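(* Let $\mathbb{K}$ be a field, $n\ge 1$, and let $q\in\mathbb{K}^*$ not be a root of unity. If $M$ is a nonzero finitely generated (right) module over the quantum Euclidean $2n$-space $\mathcal{O}_q(\mathfrak{o}\mathbb{K}^{2n})$ that is not a $\mathscr{Z}$-torsion module, then $$\operatorname{GK-dim}(M)\ \ge\ n-1=\frac{\operatorname{GK-dim}(\mathcal{O}_q(\mathfrak{o}\mathbb{K}^{2n}))}{2}-1.$$
   Context: Definition of $K_n$: let $P=(p_1,\ldots,p_n)$ and $Q=(q_1,\ldots,q_n)$ be $n$-tuples of elements of $\mathbb{K}^*$ with $p_i\ne q_i$ for all $i$, and let $\Gamma=(\gamma_{ij})$ be a multiplicatively antisymmetric $n\times n$ matrix over $\mathbb{K}$ (that is, $\gamma_{ii}=1$ and $\gamma_{ij}\gamma_{ji}=1$ for all $i,j$). The algebra $K_n=K_{n,\Gamma}^{P,Q}(\mathbb{K})$ is the $\mathbb{K}$-algebra generated by $x_1,y_1,\ldots,x_n,y_n$ subject to the relations $x_ix_j=q_ip_j^{-1}\gamma_{ij}x_jx_i$ for $i<j$; $y_iy_j=\gamma_{ij}y_jy_i$ for $i<j$; $x_iy_j=p_j\gamma_{ij}^{-1}y_jx_i$ for $i<j$; $x_iy_j=q_j\gamma_{ij}^{-1}y_jx_i$ for $i>j$; $x_iy_i-q_iy_ix_i=\sum_{l=1}^{i-1}(q_l-p_l)y_lx_l$ for all $i$. The quantum Euclidean $2n$-space $\mathcal{O}_q(\mathfrak{o}\mathbb{K}^{2n})$ is the algebra $K_{n,\Gamma}^{P,Q}(\mathbb{K})$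 with $p_i=q^{-2}$, $q_i=1$ for all $i$ and $\gamma_{ij}=q^{-1}$ for all $i<j$. The elements $z_i:=\sum_{l\le i}(q_l-p_l)y_lx_l$ ($1\le i\le n$) are normal in $K_n$ and commute with each other, and $\mathscr{Z}:=\{z_1^{j_1}\cdots z_n^{j_n}: j_i\in\mathbb{Z}_{\ge 0}\}$ is an Ore set. A module $M$ is $\mathscr{Z}$-torsion if every $m\in M$ satisfies $ms=0$ for some $s\in\mathscr{Z}$. $\operatorname{GK-dim}$ denotes Gelfand--Kirillov dimension over $\mathbb{K}$. *)

theory Defs
  imports
    "Jordan_Normal_Form.VS_Connect"
    "HOL-Algebra.QuotRing"
    "HOL-Library.Poly_Mapping"
    "HOL-Library.Extended_Real"
begin

section \<open>Algebras given by generators and relations\<close>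

text \<open>
  Algebras over a field \<open>'k\<close> are encoded as \<^type>\<open>module\<close> records over the field record
  \<^term>\<open>class_ring :: 'k::field ring\<close>: such a record carries a ring structure together with a
  scalar multiplication.  The free algebra is the monoid algebra of the free monoid; the latter is
  written additively because the convolution product of \<^type>\<open>poly_mapping\<close> is set up for
  (not necessarily commutative) additive monoids of exponents.
\<close>

datatype 'g free_monoid = Free_Monoid (letters: "'g list")

instantiation free_monoid :: (type) monoid_add
begin

definition zero_free_monoid :: "'a free_monoid" where
  "0 = Free_Monoid []"

definition plus_free_monoid :: "'a free_monoid \<Rightarrow> 'a free_monoid \<Rightarrow> 'a free_monoid" where
  "u + v = Free_Monoid (letters u @ letters v)"

instance
  by standard (simp_all add: zero_free_monoid_def plus_free_monoid_def)

end

type_synonym ('g, 'k) free_alg = "'g free_monoid \<Rightarrow>\<^sub>0 'k"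

definition fa_scalar :: "'k \<Rightarrow> ('g, 'k::field) free_alg" where
  "fa_scalar c = Poly_Mapping.single 0 c"

definition fa_gen :: "'g \<Rightarrow> ('g, 'k::field) free_alg" where
  "fa_gen g = Poly_Mapping.single (Free_Monoid [g]) 1"

definition fa_on :: "'g set \<Rightarrow> ('g, 'k::field) free_alg set" where
  "fa_on G = {f. \<forall>w \<in> Poly_Mapping.keys f. set (letters w) \<subseteq> G}"

definition free_algebra :: "'g set \<Rightarrow> ('k::field, ('g, 'k) free_alg) module" where
  "free_algebra G =
    \<lparr>carrier = fa_on G, mult = (*), one = 1, zero = 0, add = (+), smult = (\<lambda>c f. fa_scalar c * f)\<rparr>"

text \<open>The ring \<^term>\<open>A Quot I\<close> with the scalar multiplication induced by that of \<open>A\<close>.\<close>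

definition quotient_algebra :: "('k, 'a, 'e) module_scheme \<Rightarrow> 'a set \<Rightarrow> ('k, 'a set) module" where
  "quotient_algebra A I =
    \<lparr>carrier = carrier (A Quot I), mult = mult (A Quot I), one = one (A Quot I),
     zero = zero (A Quot I), add = add (A Quot I),
     smult = (\<lambda>c U. \<Union>u\<in>U. I +>\<^bsub>A\<^esub> (c \<odot>\<^bsub>A\<^esub> u))\<rparr>"

definition relation_ideal :: "'g set \<Rightarrow> ('g, 'k::field) free_alg set \<Rightarrow> ('g, 'k) free_alg set" where
  "relation_ideal G R = Idl\<^bsub>free_algebra G\<^esub> R"

text \<open>The algebra generated by \<open>G\<close> subject to the relations \<open>r = 0\<close> for \<open>r \<in> R\<close>.\<close>

definition presented_algebra ::
    "'g set \<Rightarrow> ('g, 'k::field) free_alg set \<Rightarrow> ('k, ('g, 'k) free_alg set) module" where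
  "presented_algebra G R = quotient_algebra (free_algebra G) (relation_ideal G R)"

lemma keys_fa_scalar: "Poly_Mapping.keys (fa_scalar c) \<subseteq> {0}"
  by (simp add: fa_scalar_def)

lemma fa_scalar_add: "fa_scalar (c + d) = fa_scalar c + fa_scalar d"
  by (simp add: fa_scalar_def single_add)

lemma fa_scalar_mult: "fa_scalar (c * d) = fa_scalar c * fa_scalar d"
  by (simp add: fa_scalar_def mult_single)

lemma fa_scalar_1: "fa_scalar 1 = 1"
  by (simp add: fa_scalar_def)

lemma fa_scalar_commute: "fa_scalar c * f = f * fa_scalar c"
proof (induction f rule: update_induct)
  case const
  then show ?case by simp
next
  case (update f w d)
  have "Poly_Mapping.update w d f = f + Poly_Mapping.single w d"
    using update(1) by (intro poly_mapping_eqI) (auto simp: lookup_update lookup_add lookup_single in_keys_iff)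
  then show ?case using update by (simp add: distrib_left distrib_right)
     (simp add: fa_scalar_def mult_single mult.commute)
qed

lemma carrier_free_algebra: "carrier (free_algebra G) = fa_on G"
  by (simp add: free_algebra_def fa_on_def)

lemma fa_on_0: "0 \<in> fa_on G" by (simp add: fa_on_def)

lemma fa_on_add: "f \<in> fa_on G \<Longrightarrow> g \<in> fa_on G \<Longrightarrow> f + g \<in> fa_on G"
  using keys_add[of f g] unfolding fa_on_def by blast

lemma fa_on_uminus: "f \<in> fa_on G \<Longrightarrow> - f \<in> fa_on G"
  by (simp add: fa_on_def)

lemma fa_on_mult: "f \<in> fa_on G \<Longrightarrow> g \<in> fa_on G \<Longrightarrow> f * g \<in> fa_on G"
  using keys_mult[of f g] unfolding fa_on_def by (fastforce simp: plus_free_monoid_def)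

lemma fa_on_scalar: "fa_scalar c \<in> fa_on G"
  using keys_fa_scalar[of c] by (force simp: fa_on_def zero_free_monoid_def)

lemma fa_on_gen: "g \<in> G \<Longrightarrow> fa_gen g \<in> fa_on G"
  by (simp add: fa_on_def fa_gen_def)

lemma fa_on_diff: "f \<in> fa_on G \<Longrightarrow> g \<in> fa_on G \<Longrightarrow> f - g \<in> fa_on G"
  using fa_on_add[of f G "-g"] fa_on_uminus[of g G] by simp

lemma fa_on_sum: "(\<And>i. i \<in> I \<Longrightarrow> f i \<in> fa_on G) \<Longrightarrow> (\<Sum>i\<in>I. f i) \<in> fa_on G"
  by (induction I rule: infinite_finite_induct) (simp_all add: fa_on_0 fa_on_add)

lemma ring_free_algebra: "ring (free_algebra G)"
proof (rule ringI)
  show "abelian_group (free_algebra G)"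
  proof (rule abelian_groupI)
    fix f assume "f \<in> carrier (free_algebra G)"
    then show "\<exists>g\<in>carrier (free_algebra G). g \<oplus>\<^bsub>free_algebra G\<^esub> f = \<zero>\<^bsub>free_algebra G\<^esub>"
      by (intro bexI[of _ "- f"]) (auto simp: carrier_free_algebra fa_on_uminus, simp add: free_algebra_def)
  qed (simp_all add: carrier_free_algebra, simp_all add: free_algebra_def fa_on_add fa_on_0 add.assoc add.commute)
  show "Group.monoid (free_algebra G)"
    by (rule monoidI)
      (simp_all add: carrier_free_algebra, simp_all add: free_algebra_def fa_on_mult mult.assoc
        fa_on_scalar[of 1 G, unfolded fa_scalar_1])
qed (auto simp: free_algebra_def distrib_left distrib_right)

lemma vectorspace_free_algebra: "vectorspace (class_ring :: 'k ring) (free_algebra (G :: 'a set) :: ('k::field,_) module)"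
proof -
  interpret R: ring "free_algebra G :: ('k::field,_) module" by (rule ring_free_algebra)
  have "Module.module (class_ring :: 'k ring) (free_algebra G)"
  proof (rule moduleI)
    fix c :: 'k and f :: "('a, 'k) free_alg" assume "f \<in> carrier (free_algebra G)"
    then have "fa_scalar c * f \<in> fa_on G" by (auto simp: carrier_free_algebra intro: fa_on_mult fa_on_scalar)
    then show "c \<odot>\<^bsub>free_algebra G\<^esub> f \<in> carrier (free_algebra G)"
      by (simp add: carrier_free_algebra) (simp add: free_algebra_def)
  qed (auto simp: class_cring.cring_axioms R.abelian_group_axioms, auto simp: free_algebra_def fa_scalar_add fa_scalar_mult fa_scalar_1
     distrib_left distrib_right mult.assoc class_ring_simps)
  then show ?thesis by (rule vectorspace.intro[OF _ class_field])
qed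

lemma smult_free_algebra: "c \<odot>\<^bsub>free_algebra G\<^esub> f = fa_scalar c \<otimes>\<^bsub>free_algebra G\<^esub> f"
  by (simp add: free_algebra_def)

text \<open>The next lemmas check that the constructions above yield rings and vector spaces.\<close>

locale presentation =
  fixes G :: "'g set" and R :: "('g, 'k::field) free_alg set"
  assumes relations_subset: "R \<subseteq> carrier (free_algebra G)"
begin

abbreviation "FG \<equiv> free_algebra G :: ('k, ('g, 'k) free_alg) module"
abbreviation "I \<equiv> relation_ideal G R"
abbreviation "PA \<equiv> presented_algebra G R"

lemma ideal_relation_ideal: "ideal I FG"
  unfolding relation_ideal_def using ring.genideal_ideal[OF ring_free_algebra relations_subset] .

lemma presented_simps: "carrier PA = carrier (FG Quot I)" "mult PA = mult (FG Quot I)"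
  "add PA = add (FG Quot I)" "one PA = one (FG Quot I)" "zero PA = zero (FG Quot I)"
  by (auto simp: presented_algebra_def quotient_algebra_def)

lemma ring_presented: "ring PA"
proof -
  interpret Q: ring "FG Quot I" by (rule ideal.quotient_is_ring[OF ideal_relation_ideal])
  have "abelian_group PA"
  proof (rule abelian_groupI, unfold presented_simps)
    fix x assume "x \<in> carrier (FG Quot I)"
    then show "\<exists>y\<in>carrier (FG Quot I). y \<oplus>\<^bsub>FG Quot I\<^esub> x = \<zero>\<^bsub>FG Quot I\<^esub>"
      using Q.a_inv_closed Q.l_neg by blast
  qed (rule Q.a_assoc Q.a_comm Q.l_zero Q.zero_closed Q.a_closed; assumption)+
  moreover have "Group.monoid PA"
    by (rule monoidI) (simp_all add: presented_simps Q.m_assoc)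
  ultimately show ?thesis
    by (intro ringI) (simp_all add: presented_simps Q.l_distr Q.r_distr)
qed

lemma smult_presented_coset:
  assumes "f \<in> carrier FG"
  shows "c \<odot>\<^bsub>PA\<^esub> (I +>\<^bsub>FG\<^esub> f) = I +>\<^bsub>FG\<^esub> (fa_scalar c * f)"
proof -
  interpret J: ideal I FG by (rule ideal_relation_ideal)
  have m: "fa_scalar c \<otimes>\<^bsub>FG\<^esub> f = fa_scalar c * f" for f by (simp add: free_algebra_def)
  have sc: "fa_scalar c \<in> carrier FG" by (simp add: carrier_free_algebra fa_on_scalar)
  have sub: "g \<in> carrier FG \<and> I +>\<^bsub>FG\<^esub> (fa_scalar c \<otimes>\<^bsub>FG\<^esub> g) = I +>\<^bsub>FG\<^esub> (fa_scalar c \<otimes>\<^bsub>FG\<^esub> f)" if g: "g \<in> I +>\<^bsub>FG\<^esub> f" for g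
  proof -
    obtain h where h: "h \<in> I" "g = h \<oplus>\<^bsub>FG\<^esub> f" using g by (auto simp: a_r_coset_def r_coset_def)
    have "fa_scalar c \<otimes>\<^bsub>FG\<^esub> g = fa_scalar c \<otimes>\<^bsub>FG\<^esub> h \<oplus>\<^bsub>FG\<^esub> fa_scalar c \<otimes>\<^bsub>FG\<^esub> f"
      using h assms sc J.Icarr by (simp add: J.r_distr)
    moreover have "fa_scalar c \<otimes>\<^bsub>FG\<^esub> h \<in> I" using h sc J.I_l_closed by blast
    ultimately have "fa_scalar c \<otimes>\<^bsub>FG\<^esub> g \<in> I +>\<^bsub>FG\<^esub> (fa_scalar c \<otimes>\<^bsub>FG\<^esub> f)"
      by (auto simp: a_r_coset_def r_coset_def)
    then show ?thesis using J.a_repr_independence[OF _ _ J.a_subgroup] h assms sc J.Icarr by auto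
  qed
  have "f \<in> I +>\<^bsub>FG\<^esub> f" using assms J.a_rcos_self by blast
  moreover have "c \<odot>\<^bsub>PA\<^esub> (I +>\<^bsub>FG\<^esub> f) = (\<Union>g\<in>I +>\<^bsub>FG\<^esub> f. I +>\<^bsub>FG\<^esub> (fa_scalar c \<otimes>\<^bsub>FG\<^esub> g))"
    by (simp only: presented_algebra_def quotient_algebra_def module.simps smult_free_algebra)
  ultimately show ?thesis using sub by (metis (no_types, lifting) UN_constant_eq m)
qed

lemma vectorspace_presented: "vectorspace (class_ring :: 'k ring) PA"
proof -
  interpret J: ideal I FG by (rule ideal_relation_ideal)
  interpret P: ring PA by (rule ring_presented)
  interpret V: vectorspace "class_ring :: 'k ring" FG by (rule vectorspace_free_algebra)
  have add: "(I +>\<^bsub>FG\<^esub> f) \<oplus>\<^bsub>PA\<^esub> (I +>\<^bsub>FG\<^esub> g) = I +>\<^bsub>FG\<^esub> (f + g)" if "f \<in> carrier FG" "g \<in> carrier FG" for f g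
    using J.a_rcos_sum[OF that] by (simp add: presented_simps FactRing_def) (simp add: free_algebra_def)
  have rep: "\<exists>f\<in>carrier FG. u = I +>\<^bsub>FG\<^esub> f" if "u \<in> carrier PA" for u
    using that by (auto simp: presented_simps FactRing_simps)
  have inn: "I +>\<^bsub>FG\<^esub> f \<in> carrier PA" if "f \<in> carrier FG" for f
    using that by (auto simp: presented_simps FactRing_simps)
  have sc: "fa_scalar c * f \<in> carrier FG" if "f \<in> carrier FG" for c :: 'k and f
    using that by (auto simp: carrier_free_algebra intro: fa_on_mult fa_on_scalar)
  have ad: "f + g \<in> carrier FG" if "f \<in> carrier FG" "g \<in> carrier FG" for f g
    using that by (auto simp: carrier_free_algebra intro: fa_on_add)
  have "Module.module (class_ring :: 'k ring) PA"
  proof (rule moduleI)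
    fix c d :: 'k and u v assume u: "u \<in> carrier PA"
    then obtain f where f: "f \<in> carrier FG" "u = I +>\<^bsub>FG\<^esub> f" using rep by meson
    show "c \<odot>\<^bsub>PA\<^esub> u \<in> carrier PA" unfolding f(2) smult_presented_coset[OF f(1)] by (intro inn sc f)
    show "(c \<oplus>\<^bsub>class_ring\<^esub> d) \<odot>\<^bsub>PA\<^esub> u = c \<odot>\<^bsub>PA\<^esub> u \<oplus>\<^bsub>PA\<^esub> d \<odot>\<^bsub>PA\<^esub> u"
      unfolding f(2) smult_presented_coset[OF f(1)] add[OF sc[OF f(1)] sc[OF f(1)]] by (simp add: fa_scalar_add distrib_right)
    show "(c \<otimes>\<^bsub>class_ring\<^esub> d) \<odot>\<^bsub>PA\<^esub> u = c \<odot>\<^bsub>PA\<^esub> (d \<odot>\<^bsub>PA\<^esub> u)"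
      unfolding f(2) smult_presented_coset[OF f(1)] smult_presented_coset[OF sc[OF f(1)]] by (simp add: fa_scalar_mult mult.assoc)
    show "\<one>\<^bsub>class_ring\<^esub> \<odot>\<^bsub>PA\<^esub> u = u"
      unfolding f(2) smult_presented_coset[OF f(1)] by (simp add: fa_scalar_1)
    assume "v \<in> carrier PA"
    then obtain g where g: "g \<in> carrier FG" "v = I +>\<^bsub>FG\<^esub> g" using rep by meson
    show "c \<odot>\<^bsub>PA\<^esub> (u \<oplus>\<^bsub>PA\<^esub> v) = c \<odot>\<^bsub>PA\<^esub> u \<oplus>\<^bsub>PA\<^esub> c \<odot>\<^bsub>PA\<^esub> v"
      unfolding f(2) g(2) add[OF f(1) g(1)] smult_presented_coset[OF f(1)] smult_presented_coset[OF g(1)] smult_presented_coset[OF ad[OF f(1) g(1)]]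
        add[OF sc[OF f(1)] sc[OF g(1)]] by (simp add: distrib_left)
  qed (simp_all add: class_cring.cring_axioms P.abelian_group_axioms)
  then show ?thesis by (rule vectorspace.intro[OF _ class_field])
qed

lemma smult_presented_mult:
  assumes "u \<in> carrier PA" "v \<in> carrier PA"
  shows "c \<odot>\<^bsub>PA\<^esub> (u \<otimes>\<^bsub>PA\<^esub> v) = (c \<odot>\<^bsub>PA\<^esub> u) \<otimes>\<^bsub>PA\<^esub> v" "c \<odot>\<^bsub>PA\<^esub> (u \<otimes>\<^bsub>PA\<^esub> v) = u \<otimes>\<^bsub>PA\<^esub> (c \<odot>\<^bsub>PA\<^esub> v)"
proof -
  interpret J: ideal I FG by (rule ideal_relation_ideal)
  have mul: "(I +>\<^bsub>FG\<^esub> f) \<otimes>\<^bsub>PA\<^esub> (I +>\<^bsub>FG\<^esub> g) = I +>\<^bsub>FG\<^esub> (f * g)" if "f \<in> carrier FG" "g \<in> carrier FG" for f g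
    using J.rcoset_mult_add[OF that] by (simp add: presented_simps FactRing_def) (simp add: free_algebra_def)
  have rep: "\<exists>f\<in>carrier FG. u = I +>\<^bsub>FG\<^esub> f" if "u \<in> carrier PA" for u
    using that by (auto simp: presented_simps FactRing_simps)
  have sc: "fa_scalar c * f \<in> carrier FG" if "f \<in> carrier FG" for c :: 'k and f
    using that by (auto simp: carrier_free_algebra intro: fa_on_mult fa_on_scalar)
  have ad: "f * g \<in> carrier FG" if "f \<in> carrier FG" "g \<in> carrier FG" for f g
    using that by (auto simp: carrier_free_algebra intro: fa_on_mult)
  obtain f g where fg: "f\<in>carrier FG" "g \<in> carrier FG" "u = I +>\<^bsub>FG\<^esub> f" "v = I +>\<^bsub>FG\<^esub> g" using rep assms by meson
  show "c \<odot>\<^bsub>PA\<^esub> (u \<otimes>\<^bsub>PA\<^esub> v) = (c \<odot>\<^bsub>PA\<^esub> u) \<otimes>\<^bsub>PA\<^esub> v" "c \<odot>\<^bsub>PA\<^esub> (u \<otimes>\<^bsub>PA\<^esub> v) = u \<otimes>\<^bsub>PA\<^esub> (c \<odot>\<^bsub>PA\<^esub> v)"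
    unfolding fg(3,4) mul[OF fg(1,2)] smult_presented_coset[OF fg(1)] smult_presented_coset[OF fg(2)] smult_presented_coset[OF ad[OF fg(1,2)]]
      mul[OF sc[OF fg(1)] fg(2)] mul[OF fg(1) sc[OF fg(2)]]
    by (simp_all only: mult.assoc[symmetric] fa_scalar_commute[of c f])
qed

end

section \<open>The algebras \<open>K\<^sub>n\<close> and quantum Euclidean space\<close>

datatype gen = X (index: nat) | Y (index: nat)

definition Kn_gens :: "nat \<Rightarrow> gen set" where
  "Kn_gens n = {g. index g \<in> {1..n}}"

definition Kn_relations ::
    "nat \<Rightarrow> (nat \<Rightarrow> 'k::field) \<Rightarrow> (nat \<Rightarrow> 'k) \<Rightarrow> (nat \<Rightarrow> nat \<Rightarrow> 'k) \<Rightarrow> (gen, 'k) free_alg set" where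
  "Kn_relations n p q \<gamma> =
    (let x = (\<lambda>i. fa_gen (X i)); y = (\<lambda>i. fa_gen (Y i)); s = fa_scalar in
      {x i * x j - s (q i * inverse (p j) * \<gamma> i j) * x j * x i | i j. 1 \<le> i \<and> i < j \<and> j \<le> n}
    \<union> {y i * y j - s (\<gamma> i j) * y j * y i | i j. 1 \<le> i \<and> i < j \<and> j \<le> n}
    \<union> {x i * y j - s (p j * inverse (\<gamma> i j)) * y j * x i | i j. 1 \<le> i \<and> i < j \<and> j \<le> n}
    \<union> {x i * y j - s (q j * inverse (\<gamma> i j)) * y j * x i | i j. 1 \<le> j \<and> j < i \<and> i \<le> n}
    \<union> {x i * y i - s (q i) * y i * x i - (\<Sum>l = 1..i - 1. s (q l - p l) * y l * x l)
        | i. 1 \<le> i \<and> i \<le> n})"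

lemma Kn_relations_subset: "Kn_relations n p q \<gamma> \<subseteq> carrier (free_algebra (Kn_gens n))"
  unfolding Kn_relations_def Let_def carrier_free_algebra
  by (intro Un_least subsetI; elim CollectE exE conjE; simp only:)
    (auto intro!: fa_on_diff fa_on_mult fa_on_sum fa_on_scalar fa_on_gen simp: Kn_gens_def)

lemma Kn_presentation: "presentation (Kn_gens n) (Kn_relations n p q \<gamma>)"
  by (rule presentation.intro[OF Kn_relations_subset])

definition Kn_algebra ::
    "nat \<Rightarrow> (nat \<Rightarrow> 'k::field) \<Rightarrow> (nat \<Rightarrow> 'k) \<Rightarrow> (nat \<Rightarrow> nat \<Rightarrow> 'k)
      \<Rightarrow> ('k, (gen, 'k) free_alg set) module" where
  "Kn_algebra n p q \<gamma> = presented_algebra (Kn_gens n) (Kn_relations n p q \<gamma>)"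

definition Kn_z ::
    "nat \<Rightarrow> (nat \<Rightarrow> 'k::field) \<Rightarrow> (nat \<Rightarrow> 'k) \<Rightarrow> (nat \<Rightarrow> nat \<Rightarrow> 'k) \<Rightarrow> nat \<Rightarrow> (gen, 'k) free_alg set" where
  "Kn_z n p q \<gamma> i =
    relation_ideal (Kn_gens n) (Kn_relations n p q \<gamma>) +>\<^bsub>free_algebra (Kn_gens n)\<^esub>
      (\<Sum>l = 1..i. fa_scalar (q l - p l) * fa_gen (Y l) * fa_gen (X l))"

text \<open>The set of all products \<open>z\<^sub>1\<^bsup>j 1\<^esup> \<cdots> z\<^sub>n\<^bsup>j n\<^esup>\<close>.\<close>

definition Kn_Z ::
    "nat \<Rightarrow> (nat \<Rightarrow> 'k::field) \<Rightarrow> (nat \<Rightarrow> 'k) \<Rightarrow> (nat \<Rightarrow> nat \<Rightarrow> 'k) \<Rightarrow> (gen, 'k) free_alg set set" where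
  "Kn_Z n p q \<gamma> =
    (let A = Kn_algebra n p q \<gamma> in
      {foldr (\<lambda>i a. (Kn_z n p q \<gamma> i [^]\<^bsub>A\<^esub> j i) \<otimes>\<^bsub>A\<^esub> a) [1..<Suc n] \<one>\<^bsub>A\<^esub> | j :: nat \<Rightarrow> nat. True})"

text \<open>
  In the presentation of \<open>K\<^sub>n\<close> the parameters \<open>p\<close>, \<open>q\<close>, \<open>\<gamma>\<close> are subject to the following conditions.
\<close>

definition Kn_parameters ::
    "nat \<Rightarrow> (nat \<Rightarrow> 'k::field) \<Rightarrow> (nat \<Rightarrow> 'k) \<Rightarrow> (nat \<Rightarrow> nat \<Rightarrow> 'k) \<Rightarrow> bool" where
  "Kn_parameters n p q \<gamma> \<longleftrightarrow>
    (\<forall>i\<in>{1..n}. p i \<noteq> 0 \<and> q i \<noteq> 0 \<and> p i \<noteq> q i) \<and>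
    (\<forall>i\<in>{1..n}. \<gamma> i i = 1) \<and> (\<forall>i\<in>{1..n}. \<forall>j\<in>{1..n}. \<gamma> i j * \<gamma> j i = 1)"

definition qe_p :: "'k::field \<Rightarrow> nat \<Rightarrow> 'k" where
  "qe_p q i = inverse (q ^ 2)"

definition qe_q :: "nat \<Rightarrow> 'k::field" where
  "qe_q i = 1"

definition qe_gamma :: "'k::field \<Rightarrow> nat \<Rightarrow> nat \<Rightarrow> 'k" where
  "qe_gamma q i j = (if i < j then inverse q else if i = j then 1 else q)"

lemma qe_parameters:
  assumes "q \<noteq> 0" "\<And>k::nat. k \<ge> 1 \<Longrightarrow> q ^ k \<noteq> 1"
  shows "Kn_parameters n (qe_p q) qe_q (qe_gamma q)"
proof -
  have "inverse (q ^ 2) \<noteq> 1"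
    using assms(2)[of 2] inverse_eq_1_iff[of "q ^ 2"] by simp
  then show ?thesis
    using assms(1) unfolding Kn_parameters_def qe_p_def qe_q_def qe_gamma_def by auto
qed

definition quantum_euclidean :: "nat \<Rightarrow> 'k::field \<Rightarrow> ('k, (gen, 'k) free_alg set) module" where
  "quantum_euclidean n q = Kn_algebra n (qe_p q) qe_q (qe_gamma q)"

definition quantum_euclidean_Z :: "nat \<Rightarrow> 'k::field \<Rightarrow> (gen, 'k) free_alg set set" where
  "quantum_euclidean_Z n q = Kn_Z n (qe_p q) qe_q (qe_gamma q)"

section \<open>Right modules\<close>

text \<open>
  A right module over a not necessarily commutative ring \<open>A\<close> is again a \<^type>\<open>module\<close> record \<open>M\<close>;
  the element \<open>a \<odot>\<^bsub>M\<^esub> m\<close> stands for the right action \<open>m a\<close>, whence the order of the factors in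
  \<open>smult_assoc\<close>.
\<close>

locale right_module = A?: ring A + M?: abelian_group M
    for A :: "('a, 'c) ring_scheme" (structure) and M :: "('a, 'm, 'e) module_scheme" (structure) +
  assumes smult_closed: "a \<in> carrier A \<Longrightarrow> m \<in> carrier M \<Longrightarrow> a \<odot>\<^bsub>M\<^esub> m \<in> carrier M"
    and smult_add_ring: "a \<in> carrier A \<Longrightarrow> b \<in> carrier A \<Longrightarrow> m \<in> carrier M \<Longrightarrow>
      (a \<oplus>\<^bsub>A\<^esub> b) \<odot>\<^bsub>M\<^esub> m = a \<odot>\<^bsub>M\<^esub> m \<oplus>\<^bsub>M\<^esub> b \<odot>\<^bsub>M\<^esub> m"
    and smult_add_module: "a \<in> carrier A \<Longrightarrow> m \<in> carrier M \<Longrightarrow> m' \<in> carrier M \<Longrightarrow>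
      a \<odot>\<^bsub>M\<^esub> (m \<oplus>\<^bsub>M\<^esub> m') = a \<odot>\<^bsub>M\<^esub> m \<oplus>\<^bsub>M\<^esub> a \<odot>\<^bsub>M\<^esub> m'"
    and smult_assoc: "a \<in> carrier A \<Longrightarrow> b \<in> carrier A \<Longrightarrow> m \<in> carrier M \<Longrightarrow>
      (a \<otimes>\<^bsub>A\<^esub> b) \<odot>\<^bsub>M\<^esub> m = b \<odot>\<^bsub>M\<^esub> (a \<odot>\<^bsub>M\<^esub> m)"
    and smult_one: "m \<in> carrier M \<Longrightarrow> \<one>\<^bsub>A\<^esub> \<odot>\<^bsub>M\<^esub> m = m"

definition fin_gen_module :: "('a, 'c) ring_scheme \<Rightarrow> ('a, 'm, 'e) module_scheme \<Rightarrow> bool" where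
  "fin_gen_module A M \<longleftrightarrow>
    (\<exists>S. finite S \<and> S \<subseteq> carrier M \<and>
      carrier M = {\<Oplus>\<^bsub>M\<^esub>s\<in>S. a s \<odot>\<^bsub>M\<^esub> s | a. a \<in> S \<rightarrow> carrier A})"

definition torsion_module :: "'a set \<Rightarrow> ('a, 'm, 'e) module_scheme \<Rightarrow> bool" where
  "torsion_module S M \<longleftrightarrow> (\<forall>m\<in>carrier M. \<exists>s\<in>S. s \<odot>\<^bsub>M\<^esub> m = \<zero>\<^bsub>M\<^esub>)"

text \<open>The vector space underlying a right module over a \<open>'k\<close>-algebra: \<open>c\<close> acts as \<open>c \<odot>\<^bsub>A\<^esub> \<one>\<^bsub>A\<^esub>\<close>.\<close>

definition underlying_space ::
    "('k, 'a, 'c) module_scheme \<Rightarrow> ('a, 'm, 'e) module_scheme \<Rightarrow> ('k, 'm) module" where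
  "underlying_space A M =
    \<lparr>carrier = carrier M, mult = mult M, one = one M, zero = zero M, add = add M,
     smult = (\<lambda>c m. (c \<odot>\<^bsub>A\<^esub> \<one>\<^bsub>A\<^esub>) \<odot>\<^bsub>M\<^esub> m)\<rparr>"

context presentation
begin

lemma vectorspace_underlying_space:
  assumes "right_module PA M"
  shows "vectorspace (class_ring :: 'k ring) (underlying_space PA M)"
proof -
  interpret M: right_module PA M by fact
  interpret V: vectorspace "class_ring :: 'k ring" PA by (rule vectorspace_presented)
  have sa: "(c*d) \<odot>\<^bsub>PA\<^esub> \<one>\<^bsub>PA\<^esub> = (d \<odot>\<^bsub>PA\<^esub> \<one>\<^bsub>PA\<^esub>) \<otimes>\<^bsub>PA\<^esub> (c \<odot>\<^bsub>PA\<^esub> \<one>\<^bsub>PA\<^esub>)" for c d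
    using smult_presented_mult(1)[of "\<one>\<^bsub>PA\<^esub>" "c \<odot>\<^bsub>PA\<^esub> \<one>\<^bsub>PA\<^esub>" d] V.smult_assoc1[of d c "\<one>\<^bsub>PA\<^esub>"] V.smult_closed[of c "\<one>\<^bsub>PA\<^esub>"]
     V.smult_closed[of d "\<one>\<^bsub>PA\<^esub>"]
    by (simp add: class_ring_simps mult.commute)
  have cl: "c \<odot>\<^bsub>PA\<^esub> \<one>\<^bsub>PA\<^esub> \<in> carrier PA" for c using V.smult_closed[of c "\<one>\<^bsub>PA\<^esub>"] by simp
  have us: "carrier (underlying_space PA M) = carrier M" "add (underlying_space PA M) = add M"
    "zero (underlying_space PA M) = zero M"
    "\<And>c m. c \<odot>\<^bsub>underlying_space PA M\<^esub> m = (c \<odot>\<^bsub>PA\<^esub> \<one>\<^bsub>PA\<^esub>) \<odot>\<^bsub>M\<^esub> m"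
    by (simp_all add: underlying_space_def)
  have ab: "abelian_group (underlying_space PA M)"
  proof (rule abelian_groupI, unfold us)
    fix x assume "x \<in> carrier M"
    then show "\<exists>y\<in>carrier M. y \<oplus>\<^bsub>M\<^esub> x = \<zero>\<^bsub>M\<^esub>"
      using M.M.a_inv_closed M.M.l_neg by blast
  qed (rule M.M.a_assoc M.M.a_comm M.M.l_zero M.M.zero_closed M.M.a_closed; assumption)+
  have "Module.module (class_ring :: 'k ring) (underlying_space PA M)"
  proof (rule moduleI, unfold us)
    fix c d :: 'k and x y assume x: "x \<in> carrier M"
    show "(c \<odot>\<^bsub>PA\<^esub> \<one>\<^bsub>PA\<^esub>) \<odot>\<^bsub>M\<^esub> x \<in> carrier M"
      using M.smult_closed[OF cl x] .
    show "((c \<oplus>\<^bsub>class_ring\<^esub> d) \<odot>\<^bsub>PA\<^esub> \<one>\<^bsub>PA\<^esub>) \<odot>\<^bsub>M\<^esub> x =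
        (c \<odot>\<^bsub>PA\<^esub> \<one>\<^bsub>PA\<^esub>) \<odot>\<^bsub>M\<^esub> x \<oplus>\<^bsub>M\<^esub> (d \<odot>\<^bsub>PA\<^esub> \<one>\<^bsub>PA\<^esub>) \<odot>\<^bsub>M\<^esub> x"
      using M.smult_add_ring[OF cl cl x] V.smult_l_distr[of c d "\<one>\<^bsub>PA\<^esub>"] by simp
    show "((c \<otimes>\<^bsub>class_ring\<^esub> d) \<odot>\<^bsub>PA\<^esub> \<one>\<^bsub>PA\<^esub>) \<odot>\<^bsub>M\<^esub> x =
        (c \<odot>\<^bsub>PA\<^esub> \<one>\<^bsub>PA\<^esub>) \<odot>\<^bsub>M\<^esub> ((d \<odot>\<^bsub>PA\<^esub> \<one>\<^bsub>PA\<^esub>) \<odot>\<^bsub>M\<^esub> x)"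
      using M.smult_assoc[OF cl cl x] sa by simp
    show "(\<one>\<^bsub>class_ring\<^esub> \<odot>\<^bsub>PA\<^esub> \<one>\<^bsub>PA\<^esub>) \<odot>\<^bsub>M\<^esub> x = x"
      using V.smult_one[of "\<one>\<^bsub>PA\<^esub>"] M.smult_one[OF x] by simp
    assume y: "y \<in> carrier M"
    show "(c \<odot>\<^bsub>PA\<^esub> \<one>\<^bsub>PA\<^esub>) \<odot>\<^bsub>M\<^esub> (x \<oplus>\<^bsub>M\<^esub> y) =
        (c \<odot>\<^bsub>PA\<^esub> \<one>\<^bsub>PA\<^esub>) \<odot>\<^bsub>M\<^esub> x \<oplus>\<^bsub>M\<^esub> (c \<odot>\<^bsub>PA\<^esub> \<one>\<^bsub>PA\<^esub>) \<odot>\<^bsub>M\<^esub> y"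
      using M.smult_add_module[OF cl x y] .
  qed (rule class_cring.cring_axioms ab)+
  then show ?thesis by (rule vectorspace.intro[OF _ class_field])
qed

end

section \<open>Gelfand--Kirillov dimension\<close>

definition vs_span :: "('k::field, 'v, 'e) module_scheme \<Rightarrow> 'v set \<Rightarrow> 'v set" where
  "vs_span V S = LinearCombinations.module.span class_ring V S"

definition subspace_dim :: "('k::field, 'v, 'e) module_scheme \<Rightarrow> 'v set \<Rightarrow> nat" where
  "subspace_dim V W = vectorspace.dim (class_ring :: 'k ring) (V\<lparr>carrier := W\<rparr>)"

definition fd_subspaces :: "('k::field, 'v, 'e) module_scheme \<Rightarrow> 'v set set" where
  "fd_subspaces V =
    {W. VectorSpace.subspace (class_ring :: 'k ring) W V \<and>
        vectorspace.fin_dim (class_ring :: 'k ring) (V\<lparr>carrier := W\<rparr>)}"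

text \<open>\<open>V\<^sup>0 + V\<^sup>1 + \<cdots> + V\<^sup>k\<close>, with \<open>V\<^sup>0\<close> the line spanned by \<open>\<one>\<close>\<close>

definition power_sum :: "('k::field, 'a, 'e) module_scheme \<Rightarrow> 'a set \<Rightarrow> nat \<Rightarrow> 'a set" where
  "power_sum A V k =
    vs_span A {foldr (\<otimes>\<^bsub>A\<^esub>) vs \<one>\<^bsub>A\<^esub> | vs. length vs \<le> k \<and> set vs \<subseteq> V}"

text \<open>The subspace \<open>F W\<close> of \<open>M\<close>, for subspaces \<open>F\<close> of \<open>M\<close> and \<open>W\<close> of \<open>A\<close>\<close>

definition act_span ::
    "('k::field, 'a, 'c) module_scheme \<Rightarrow> ('a, 'm, 'e) module_scheme \<Rightarrow> 'm set \<Rightarrow> 'a set \<Rightarrow> 'm set" where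
  "act_span A M F W = vs_span (underlying_space A M) {a \<odot>\<^bsub>M\<^esub> m | a m. a \<in> W \<and> m \<in> F}"

definition growth_exponent :: "(nat \<Rightarrow> nat) \<Rightarrow> ereal" where
  "growth_exponent d = limsup (\<lambda>k. ereal (log (real k) (real (d k))))"

definition GK_dim :: "('k::field, 'a, 'e) module_scheme \<Rightarrow> ereal" where
  "GK_dim A = (SUP V\<in>fd_subspaces A. growth_exponent (\<lambda>k. subspace_dim A (power_sum A V k)))"

text \<open>
  For \<open>M = 0\<close> this gives 0, since \<open>ln 0 = 0\<close>; for \<open>M \<noteq> 0\<close> the term for \<open>F = 0\<close> does not affect
  the supremum.
\<close>

definition GK_dim_module ::
    "('k::field, 'a, 'c) module_scheme \<Rightarrow> ('a, 'm, 'e) module_scheme \<Rightarrow> ereal" where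
  "GK_dim_module A M =
    (SUP V\<in>fd_subspaces A. SUP F\<in>fd_subspaces (underlying_space A M).
      growth_exponent (\<lambda>k. subspace_dim (underlying_space A M) (act_span A M F (power_sum A V k))))"

end

(*
Write x_i y_i - y_i x_i = z_{i-1} and z_i = z_{i-1} + (1 - q^-2) y_i x_i.  The z_i commute with each other,
z_i commutes with x_j, y_j for j <= i, and z_i x_j = q^2 x_j z_i, z_i y_j = q^-2 y_j z_i for j > i.

Lower bound for M: start with a vector m that no product of the z_i kills.  For j = 2, ..., n, either
no power of x_j introduces torsion, or, after replacing m by some nonzero m w x_j^(k-1), the vector m
is killed by x_j; then the commutator formula for y_j^t x_j shows that no power of y_j introduces
torsion.  One ends with letters w_j in {x_j, y_j} such that no monomial in w_2, ..., w_n, z_1, ..., z_{n-1}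
kills m.  These 2(n-1) elements commute up to powers of q, with a nondegenerate exponent matrix.  As in
Bernstein's inequality, if (k+1)^(2(n-1)) exceeded the product of the dimensions of two spaces m V^{ak}, m V^{bk},
some combination of the monomials with exponents <= k would vanish on the first of them; conjugating it
by monomials separates its terms and gives a monomial killing m.  Hence the dimensions grow at least
like k^(n-1).

The dimension of the algebra is 2n: ordered monomials in the y_i, x_i span, and in the representation
below the monomials z^a x^b are linearly independent.
*)
theory Submission
  imports Defs "HOL-Computational_Algebra.Polynomial"
begin

section \<open>Finite-dimensional subspaces and functionals\<close>

text \<open>The bound is \<open>n - 1\<close> and not \<open>n\<close> because of index 1: there the
  commutator of \<open>x 1\<close> and \<open>y 1\<close> is \<open>z 0 = 0\<close>, so a vector
  killed by \<open>x 1\<close> gives no control over \<open>y 1\<close>, and no letter is chosen.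
  Likewise \<open>z n\<close> is central and would only add a zero row to the exponent matrix. In
  that matrix the z-against-z block vanishes and the two mixed blocks are triangular with entries 0,
  2, -2; of the letter-against-letter block only the size of the entries matters. That
  \<open>q\<close> is no root of unity makes \<open>c0 = 1 - q^-2\<close> and the sums 1 + r + ... +
  r^t with r = q^-2 nonzero, and it makes distinct exponents give distinct powers of
  \<open>q\<close>. Monomials need not act invertibly on the module, so conjugation by T^g is
  imitated by putting T^h and T^g on the two sides, with h + g constant. The Bernstein argument
  bounds only a product of two dimensions, taken in degrees a k and b k. Growth exponents ignore
  linear rescaling, so each factor accounts for half of the exponent 2(n-1). The lower bound for the
  algebra needs no confluence argument: weighted shifts with polynomial coefficients supply enough
  functionals.\<close>

text \<open>Gaussian elimination by induction on the equations: the new equation is either trivial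
  on \<open>U\<close> or determines one unknown \<open>u0\<close> in terms of the others. Both lower
  bounds for dimensions below rest on this lemma.\<close>

lemma homogeneous_system:
  fixes \<alpha> :: "'e \<Rightarrow> 'u \<Rightarrow> 'k::field"
  assumes "finite E" "finite U" "card E < card U"
  shows "\<exists>c. (\<exists>u\<in>U. c u \<noteq> 0) \<and> (\<forall>e\<in>E. (\<Sum>u\<in>U. c u * \<alpha> e u) = 0)"
  using assms
proof (induction E arbitrary: U \<alpha> rule: finite_induct)
  case empty
  then obtain u where "u \<in> U" by fastforce
  then show ?case by (intro exI[of _ "\<lambda>_. 1"]) auto
next
  case (insert e E)
  show ?case
  proof (cases "\<forall>u\<in>U. \<alpha> e u = 0")
    case True
    then show ?thesis using insert.IH[of U \<alpha>] insert.prems insert.hyps by auto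
  next
    case False
    then obtain u0 where u0: "u0 \<in> U" "\<alpha> e u0 \<noteq> 0" by auto
    define U' where "U' = U - {u0}"
    \<comment> \<open>Coefficients of the remaining equations after equation \<open>e\<close> has
      been solved for \<open>u0\<close>.\<close>
    define \<beta> where "\<beta> = (\<lambda>e' u. \<alpha> e' u - \<alpha> e' u0 * \<alpha> e u / \<alpha> e u0)"
    have fin: "finite U'" and ins: "U = insert u0 U'" "u0 \<notin> U'"
      using insert.prems u0 by (auto simp: U'_def)
    then have "card E < card U'" using insert by simp
    then obtain c where c: "\<exists>u\<in>U'. c u \<noteq> 0" "\<forall>e'\<in>E. (\<Sum>u\<in>U'. c u * \<beta> e' u) = 0"
      using insert.IH[of U' \<beta>] fin by auto
    define d where "d = (\<lambda>u. if u = u0 then - (\<Sum>u\<in>U'. c u * \<alpha> e u) / \<alpha> e u0 else c u)"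
    have dU: "(\<Sum>u\<in>U'. d u * f u) = (\<Sum>u\<in>U'. c u * f u)" for f
      using ins(2) by (intro sum.cong) (auto simp: d_def)
    have split: "(\<Sum>u\<in>U. d u * f u) = - (\<Sum>u\<in>U'. c u * \<alpha> e u) / \<alpha> e u0 * f u0 + (\<Sum>u\<in>U'. c u * f u)" for f
      using ins fin dU[of f] by (simp add: d_def)
    have "(\<Sum>u\<in>U. d u * \<alpha> e' u) = 0" if "e' \<in> insert e E" for e'
    proof (cases "e' = e")
      case True
      then show ?thesis using u0 by (simp add: split)
    next
      case False
      then have "(\<Sum>u\<in>U'. c u * \<beta> e' u) = 0" using that c(2) by auto
      then show ?thesis unfolding split \<beta>_def
        by (simp add: right_diff_distrib sum_subtractf sum_distrib_left sum_distrib_right sum_divide_distrib mult_ac)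
    qed
    moreover have "\<exists>u\<in>U. d u \<noteq> 0" using c(1) ins by (auto simp: d_def)
    ultimately show ?thesis by blast
  qed
qed

text \<open>Linearity is demanded on \<open>W\<close> only, because the coordinate functions of
  \<open>dual_basis\<close> come from a definite description that says nothing outside
  \<open>W\<close>.\<close>

definition linear_functional_on :: "('k::field, 'v, 'e) module_scheme \<Rightarrow> 'v set \<Rightarrow> ('v \<Rightarrow> 'k) \<Rightarrow> bool" where
  "linear_functional_on V W \<psi> \<longleftrightarrow>
    (\<forall>u\<in>W. \<forall>v\<in>W. \<psi> (u \<oplus>\<^bsub>V\<^esub> v) = \<psi> u + \<psi> v) \<and> (\<forall>c. \<forall>u\<in>W. \<psi> (c \<odot>\<^bsub>V\<^esub> u) = c * \<psi> u)"

locale kspace = vectorspace "class_ring :: 'k ring" V for V :: "('k::field, 'v, 'e) module_scheme"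
begin

lemma carrier_K [simp]: "carrier (class_ring :: 'k ring) = UNIV" "\<And>A f. f \<in> (A :: 'z set) \<rightarrow> (UNIV :: 'k set)"
  by (simp_all add: class_ring_simps)

lemma zero_smult: "v \<in> carrier V \<Longrightarrow> (0::'k) \<odot>\<^bsub>V\<^esub> v = \<zero>\<^bsub>V\<^esub>"
  using lmult_0[of v] by (simp add: class_ring_simps)

lemma fd_subspacesD:
  assumes "W \<in> fd_subspaces V"
  shows "VectorSpace.subspace class_ring W V" "submodule class_ring W V" "vectorspace class_ring (V\<lparr>carrier := W\<rparr>)"
    "vectorspace.fin_dim class_ring (V\<lparr>carrier := W\<rparr>)" "W \<subseteq> carrier V"
  using assms subspace_is_vs submodule.subset[of class_ring W V] by (auto simp: fd_subspaces_def)

lemma linear_functional_lincomb: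
  assumes sub: "submodule class_ring W V" and \<psi>: "linear_functional_on V W \<psi>"
    and "finite B" "B \<subseteq> W"
  shows "lincomb a B \<in> W \<and> \<psi> (lincomb a B) = (\<Sum>b\<in>B. a b * \<psi> b)"
  using assms(3,4)
proof (induction B rule: finite_induct)
  case empty
  have z: "\<zero>\<^bsub>V\<^esub> \<in> W" using sub by (simp add: submodule.zero_closed)
  then have "\<psi> (0 \<odot>\<^bsub>V\<^esub> \<zero>\<^bsub>V\<^esub>) = 0 * \<psi> \<zero>\<^bsub>V\<^esub>" using \<psi> by (auto simp only: linear_functional_on_def)
  moreover have "(0::'k) \<odot>\<^bsub>V\<^esub> \<zero>\<^bsub>V\<^esub> = \<zero>\<^bsub>V\<^esub>" by simp
  ultimately show ?case using z by (simp add: lincomb_def)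
next
  case (insert b B)
  have carr: "W \<subseteq> carrier V" using sub by (rule submodule.subset)
  have "a b \<odot>\<^bsub>V\<^esub> b \<in> W" using insert sub by (auto intro!: submodule.smult_closed)
  moreover have "lincomb a (insert b B) = a b \<odot>\<^bsub>V\<^esub> b \<oplus>\<^bsub>V\<^esub> lincomb a B"
    using lincomb_insert[of B a b] insert carr by auto
  moreover have "\<psi> (a b \<odot>\<^bsub>V\<^esub> b) = a b * \<psi> b" using insert \<psi> by (auto simp: linear_functional_on_def)
  ultimately show ?case using insert \<psi> sub by (auto simp: linear_functional_on_def submodule.m_closed)
qed

text \<open>Finite dimension in the form needed later: coordinates on \<open>W\<close>, the
  expansion of every functional in them, and the fact that they separate points. Arguments about
  maps between subspaces thereby become statements about finitely many scalars.\<close>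

lemma dual_basis:
  assumes W: "W \<in> fd_subspaces V"
  shows "\<exists>B \<phi>. finite B \<and> card B = subspace_dim V W \<and> B \<subseteq> W \<and>
    (\<forall>\<psi> w. linear_functional_on V W \<psi> \<longrightarrow> w \<in> W \<longrightarrow> \<psi> w = (\<Sum>b\<in>B. \<phi> b w * \<psi> b)) \<and>
    (\<forall>b\<in>B. linear_functional_on V W (\<phi> b)) \<and>
    (\<forall>w\<in>W. (\<forall>b\<in>B. \<phi> b w = 0) \<longrightarrow> w = \<zero>\<^bsub>V\<^esub>)"
proof -
  note D = fd_subspacesD[OF W]
  interpret W: vectorspace "class_ring :: 'k ring" "V\<lparr>carrier := W\<rparr>" by (rule D(3))
  obtain B where B: "finite B" "W.basis B" using W.finite_basis_exists[OF D(4)] by blast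
  then have BW: "B \<subseteq> W" by (simp add: W.basis_def)
  have ex: "\<exists>!a. a \<in> B \<rightarrow>\<^sub>E UNIV \<and> W.lincomb a B = w" if "w \<in> W" for w
    using W.basis_criterion[OF B(1)] BW B(2) that by (simp add: class_ring_simps)
  have eq: "W.lincomb a B = lincomb a B" for a
    using lincomb_not_depend[OF B(1) BW D(2)] by simp
  \<comment> \<open>Coordinates are unique only among functions fixed to \<open>undefined\<close>
    outside \<open>B\<close>, hence the extensional function space.\<close>
  define a where "a w = (THE a. a \<in> B \<rightarrow>\<^sub>E (UNIV :: 'k set) \<and> W.lincomb a B = w)" for w
  have a: "a w \<in> B \<rightarrow>\<^sub>E UNIV" "lincomb (a w) B = w" if "w \<in> W" for w
    using theI'[OF ex[OF that]] by (simp_all add: a_def eq)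
  have uniq: "a w b = f b" if "w \<in> W" "lincomb f B = w" "b \<in> B" for w f b
  proof -
    have "lincomb (restrict f B) B = lincomb f B"
      using BW D(5) by (intro lincomb_cong) auto
    then have "restrict f B = a w" using ex[OF that(1)] a[OF that(1)] that(2) unfolding eq by (metis restrict_PiE_iff UNIV_I)
    then show ?thesis using that(3) by (metis restrict_apply')
  qed
  have BV: "B \<subseteq> carrier V" using BW D(5) by auto
  show ?thesis
  proof (intro exI[of _ B] exI[of _ "\<lambda>b w. a w b"] conjI allI ballI impI)
    show "finite B" "B \<subseteq> W" by fact+
    show "card B = subspace_dim V W" using W.dim_basis[OF B] by (simp add: subspace_dim_def)
    show "\<psi> w = (\<Sum>b\<in>B. a w b * \<psi> b)" if "linear_functional_on V W \<psi>" "w \<in> W" for \<psi> w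
      using linear_functional_lincomb[OF D(2) that(1) B(1) BW, of "a w"] a(2)[OF that(2)] by simp
    show "linear_functional_on V W (\<lambda>w. a w b)" if "b \<in> B" for b
      unfolding linear_functional_on_def
    proof (intro conjI ballI allI)
      fix u v assume uv: "u \<in> W" "v \<in> W"
      have "lincomb (\<lambda>b. a u b + a v b) B = u \<oplus>\<^bsub>V\<^esub> v"
        using lincomb_sum[OF B(1) BV, of "a u" "a v"] a(2) uv by (simp add: class_ring_simps)
      then show "a (u \<oplus>\<^bsub>V\<^esub> v) b = a u b + a v b"
        using uniq[of "u \<oplus>\<^bsub>V\<^esub> v"] uv that D(2) by (simp add: submodule.m_closed)
    next
      fix c u assume u: "u \<in> W"
      have "lincomb (\<lambda>b. c * a u b) B = c \<odot>\<^bsub>V\<^esub> u"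
        using lincomb_smult[OF BV, of "a u" c] a(2) u by (simp add: class_ring_simps)
      then show "a (c \<odot>\<^bsub>V\<^esub> u) b = c * a u b"
        using uniq[of "c \<odot>\<^bsub>V\<^esub> u"] u that D(2) by (simp add: submodule.smult_closed)
    qed
    show "w = \<zero>\<^bsub>V\<^esub>" if "w \<in> W" "\<forall>b\<in>B. a w b = 0" for w
    proof -
      have "w = lincomb (a w) B" using a(2)[OF that(1)] by simp
      also have "\<dots> = \<zero>\<^bsub>V\<^esub>" unfolding lincomb_def using that(2) BV zero_smult by (intro finsum_all0) auto
      finally show ?thesis .
    qed
  qed
qed

text \<open>If there were more vectors than dimensions, some nontrivial combination of the
  \<open>v j\<close> would have all coordinates zero; applying \<open>\<psi> i\<close> to it leaves
  only the i-th term, which is nonzero for a suitable i.\<close>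

lemma dim_ge_dual_family:
  assumes W: "W \<in> fd_subspaces V" and fin: "finite I" and v: "\<And>i. i \<in> I \<Longrightarrow> v i \<in> W"
    and \<psi>: "\<And>i. i \<in> I \<Longrightarrow> linear_functional_on V W (\<psi> i)"
    and diag: "\<And>i j. i \<in> I \<Longrightarrow> j \<in> I \<Longrightarrow> \<psi> i (v j) = 0 \<longleftrightarrow> i \<noteq> j"
  shows "card I \<le> subspace_dim V W"
proof (rule ccontr)
  assume less: "\<not> ?thesis"
  obtain B \<phi> where B: "finite B" "card B = subspace_dim V W"
    and exp: "\<forall>\<psi> w. linear_functional_on V W \<psi> \<longrightarrow> w \<in> W \<longrightarrow> \<psi> w = (\<Sum>b\<in>B. \<phi> b w * \<psi> b)"
    using dual_basis[OF W] by blast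
  obtain c where c: "\<exists>i\<in>I. c i \<noteq> 0" "\<forall>b\<in>B. (\<Sum>j\<in>I. c j * \<phi> b (v j)) = 0"
    using homogeneous_system[OF B(1) fin, of "\<lambda>b j. \<phi> b (v j)"] less B(2) by auto
  obtain i where i: "i \<in> I" "c i \<noteq> 0" using c(1) by blast
  have "(\<Sum>j\<in>I. c j * \<psi> i (v j)) = (\<Sum>j\<in>I. \<Sum>b\<in>B. (c j * \<phi> b (v j)) * \<psi> i b)"
    using exp[rule_format, OF \<psi>[OF i(1)] v] by (simp add: sum_distrib_left mult.assoc)
  also have "\<dots> = (\<Sum>b\<in>B. (\<Sum>j\<in>I. c j * \<phi> b (v j)) * \<psi> i b)"
    by (subst sum.swap) (simp add: sum_distrib_right)
  also have "\<dots> = 0" using c(2) by simp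
  finally have "(\<Sum>j\<in>I. c j * \<psi> i (v j)) = 0" .
  moreover have "(\<Sum>j\<in>I. c j * \<psi> i (v j)) = c i * \<psi> i (v i)"
    using diag i(1) by (subst sum.remove[OF fin i(1)]) (auto intro!: sum.neutral)
  ultimately show False using i diag by auto
qed

lemma vs_span_eq: "vs_span V S = span S"
  by (simp add: vs_span_def)

lemma span_fd:
  assumes "finite S" "S \<subseteq> carrier V"
  shows "vs_span V S \<in> fd_subspaces V"
proof -
  have sub: "VectorSpace.subspace class_ring (span S) V" by (rule span_is_subspace[OF assms(2)])
  then have sm: "submodule class_ring (span S) V" by simp
  interpret W: vectorspace "class_ring :: 'k ring" "V\<lparr>carrier := span S\<rparr>" by (rule subspace_is_vs[OF sub])
  have "W.span S = span S" using span_li_not_depend[OF in_own_span[OF assms(2)] sm] by simp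
  then have "W.fin_dim" unfolding W.fin_dim_def using assms(1) in_own_span[OF assms(2)] by auto
  then show ?thesis using sub by (simp add: fd_subspaces_def vs_span_eq)
qed

lemma fd_subspaces_generators:
  assumes W: "W \<in> fd_subspaces V"
  obtains S where "finite S" "S \<subseteq> W" "W = vs_span V S" "card S = subspace_dim V W" "lin_indpt S"
proof -
  note D = fd_subspacesD[OF W]
  interpret W: vectorspace "class_ring :: 'k ring" "V\<lparr>carrier := W\<rparr>" by (rule D(3))
  obtain B where B: "finite B" "W.basis B" using W.finite_basis_exists[OF D(4)] by blast
  then have BW: "B \<subseteq> W" by (simp add: W.basis_def)
  have "W.span B = W" using B(2) by (simp add: W.basis_def)
  then have 1: "W = vs_span V B" using span_li_not_depend[OF BW D(2)] by (simp add: vs_span_eq)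
  have "lin_indpt B"
  proof (rule finite_lin_indpt2[OF B(1)])
    show "B \<subseteq> carrier V" using BW D(5) by auto
    fix a assume "a \<in> B \<rightarrow> carrier (class_ring :: 'k ring)" "lincomb a B = \<zero>\<^bsub>V\<^esub>"
    then have a: "W.lincomb a B = \<zero>\<^bsub>V\<lparr>carrier := W\<rparr>\<^esub>"
      using lincomb_not_depend[OF B(1) BW D(2), of a] by simp
    have li: "\<not> W.lin_dep B" using B(2) by (simp add: W.basis_def)
    show "\<forall>v\<in>B. a v = \<zero>\<^bsub>class_ring\<^esub>"
      using W.lin_dep_crit[OF B(1) order.refl _ _ _ a] li by auto
  qed
  moreover have "card B = subspace_dim V W" using W.dim_basis[OF B] by (simp add: subspace_dim_def)
  ultimately show ?thesis using that[OF B(1) BW 1] by blast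
qed

lemma dim_le_card:
  assumes W: "W \<in> fd_subspaces V" and S: "finite S" "S \<subseteq> carrier V" "W \<subseteq> vs_span V S"
  shows "subspace_dim V W \<le> card S"
proof -
  obtain B where B: "finite B" "B \<subseteq> W" "W = vs_span V B" "card B = subspace_dim V W" "lin_indpt B"
    using fd_subspaces_generators[OF W] .
  have "card B \<le> card S"
  proof -
    have "B \<subseteq> span S" using B S(3) by (auto simp: vs_span_eq)
    \<comment> \<open>Steinitz exchange: the set that completes \<open>B\<close> has nonnegative
      cardinality, and this is the claim.\<close>
    from replacement[OF B(1) S(1,2) B(5) this]
    obtain C :: "'v set" where "int (card C) \<le> int (card S) - int (card B)" by auto
    then show ?thesis by linarith
  qed
  then show ?thesis using B by simp
qed

end

section \<open>The free algebra and its quotients\<close>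

text \<open>Makes the type-based theory of spans available on the whole free algebra. Restriction to
  the generators in \<open>G\<close> is handled separately by
  \<open>fa_span_subset_on\<close>.\<close>

interpretation FA: vector_space "\<lambda>c (f :: ('g, 'k::field) free_alg). fa_scalar c * f"
  by standard (simp_all add: distrib_left distrib_right fa_scalar_add fa_scalar_mult fa_scalar_1 mult.assoc)

definition fa_mono :: "'g list \<Rightarrow> ('g, 'k::field) free_alg" where
  "fa_mono ws = Poly_Mapping.single (Free_Monoid ws) 1"

lemma fa_mono_Nil: "fa_mono [] = 1"
  by (simp add: fa_mono_def zero_free_monoid_def[symmetric])

lemma fa_mono_append: "fa_mono (u @ v) = fa_mono u * fa_mono v"
  by (simp add: fa_mono_def mult_single plus_free_monoid_def)

lemma fa_mono_single: "fa_mono [g] = fa_gen g"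
  by (simp add: fa_mono_def fa_gen_def)

lemma fa_mono_on: "set ws \<subseteq> G \<Longrightarrow> fa_mono ws \<in> fa_on G"
  by (simp add: fa_mono_def fa_on_def)

lemma fa_expand: "f = (\<Sum>w\<in>Poly_Mapping.keys f. fa_scalar (Poly_Mapping.lookup f w) * fa_mono (letters w))"
  for f :: "('g, 'k::field) free_alg"
proof -
  have "f = (\<Sum>w\<in>Poly_Mapping.keys f. Poly_Mapping.single w (Poly_Mapping.lookup f w))"
    by (intro poly_mapping_eqI) (auto simp: lookup_sum lookup_single when_def in_keys_iff intro: sum.neutral)
  also have "\<dots> = (\<Sum>w\<in>Poly_Mapping.keys f. fa_scalar (Poly_Mapping.lookup f w) * fa_mono (letters w))"
    by (intro sum.cong) (simp_all add: fa_scalar_def fa_mono_def mult_single)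
  finally show ?thesis .
qed

lemma fa_scalar_left_commute: "u * (fa_scalar c * f) = fa_scalar c * (u * f)"
  by (metis fa_scalar_commute mult.assoc)

lemma fa_span_mult:
  assumes "f \<in> FA.span P" "g \<in> FA.span Q" "\<And>u v. u \<in> P \<Longrightarrow> v \<in> Q \<Longrightarrow> u * v \<in> FA.span S"
  shows "(f :: ('g, 'k::field) free_alg) * g \<in> FA.span S"
proof -
  have 1: "u * g \<in> FA.span S" if "u \<in> P" for u
    using assms(2)
  proof (induction rule: FA.span_induct_alt)
    case base
    then show ?case by (simp add: FA.span_zero)
  next
    case (step c x y)
    have "u * (fa_scalar c * x + y) = fa_scalar c * (u * x) + u * y"
      by (simp add: distrib_left fa_scalar_left_commute)
    then show ?case using step assms(3)[OF that] by (simp add: FA.span_add FA.span_scale)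
  qed
  show ?thesis
    using assms(1)
  proof (induction rule: FA.span_induct_alt)
    case base
    then show ?case by (simp add: FA.span_zero)
  next
    case (step c x y)
    have "(fa_scalar c * x + y) * g = fa_scalar c * (x * g) + y * g"
      by (simp add: distrib_right mult.assoc)
    then show ?case using step 1 by (simp add: FA.span_add FA.span_scale)
  qed
qed

lemma fa_span_subset_on: "P \<subseteq> fa_on G \<Longrightarrow> FA.span P \<subseteq> fa_on G"
  by (rule FA.span_minimal) (auto simp: FA.subspace_def fa_on_0 fa_on_add fa_on_mult fa_on_scalar)

lemma fa_on_one: "1 \<in> fa_on G"
  using fa_on_scalar[of 1 G] by (simp add: fa_scalar_1)

lemma fa_on_prod_list: "set fs \<subseteq> fa_on G \<Longrightarrow> prod_list fs \<in> fa_on G"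
  by (induction fs) (auto intro: fa_on_mult fa_on_one)

lemma fa_on_power: "f \<in> fa_on G \<Longrightarrow> f ^ k \<in> fa_on G"
  by (induction k) (auto intro: fa_on_mult fa_on_one)

text \<open>A finite spanning set, for finite \<open>E\<close>, of V^0 + ... + V^k where V is the
  span of \<open>E\<close>; \<open>power_sum\<close> forms its products from all elements of V
  instead.\<close>

definition fa_products :: "('g, 'k::field) free_alg set \<Rightarrow> nat \<Rightarrow> ('g, 'k) free_alg set" where
  "fa_products E k = prod_list ` {es. length es \<le> k \<and> set es \<subseteq> E}"

lemma finite_fa_products: "finite E \<Longrightarrow> finite (fa_products E k)"
  using finite_lists_length_le[of E k] by (simp add: fa_products_def conj_commute)

lemma fa_products_on: "E \<subseteq> fa_on G \<Longrightarrow> fa_products E k \<subseteq> fa_on G"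
  by (auto simp: fa_products_def intro!: fa_on_prod_list)

lemma fa_products_mono: "j \<le> k \<Longrightarrow> fa_products E j \<subseteq> fa_products E k"
  by (auto simp: fa_products_def)

lemma fa_productsI: "length es \<le> k \<Longrightarrow> set es \<subseteq> E \<Longrightarrow> f = prod_list es \<Longrightarrow> f \<in> fa_products E k"
  by (auto simp: fa_products_def)

lemma fa_productsE:
  assumes "f \<in> fa_products E k"
  obtains es where "length es \<le> k" "set es \<subseteq> E" "f = prod_list es"
  using assms by (auto simp: fa_products_def)

lemma fa_products_mult: "f \<in> fa_products E j \<Longrightarrow> g \<in> fa_products E k \<Longrightarrow> f * g \<in> fa_products E (j + k)"
  by (elim fa_productsE, rule_tac es = "es @ esa" in fa_productsI) auto

lemma prod_list_powers_products:
  fixes f :: "'i \<Rightarrow> ('g, 'k::field) free_alg"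
  assumes E: "\<And>l. l \<in> set ls \<Longrightarrow> f l \<in> E" and b: "\<And>l. l \<in> set ls \<Longrightarrow> b l \<le> (k :: nat)"
  shows "prod_list (map (\<lambda>l. f l ^ b l) ls) \<in> fa_products E (length ls * k)"
  using assms
proof (induction ls)
  case Nil
  then show ?case by (auto intro: fa_productsI[of "[]"])
next
  case (Cons l ls)
  have "f l ^ b l \<in> fa_products E k"
    using Cons.prems by (intro fa_productsI[of "replicate (b l) (f l)"]) auto
  moreover have "prod_list (map (\<lambda>l. f l ^ b l) ls) \<in> fa_products E (length ls * k)" using Cons by auto
  ultimately show ?case using fa_products_mult[of "f l ^ b l" E k] by simp
qed

lemma prod_list_span_products:
  "set fs \<subseteq> FA.span E \<Longrightarrow> length fs \<le> k \<Longrightarrow> prod_list fs \<in> FA.span (fa_products E k)"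
proof (induction fs arbitrary: k)
  case Nil
  have "1 \<in> fa_products E k" by (rule fa_productsI[of "[]"]) auto
  then show ?case by (simp add: FA.span_base)
next
  case (Cons f fs)
  then obtain j where j: "k = Suc j" "length fs \<le> j" by (cases k) auto
  have "f * prod_list fs \<in> FA.span (fa_products E k)"
  proof (rule fa_span_mult)
    show "f \<in> FA.span E" "prod_list fs \<in> FA.span (fa_products E j)" using Cons j by auto
    fix u v assume "u \<in> E" "v \<in> fa_products E j"
    then have "u * v \<in> fa_products E k"
      unfolding j by (elim fa_productsE, rule_tac es = "u # es" in fa_productsI) auto
    then show "u * v \<in> FA.span (fa_products E k)" by (rule FA.span_base)
  qed
  then show ?case by simp
qed

text \<open>Bridge between the type-based \<open>FA.span\<close> and the record-based
  \<open>vs_span\<close>. It serves for the projection to the quotient and for the map sending f to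
  its action on a fixed vector.\<close>

lemma (in kspace) span_image_fa:
  fixes h :: "('g, 'k) free_alg \<Rightarrow> 'v"
  assumes P: "P \<subseteq> fa_on G"
    and h: "\<And>f. f \<in> fa_on G \<Longrightarrow> h f \<in> carrier V"
      "\<And>f g. f \<in> fa_on G \<Longrightarrow> g \<in> fa_on G \<Longrightarrow> h (f + g) = h f \<oplus>\<^bsub>V\<^esub> h g"
      "\<And>c f. f \<in> fa_on G \<Longrightarrow> h (fa_scalar c * f) = c \<odot>\<^bsub>V\<^esub> h f"
  shows "h ` FA.span P = vs_span V (h ` P)"
proof
  have on: "FA.span P \<subseteq> fa_on G" by (rule fa_span_subset_on[OF P])
  have h0: "h 0 = \<zero>\<^bsub>V\<^esub>" using h(3)[of 0 0] h(1)[of 0] by (simp add: fa_on_0 zero_smult)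
  have hP: "h ` P \<subseteq> carrier V" using P h(1) by auto
  have sm: "submodule class_ring (span (h ` P)) V" by (rule span_is_submodule[OF hP])
  show "h ` FA.span P \<subseteq> vs_span V (h ` P)"
  proof
    fix v assume "v \<in> h ` FA.span P"
    then obtain f where f: "f \<in> FA.span P" "v = h f" by auto
    have "h f \<in> span (h ` P) \<and> f \<in> fa_on G" using f(1)
    proof (induction rule: FA.span_induct_alt)
      case base
      then show ?case using sm by (simp add: h0 submodule.zero_closed fa_on_0)
    next
      case (step c x y)
      have x: "x \<in> fa_on G" "fa_scalar c * x \<in> fa_on G" using step P by (auto intro: fa_on_mult fa_on_scalar)
      have "h x \<in> span (h ` P)" using in_own_span[OF hP] step by auto
      then show ?case using step x sm h(2)[OF x(2)] h(3)[OF x(1)]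
        by (simp add: submodule.m_closed submodule.smult_closed fa_on_add)
    qed
    then show "v \<in> vs_span V (h ` P)" by (simp add: f vs_span_eq)
  qed
  have "submodule class_ring (h ` FA.span P) V"
  proof
    show "h ` FA.span P \<subseteq> carrier V" using on h(1) by auto
    show "\<zero>\<^bsub>V\<^esub> \<in> h ` FA.span P" using h0 FA.span_zero[of P] by (metis image_eqI)
  next
    fix v w assume "v \<in> h ` FA.span P" "w \<in> h ` FA.span P"
    then obtain f g where fg: "f \<in> FA.span P" "g \<in> FA.span P" "v = h f" "w = h g" by auto
    then have "v \<oplus>\<^bsub>V\<^esub> w = h (f + g)" using h(2)[OF subsetD[OF on fg(1)] subsetD[OF on fg(2)]] by simp
    then show "v \<oplus>\<^bsub>V\<^esub> w \<in> h ` FA.span P" using FA.span_add[OF fg(1,2)] by (rule image_eqI)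
  next
    fix c :: 'k and v assume "v \<in> h ` FA.span P"
    then obtain f where f: "f \<in> FA.span P" "v = h f" by auto
    then have "c \<odot>\<^bsub>V\<^esub> v = h (fa_scalar c * f)" using h(3)[OF subsetD[OF on f(1)]] by simp
    then show "c \<odot>\<^bsub>V\<^esub> v \<in> h ` FA.span P" using FA.span_scale[OF f(1)] by (rule image_eqI)
  qed
  then show "vs_span V (h ` P) \<subseteq> h ` FA.span P"
    unfolding vs_span_eq by (intro span_is_subset) (auto simp: FA.span_base)
qed

section \<open>Lifting subspaces of the quotient to the free algebra\<close>

context presentation
begin

definition proj :: "('g, 'k) free_alg \<Rightarrow> ('g, 'k) free_alg set" where
  "proj f = I +>\<^bsub>FG\<^esub> f"

lemma proj_closed: "f \<in> fa_on G \<Longrightarrow> proj f \<in> carrier PA"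
  unfolding carrier_free_algebra[symmetric] proj_def by (auto simp: presented_simps FactRing_simps)

lemma proj_surj: "u \<in> carrier PA \<Longrightarrow> \<exists>f\<in>fa_on G. u = proj f"
  unfolding carrier_free_algebra[symmetric] proj_def by (auto simp: presented_simps FactRing_simps)

lemma proj_add: "f \<in> fa_on G \<Longrightarrow> g \<in> fa_on G \<Longrightarrow> proj (f + g) = proj f \<oplus>\<^bsub>PA\<^esub> proj g"
proof -
  interpret J: ideal I FG by (rule ideal_relation_ideal)
  assume "f \<in> fa_on G" "g \<in> fa_on G"
  then show ?thesis unfolding proj_def carrier_free_algebra[symmetric]
    using J.a_rcos_sum[of f g] by (simp add: presented_simps FactRing_def) (simp add: free_algebra_def)
qed

lemma proj_mult: "f \<in> fa_on G \<Longrightarrow> g \<in> fa_on G \<Longrightarrow> proj (f * g) = proj f \<otimes>\<^bsub>PA\<^esub> proj g"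
proof -
  interpret J: ideal I FG by (rule ideal_relation_ideal)
  assume "f \<in> fa_on G" "g \<in> fa_on G"
  then show ?thesis unfolding proj_def carrier_free_algebra[symmetric]
    using J.rcoset_mult_add[of f g] by (simp add: presented_simps FactRing_def) (simp add: free_algebra_def)
qed

lemma proj_scalar: "f \<in> fa_on G \<Longrightarrow> proj (fa_scalar c * f) = c \<odot>\<^bsub>PA\<^esub> proj f"
  unfolding proj_def using smult_presented_coset[of f c] by (simp add: carrier_free_algebra)

lemma proj_one: "proj 1 = \<one>\<^bsub>PA\<^esub>"
  by (simp add: proj_def presented_simps FactRing_def) (simp add: free_algebra_def)

lemma FG_minus: "g \<in> fa_on G \<Longrightarrow> \<ominus>\<^bsub>FG\<^esub> g = - g"
proof -
  interpret R: ring FG by (rule ring_free_algebra)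
  assume "g \<in> fa_on G"
  then show ?thesis
    using R.minus_equality[of "- g" g] by (simp add: carrier_free_algebra fa_on_uminus) (simp add: free_algebra_def)
qed

lemma proj_eqI:
  assumes "f \<in> fa_on G" "g \<in> fa_on G" "f - g \<in> I"
  shows "proj f = proj g"
proof -
  interpret J: ideal I FG by (rule ideal_relation_ideal)
  have "f \<in> I +>\<^bsub>FG\<^esub> g"
    using assms(3) by (auto simp: a_r_coset_def r_coset_def intro!: bexI[of _ "f - g"]) (simp add: free_algebra_def)
  then show ?thesis unfolding proj_def
    using J.a_repr_independence[OF _ _ J.a_subgroup, of f g] assms by (simp add: carrier_free_algebra)
qed

lemma I_subset: "I \<subseteq> fa_on G"
proof -
  interpret J: ideal I FG by (rule ideal_relation_ideal)
  show ?thesis using J.Icarr by (auto simp: carrier_free_algebra)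
qed

lemma relation_in_I: "r \<in> R \<Longrightarrow> r \<in> I"
  unfolding relation_ideal_def using ring.genideal_self[OF ring_free_algebra relations_subset] by blast

lemma I_add: "f \<in> I \<Longrightarrow> g \<in> I \<Longrightarrow> f + g \<in> I"
proof -
  interpret J: ideal I FG by (rule ideal_relation_ideal)
  assume "f \<in> I" "g \<in> I"
  then have "f \<oplus>\<^bsub>FG\<^esub> g \<in> I" by blast
  then show ?thesis by (simp add: free_algebra_def)
qed

lemma I_mult_left: "f \<in> I \<Longrightarrow> a \<in> fa_on G \<Longrightarrow> a * f \<in> I"
proof -
  interpret J: ideal I FG by (rule ideal_relation_ideal)
  assume "f \<in> I" "a \<in> fa_on G"
  then have "a \<otimes>\<^bsub>FG\<^esub> f \<in> I" by (intro J.I_l_closed) (auto simp: carrier_free_algebra)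
  then show ?thesis by (simp add: free_algebra_def)
qed

lemma I_mult_right: "f \<in> I \<Longrightarrow> a \<in> fa_on G \<Longrightarrow> f * a \<in> I"
proof -
  interpret J: ideal I FG by (rule ideal_relation_ideal)
  assume "f \<in> I" "a \<in> fa_on G"
  then have "f \<otimes>\<^bsub>FG\<^esub> a \<in> I" by (intro J.I_r_closed) (auto simp: carrier_free_algebra)
  then show ?thesis by (simp add: free_algebra_def)
qed

lemma I_scale: "f \<in> I \<Longrightarrow> fa_scalar c * f \<in> I"
  by (rule I_mult_left[OF _ fa_on_scalar])

lemma I_zero: "0 \<in> I"
proof -
  interpret J: ideal I FG by (rule ideal_relation_ideal)
  have "\<zero>\<^bsub>FG\<^esub> \<in> I" by simp
  then show ?thesis by (simp add: free_algebra_def)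
qed

lemma I_uminus: "f \<in> I \<Longrightarrow> - f \<in> I"
  using I_scale[of f "-1"] fa_scalar_add[of 1 "-1", where 'a='g]
  by (simp add: fa_scalar_1 fa_scalar_def single_uminus)

lemma I_diff: "f \<in> I \<Longrightarrow> g \<in> I \<Longrightarrow> f - g \<in> I"
  using I_add[of f "- g"] I_uminus[of g] by simp

lemma kspace_PA: "kspace PA"
  by (simp add: kspace_def vectorspace_presented)

lemma proj_span_image:
  assumes "P \<subseteq> fa_on G"
  shows "proj ` FA.span P = vs_span PA (proj ` P)"
  by (rule kspace.span_image_fa[OF kspace_PA assms]) (simp_all add: proj_closed proj_add proj_scalar)

text \<open>Finitely many generators of a subspace can be lifted, so growth is computed from finite
  subsets of the free algebra from here on.\<close>

lemma fd_subspaces_PA_iff: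
  "V \<in> fd_subspaces PA \<longleftrightarrow> (\<exists>E. finite E \<and> E \<subseteq> fa_on G \<and> V = proj ` FA.span E)"
proof
  interpret K: kspace PA by (rule kspace_PA)
  assume V: "V \<in> fd_subspaces PA"
  obtain S where S: "finite S" "S \<subseteq> V" "V = vs_span PA S" "card S = subspace_dim PA V" "K.lin_indpt S"
    using K.fd_subspaces_generators[OF V] .
  have "S \<subseteq> carrier PA" using S(2) K.fd_subspacesD(5)[OF V] by simp
  then have "\<forall>s\<in>S. \<exists>f\<in>fa_on G. s = proj f" using proj_surj by blast
  then obtain r where r: "\<forall>s\<in>S. r s \<in> fa_on G \<and> s = proj (r s)" by metis
  then have "proj ` r ` S = S" by force
  then show "\<exists>E. finite E \<and> E \<subseteq> fa_on G \<and> V = proj ` FA.span E"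
    using r S(1,3) proj_span_image[of "r ` S"] by (intro exI[of _ "r ` S"]) auto
next
  interpret K: kspace PA by (rule kspace_PA)
  assume "\<exists>E. finite E \<and> E \<subseteq> fa_on G \<and> V = proj ` FA.span E"
  then obtain E where E: "finite E" "E \<subseteq> fa_on G" "V = proj ` FA.span E" by blast
  have "proj ` E \<subseteq> carrier PA" using E(2) proj_closed by auto
  then show "V \<in> fd_subspaces PA"
    unfolding E(3) proj_span_image[OF E(2)] using E(1) by (intro K.span_fd) auto
qed

lemma proj_prod_list:
  "set fs \<subseteq> fa_on G \<Longrightarrow> prod_list fs \<in> fa_on G \<and> proj (prod_list fs) = foldr (\<otimes>\<^bsub>PA\<^esub>) (map proj fs) \<one>\<^bsub>PA\<^esub>"
proof (induction fs)
  case Nil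
  then show ?case by (simp add: fa_on_one proj_one)
next
  case (Cons f fs)
  then have f: "f \<in> fa_on G" "prod_list fs \<in> fa_on G"
    "proj (prod_list fs) = foldr (\<otimes>\<^bsub>PA\<^esub>) (map proj fs) \<one>\<^bsub>PA\<^esub>" by simp_all
  show ?case using fa_on_mult[OF f(1,2)] proj_mult[OF f(1,2)] f(3) by simp
qed

text \<open>Multilinearity: a product of at most k elements of the span of \<open>E\<close> expands
  into products of at most k elements of \<open>E\<close> itself.\<close>

lemma power_sum_image:
  assumes E: "E \<subseteq> fa_on G"
  shows "power_sum PA (proj ` FA.span E) k = proj ` FA.span (fa_products E k)"
proof -
  interpret K: kspace PA by (rule kspace_PA)
  note on = fa_span_subset_on[OF E]
  note P = fa_products_on[OF E, of k]
  let ?L = "{foldr (\<otimes>\<^bsub>PA\<^esub>) vs \<one>\<^bsub>PA\<^esub> | vs. length vs \<le> k \<and> set vs \<subseteq> proj ` FA.span E}"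
  have "v \<in> proj ` FA.span (fa_products E k)" if v: "v \<in> ?L" for v
  proof -
    obtain vs where vs: "v = foldr (\<otimes>\<^bsub>PA\<^esub>) vs \<one>\<^bsub>PA\<^esub>" "length vs \<le> k" "set vs \<subseteq> proj ` FA.span E"
      using v unfolding mem_Collect_eq by blast
    have "\<forall>v\<in>set vs. \<exists>f. f \<in> FA.span E \<and> v = proj f" using vs(3) by blast
    then obtain r where r: "\<forall>v\<in>set vs. r v \<in> FA.span E \<and> v = proj (r v)" by metis
    have "map proj (map r vs) = vs" using r by (simp add: map_idI)
    moreover have "set (map r vs) \<subseteq> FA.span E" using r by auto
    ultimately obtain fs where fs: "map proj fs = vs" "set fs \<subseteq> FA.span E" by blast
    then have "length fs \<le> k" using vs(2) by auto
    then have 1: "prod_list fs \<in> FA.span (fa_products E k)"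
      by (rule prod_list_span_products[OF fs(2)])
    have "proj (prod_list fs) = v"
      unfolding vs(1) fs(1)[symmetric] using proj_prod_list[OF order.trans[OF fs(2) on]] by simp
    then show ?thesis using 1 by (metis image_eqI)
  qed
  then have 1: "?L \<subseteq> proj ` FA.span (fa_products E k)" by (rule subsetI)
  have "proj f \<in> ?L" if f: "f \<in> fa_products E k" for f
  proof -
    obtain es where es: "length es \<le> k" "set es \<subseteq> E" "f = prod_list es" using f by (rule fa_productsE)
    have "proj f = foldr (\<otimes>\<^bsub>PA\<^esub>) (map proj es) \<one>\<^bsub>PA\<^esub>"
      unfolding es(3) using proj_prod_list[OF order.trans[OF es(2) E]] by simp
    moreover have "set (map proj es) \<subseteq> proj ` FA.span E" using es(2) FA.span_superset[of E] by auto
    moreover have "length (map proj es) \<le> k" using es(1) by simp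
    ultimately show ?thesis by blast
  qed
  then have 2: "proj ` fa_products E k \<subseteq> ?L" by (rule image_subsetI)
  have img: "proj ` FA.span (fa_products E k) = vs_span PA (proj ` fa_products E k)"
    by (rule proj_span_image[OF P])
  have "proj ` fa_products E k \<subseteq> carrier PA" using P proj_closed by auto
  then have sm: "submodule class_ring (proj ` FA.span (fa_products E k)) PA"
    unfolding img K.vs_span_eq by (rule K.span_is_submodule)
  show ?thesis
  proof
    show "power_sum PA (proj ` FA.span E) k \<subseteq> proj ` FA.span (fa_products E k)"
      unfolding power_sum_def K.vs_span_eq by (rule K.span_is_subset[OF 1 sm])
    show "proj ` FA.span (fa_products E k) \<subseteq> power_sum PA (proj ` FA.span E) k"
      unfolding img power_sum_def K.vs_span_eq by (rule K.span_is_monotone[OF 2])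
  qed
qed

end

section \<open>Operators commuting up to scalars\<close>

lemma poly_eq_sum_atMost:
  assumes "degree p \<le> D"
  shows "poly p (t :: 'k::comm_semiring_1) = (\<Sum>j\<le>D. coeff p j * t ^ j)"
  unfolding poly_altdef using assms
  by (intro sum.mono_neutral_left) (auto simp: coeff_eq_0)

text \<open>Lagrange interpolation in several variables. A product of one-variable polynomials of
  degree at most \<open>D\<close>, evaluated at the values of the characters, vanishes on
  \<open>A\<close> except at \<open>x0\<close>. Expanded, it is a combination of the monomials in
  \<open>zero\<close>, so it annihilates \<open>f\<close> and leaves a nonzero multiple of
  \<open>f x0\<close>.\<close>

lemma characters_independent:
  fixes \<chi> :: "nat \<Rightarrow> 'x \<Rightarrow> 'k::field"
  assumes fin: "finite A"
    and sep: "\<And>x y. x \<in> A \<Longrightarrow> y \<in> A \<Longrightarrow> x \<noteq> y \<Longrightarrow> \<exists>i<s. \<chi> i x \<noteq> \<chi> i y"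
    and few: "\<And>i. i < s \<Longrightarrow> card (\<chi> i ` A) \<le> Suc D"
    and zero: "\<And>g. g \<in> {..<s} \<rightarrow>\<^sub>E {..D} \<Longrightarrow> (\<Sum>x\<in>A. (\<Prod>i<s. \<chi> i x ^ g i) * f x) = 0"
    and x0: "x0 \<in> A"
  shows "f x0 = 0"
proof -
  \<comment> \<open>The roots of \<open>P i\<close> are the values of \<open>\<chi> i\<close> other
    than the one at \<open>x0\<close>, so by \<open>few\<close> its degree is at most
    \<open>D\<close>.\<close>
  define P where "P i = (\<Prod>v\<in>\<chi> i ` A - {\<chi> i x0}. [:- v, 1:])" for i
  have deg: "degree (P i) \<le> D" if "i < s" for i
  proof -
    have "degree (P i) \<le> (\<Sum>v\<in>\<chi> i ` A - {\<chi> i x0}. 1)"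
      unfolding P_def by (rule order.trans[OF degree_prod_sum_le]) (use fin in auto)
    also have "\<dots> = card (\<chi> i ` A) - 1" using fin x0 by simp
    finally show ?thesis using few[OF that] by simp
  qed
  have ev: "poly (P i) (\<chi> i x) = 0 \<longleftrightarrow> \<chi> i x \<noteq> \<chi> i x0" if "x \<in> A" for i x
    using fin that by (auto simp: P_def poly_prod)
  have P0: "(\<Prod>i<s. poly (P i) (\<chi> i x)) = 0" if "x \<in> A" "x \<noteq> x0" for x
    using sep[OF that(1) x0 that(2)] ev[OF that(1)] by auto
  have "0 = (\<Sum>g\<in>{..<s} \<rightarrow>\<^sub>E {..D}. (\<Prod>i<s. coeff (P i) (g i)) * (\<Sum>x\<in>A. (\<Prod>i<s. \<chi> i x ^ g i) * f x))"
    using zero by simp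
  also have "\<dots> = (\<Sum>x\<in>A. (\<Sum>g\<in>{..<s} \<rightarrow>\<^sub>E {..D}. \<Prod>i<s. coeff (P i) (g i) * \<chi> i x ^ g i) * f x)"
    unfolding sum_distrib_left sum_distrib_right
    by (subst sum.swap) (simp add: prod.distrib mult.assoc)
  also have "\<dots> = (\<Sum>x\<in>A. (\<Prod>i<s. \<Sum>j\<le>D. coeff (P i) j * \<chi> i x ^ j) * f x)"
    by (subst prod_sum_PiE) auto
  also have "\<dots> = (\<Sum>x\<in>A. (\<Prod>i<s. poly (P i) (\<chi> i x)) * f x)"
    using poly_eq_sum_atMost[OF deg] by (intro sum.cong refl arg_cong2[where f = "(*)"] prod.cong) auto
  also have "\<dots> = (\<Prod>i<s. poly (P i) (\<chi> i x0)) * f x0"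
  proof -
    have "(\<Sum>x\<in>A - {x0}. (\<Prod>i<s. poly (P i) (\<chi> i x)) * f x) = 0"
    proof (intro sum.neutral ballI)
      fix x assume "x \<in> A - {x0}"
      then have "(\<Prod>i<s. poly (P i) (\<chi> i x)) = 0" using P0 by blast
      then show "(\<Prod>i<s. poly (P i) (\<chi> i x)) * f x = 0" by (simp only: mult_zero_left)
    qed
    then show ?thesis by (simp only: sum.remove[OF fin x0] add_0_right)
  qed
  finally have "(\<Prod>i<s. poly (P i) (\<chi> i x0)) * f x0 = 0" by simp
  moreover have "(\<Prod>i<s. poly (P i) (\<chi> i x0)) \<noteq> 0" using ev[OF x0] by auto
  ultimately show ?thesis by simp
qed

section \<open>Linear operators and their ordered monomials\<close>

context kspace
begin

definition linear_op :: "('v \<Rightarrow> 'v) \<Rightarrow> bool" where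
  "linear_op T \<longleftrightarrow> (\<forall>u\<in>carrier V. T u \<in> carrier V) \<and>
    (\<forall>u\<in>carrier V. \<forall>v\<in>carrier V. T (u \<oplus>\<^bsub>V\<^esub> v) = T u \<oplus>\<^bsub>V\<^esub> T v) \<and>
    (\<forall>c. \<forall>u\<in>carrier V. T (c \<odot>\<^bsub>V\<^esub> u) = c \<odot>\<^bsub>V\<^esub> T u)"

lemma linear_opD:
  assumes "linear_op T"
  shows "u \<in> carrier V \<Longrightarrow> T u \<in> carrier V"
    "u \<in> carrier V \<Longrightarrow> v \<in> carrier V \<Longrightarrow> T (u \<oplus>\<^bsub>V\<^esub> v) = T u \<oplus>\<^bsub>V\<^esub> T v"
    "u \<in> carrier V \<Longrightarrow> T (c \<odot>\<^bsub>V\<^esub> u) = c \<odot>\<^bsub>V\<^esub> T u"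
  using assms by (auto simp: linear_op_def)

lemma linear_op_comp: "linear_op S \<Longrightarrow> linear_op T \<Longrightarrow> linear_op (\<lambda>u. S (T u))"
  by (simp add: linear_op_def)

lemma linear_op_id: "linear_op (\<lambda>u. u)"
  by (simp add: linear_op_def)

lemma linear_op_funpow: "linear_op T \<Longrightarrow> linear_op (T ^^ k)"
proof (induction k)
  case 0
  then show ?case using linear_op_id by (simp add: id_def)
next
  case (Suc k)
  then show ?case using linear_op_comp[of T "T ^^ k"] by (simp add: comp_def)
qed

lemma smult_smult: "v \<in> carrier V \<Longrightarrow> a \<odot>\<^bsub>V\<^esub> (b \<odot>\<^bsub>V\<^esub> v) = (a * b) \<odot>\<^bsub>V\<^esub> v"
  using smult_assoc1[of a b v] by (simp add: class_ring_simps)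

lemma smult_1: "v \<in> carrier V \<Longrightarrow> (1::'k) \<odot>\<^bsub>V\<^esub> v = v"
  using smult_one[of v] by (simp add: class_ring_simps)

lemma smult_in: "v \<in> carrier V \<Longrightarrow> (c::'k) \<odot>\<^bsub>V\<^esub> v \<in> carrier V"
  using smult_closed[of c v] by simp

lemma smult_eq_zero: "v \<in> carrier V \<Longrightarrow> (c::'k) \<noteq> 0 \<Longrightarrow> c \<odot>\<^bsub>V\<^esub> v = \<zero>\<^bsub>V\<^esub> \<longleftrightarrow> v = \<zero>\<^bsub>V\<^esub>"
  using smult_smult[of v "inverse c" c] smult_1[of v] by auto

lemma linear_op_zero: "linear_op T \<Longrightarrow> T \<zero>\<^bsub>V\<^esub> = \<zero>\<^bsub>V\<^esub>"
  using linear_opD(3)[of T "\<zero>\<^bsub>V\<^esub>" 0] linear_opD(1)[of T "\<zero>\<^bsub>V\<^esub>"] by (simp add: zero_smult)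

text \<open>The ordered product T_0^(a_0) ... T_(s-1)^(a_(s-1)) applied to \<open>v\<close>: the
  operator of highest index acts first.\<close>

fun op_monomial :: "(nat \<Rightarrow> 'v \<Rightarrow> 'v) \<Rightarrow> nat \<Rightarrow> (nat \<Rightarrow> nat) \<Rightarrow> 'v \<Rightarrow> 'v" where
  "op_monomial T 0 a v = v"
| "op_monomial T (Suc s) a v = op_monomial T s a ((T s ^^ a s) v)"

lemma op_monomial_cong: "(\<And>i. i < s \<Longrightarrow> a i = b i) \<Longrightarrow> op_monomial T s a v = op_monomial T s b v"
  by (induction s arbitrary: v) auto

lemma linear_op_monomial: "(\<And>i. i < s \<Longrightarrow> linear_op (T i)) \<Longrightarrow> linear_op (op_monomial T s a)"
proof (induction s)
  case 0
  then show ?case using linear_op_id by simp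
next
  case (Suc s)
  then have "linear_op (op_monomial T s a)" "linear_op (T s ^^ a s)" by (auto intro: linear_op_funpow)
  from linear_op_comp[OF this] show ?case by simp
qed

lemma funpow_commute:
  assumes S: "linear_op S" and T: "linear_op T"
    and ST: "\<And>v. v \<in> carrier V \<Longrightarrow> S (T v) = c \<odot>\<^bsub>V\<^esub> T (S v)" and v: "v \<in> carrier V"
  shows "S ((T ^^ k) v) = (c ^ k) \<odot>\<^bsub>V\<^esub> (T ^^ k) (S v)"
proof (induction k)
  case 0
  then show ?case using v S by (simp add: smult_1 linear_opD)
next
  case (Suc k)
  have 1: "(T ^^ k) v \<in> carrier V" "(T ^^ k) (S v) \<in> carrier V"
    using linear_opD(1)[OF linear_op_funpow[OF T]] linear_opD(1)[OF S] v by auto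
  then show ?case using Suc ST[OF 1(1)] linear_opD(1,3)[OF T]
    by (simp add: smult_smult)
qed

lemma funpow_commute':
  assumes S: "linear_op S" and T: "linear_op T"
    and ST: "\<And>v. v \<in> carrier V \<Longrightarrow> S (T v) = c \<odot>\<^bsub>V\<^esub> T (S v)" and v: "v \<in> carrier V"
  shows "(S ^^ k) (T v) = (c ^ k) \<odot>\<^bsub>V\<^esub> T ((S ^^ k) v)"
proof (induction k)
  case 0
  then show ?case using v T by (simp add: smult_1 linear_opD)
next
  case (Suc k)
  have 1: "(S ^^ k) v \<in> carrier V" "(S ^^ k) (T v) \<in> carrier V" "T ((S ^^ k) v) \<in> carrier V"
    using linear_opD(1)[OF linear_op_funpow[OF S]] linear_opD(1)[OF T] v by auto
  then show ?case using Suc ST[OF 1(1)] linear_opD(1,3)[OF S] linear_opD(1)[OF T]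
    by (simp add: smult_smult mult.commute)
qed

end

locale skew_operators = kspace V for V :: "('k::field, 'v, 'e) module_scheme" +
  fixes T :: "nat \<Rightarrow> 'v \<Rightarrow> 'v" and s :: nat and lam :: "nat \<Rightarrow> nat \<Rightarrow> 'k"
  assumes linear: "i < s \<Longrightarrow> linear_op (T i)"
    and skew: "i < s \<Longrightarrow> j < s \<Longrightarrow> v \<in> carrier V \<Longrightarrow> T i (T j v) = lam i j \<odot>\<^bsub>V\<^esub> T j (T i v)"
    and lam_nonzero: "i < s \<Longrightarrow> j < s \<Longrightarrow> lam i j \<noteq> 0"
begin

text \<open>The scalar picked up when \<open>T i\<close> moves past the monomial with exponents
  \<open>a\<close> in the first \<open>r\<close> operators (\<open>operator_monomial\<close>). It is
  multiplicative in \<open>a\<close>, which makes it a character of the exponents.\<close>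

definition chi :: "nat \<Rightarrow> nat \<Rightarrow> (nat \<Rightarrow> nat) \<Rightarrow> 'k" where
  "chi r i a = (\<Prod>j<r. lam i j ^ a j)"

lemma chi_nonzero: "i < s \<Longrightarrow> r \<le> s \<Longrightarrow> chi r i a \<noteq> 0"
  by (auto simp: chi_def lam_nonzero)

lemma linear_mon: "r \<le> s \<Longrightarrow> linear_op (op_monomial T r a)"
  by (rule linear_op_monomial) (simp add: linear)

lemma operator_monomial:
  assumes "i < s" "r \<le> s" "v \<in> carrier V"
  shows "T i (op_monomial T r a v) = chi r i a \<odot>\<^bsub>V\<^esub> op_monomial T r a (T i v)"
  using assms(2,3)
proof (induction r arbitrary: v)
  case 0
  then show ?case using linear_opD(1)[OF linear[OF assms(1)]] by (simp add: chi_def smult_1)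
next
  case (Suc r)
  let ?w = "(T r ^^ a r) v"
  have L: "linear_op (op_monomial T r a)" using Suc.prems by (intro linear_mon) simp
  have r: "linear_op (T r)" "linear_op (T i)" using Suc.prems assms(1) linear by auto
  have cl: "?w \<in> carrier V" "(T r ^^ a r) (T i v) \<in> carrier V"
    using linear_opD(1)[OF linear_op_funpow[OF r(1)]] linear_opD(1)[OF r(2)] Suc.prems by auto
  have "T i (op_monomial T (Suc r) a v) = chi r i a \<odot>\<^bsub>V\<^esub> op_monomial T r a (T i ?w)"
    using Suc cl by simp
  also have "T i ?w = lam i r ^ a r \<odot>\<^bsub>V\<^esub> (T r ^^ a r) (T i v)"
    by (rule funpow_commute[OF r(2,1) skew[OF assms(1) Suc_le_lessD[OF Suc.prems(1)]] Suc.prems(2)])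
  also have "op_monomial T r a \<dots> = lam i r ^ a r \<odot>\<^bsub>V\<^esub> op_monomial T (Suc r) a (T i v)"
    using linear_opD(3)[OF L cl(2)] by simp
  also have "chi r i a \<odot>\<^bsub>V\<^esub> \<dots> = chi (Suc r) i a \<odot>\<^bsub>V\<^esub> op_monomial T (Suc r) a (T i v)"
    using linear_opD(1)[OF L cl(2)] by (simp add: smult_smult chi_def mult.commute)
  finally show ?case .
qed

text \<open>Conjugating the monomial \<open>a\<close> by the monomial \<open>g\<close> multiplies it
  by a scalar that is a monomial in the characters of \<open>a\<close>, with exponents
  \<open>g\<close>. This is the input for \<open>characters_independent\<close>.\<close>

lemma monomial_monomial:
  assumes "r \<le> s" "v \<in> carrier V"
  shows "op_monomial T r g (op_monomial T s a v)
    = (\<Prod>i<r. chi s i a ^ g i) \<odot>\<^bsub>V\<^esub> op_monomial T s a (op_monomial T r g v)"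
  using assms
proof (induction r arbitrary: v)
  case 0
  then show ?case using linear_opD(1)[OF linear_mon[of s]] by (simp add: smult_1)
next
  case (Suc r)
  let ?v = "(T r ^^ g r) v"
  have L: "linear_op (op_monomial T r g)" "linear_op (op_monomial T s a)" using Suc.prems by (auto intro: linear_mon)
  have r: "linear_op (T r)" using Suc.prems linear by auto
  have cl: "?v \<in> carrier V" using linear_opD(1)[OF linear_op_funpow[OF r]] Suc.prems by auto
  note cl' = Suc.prems(2)
  have "(T r ^^ g r) (op_monomial T s a v) = chi s r a ^ g r \<odot>\<^bsub>V\<^esub> op_monomial T s a ?v"
    by (rule funpow_commute'[OF r L(2) operator_monomial[OF Suc_le_lessD[OF Suc.prems(1)] order.refl] cl'])
  then have "op_monomial T (Suc r) g (op_monomial T s a v)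
      = chi s r a ^ g r \<odot>\<^bsub>V\<^esub> op_monomial T r g (op_monomial T s a ?v)"
    using linear_opD(1)[OF L(2) cl] linear_opD(3)[OF L(1)] by simp
  also have "\<dots> = chi s r a ^ g r \<odot>\<^bsub>V\<^esub> ((\<Prod>i<r. chi s i a ^ g i) \<odot>\<^bsub>V\<^esub> op_monomial T s a (op_monomial T (Suc r) g v))"
    using Suc cl by simp
  also have "\<dots> = (\<Prod>i<Suc r. chi s i a ^ g i) \<odot>\<^bsub>V\<^esub> op_monomial T s a (op_monomial T (Suc r) g v)"
    using linear_opD(1)[OF L(2)] linear_opD(1)[OF L(1) cl] by (simp add: smult_smult mult.commute)
  finally show ?case .
qed

text \<open>Reordering costs only nonzero scalars, and the scalar does not depend on the
  vector.\<close>

lemma monomial_add: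
  assumes "r \<le> s"
  shows "\<exists>c. c \<noteq> 0 \<and> (\<forall>v\<in>carrier V. op_monomial T r a (op_monomial T r b v)
    = c \<odot>\<^bsub>V\<^esub> op_monomial T r (\<lambda>i. a i + b i) v)"
  using assms
proof (induction r)
  case 0
  then show ?case by (intro exI[of _ 1]) (simp add: smult_1)
next
  case (Suc r)
  then obtain c where c: "c \<noteq> 0"
    "\<And>v. v \<in> carrier V \<Longrightarrow> op_monomial T r a (op_monomial T r b v) = c \<odot>\<^bsub>V\<^esub> op_monomial T r (\<lambda>i. a i + b i) v"
    by auto
  have L: "linear_op (op_monomial T r d)" for d using Suc.prems by (auto intro: linear_mon)
  have r: "linear_op (T r)" using Suc.prems linear by auto
  have "op_monomial T (Suc r) a (op_monomial T (Suc r) b v)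
    = (chi r r b ^ a r * c) \<odot>\<^bsub>V\<^esub> op_monomial T (Suc r) (\<lambda>i. a i + b i) v" if v: "v \<in> carrier V" for v
  proof -
    let ?v = "(T r ^^ b r) v" and ?u = "(T r ^^ a r) ((T r ^^ b r) v)"
    have cl: "?v \<in> carrier V" "?u \<in> carrier V" using linear_opD(1)[OF linear_op_funpow[OF r]] v by auto
    have u: "?u = (T r ^^ (a r + b r)) v" by (simp add: funpow_add)
    have "(T r ^^ a r) (op_monomial T r b ?v) = chi r r b ^ a r \<odot>\<^bsub>V\<^esub> op_monomial T r b ?u"
      using Suc.prems by (intro funpow_commute'[OF r L operator_monomial cl(1)]) auto
    then have "op_monomial T (Suc r) a (op_monomial T (Suc r) b v)
      = chi r r b ^ a r \<odot>\<^bsub>V\<^esub> op_monomial T r a (op_monomial T r b ?u)"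
      using linear_opD(1)[OF L cl(2)] linear_opD(3)[OF L] by simp
    then show ?thesis using c(2)[OF cl(2)] linear_opD(1)[OF L cl(2)] by (simp add: smult_smult u)
  qed
  moreover have "chi r r b ^ a r * c \<noteq> 0" using c chi_nonzero[of r r] Suc.prems by simp
  ultimately show ?case by blast
qed

text \<open>The argument of Bernstein's inequality: a combination of the monomials in a box that kills \<open>W\<^sub>1\<close>
  is separated into its terms by conjugation with monomials.\<close>

lemma box_le_dim_product:
  assumes W: "W1 \<in> fd_subspaces V" "W2 \<in> fd_subspaces V" "W3 \<in> fd_subspaces V"
    and m: "m \<in> carrier V" and nz: "\<And>a. op_monomial T s a m \<noteq> \<zero>\<^bsub>V\<^esub>"
    and h1: "\<And>g. g \<in> {..<s} \<rightarrow>\<^sub>E {..D} \<Longrightarrow> op_monomial T s g m \<in> W1"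
    and h2: "\<And>b w. b \<in> {..<s} \<rightarrow>\<^sub>E {..k} \<Longrightarrow> w \<in> W1 \<Longrightarrow> op_monomial T s b w \<in> W2"
    and h3: "\<And>g w. g \<in> {..<s} \<rightarrow>\<^sub>E {..D} \<Longrightarrow> w \<in> W2 \<Longrightarrow> op_monomial T s g w \<in> W3"
    and sep: "\<And>a b. a \<in> {..<s} \<rightarrow>\<^sub>E {..k} \<Longrightarrow> b \<in> {..<s} \<rightarrow>\<^sub>E {..k} \<Longrightarrow> a \<noteq> b \<Longrightarrow> \<exists>i<s. chi s i a \<noteq> chi s i b"
    and few: "\<And>i. i < s \<Longrightarrow> card (chi s i ` ({..<s} \<rightarrow>\<^sub>E {..k})) \<le> Suc D"
  shows "(k + 1) ^ s \<le> subspace_dim V W1 * subspace_dim V W2"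
proof (rule ccontr)
  assume less: "\<not> ?thesis"
  let ?X = "{..<s} \<rightarrow>\<^sub>E {..k}" and ?Y = "{..<s} \<rightarrow>\<^sub>E {..D}"
  let ?M = "op_monomial T s"
  have finX: "finite ?X" by (intro finite_PiE) auto
  have cX: "card ?X = (k + 1) ^ s" by (simp add: card_PiE)
  note L = linear_mon[OF order.refl]
  note WV = fd_subspacesD(5)[OF W(1)] fd_subspacesD(5)[OF W(2)] fd_subspacesD(5)[OF W(3)]
  note SM = fd_subspacesD(2)[OF W(1)] fd_subspacesD(2)[OF W(2)]
  from dual_basis[OF W(1)]
  obtain B1 \<phi>1 where B1: "finite B1" "card B1 = subspace_dim V W1" "B1 \<subseteq> W1"
    and e1: "\<forall>\<psi> w. linear_functional_on V W1 \<psi> \<longrightarrow> w \<in> W1 \<longrightarrow> \<psi> w = (\<Sum>b\<in>B1. \<phi>1 b w * \<psi> b)"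
    by (elim exE conjE) (rule that; assumption)
  from dual_basis[OF W(2)]
  obtain B2 \<phi>2 where B2: "finite B2" "card B2 = subspace_dim V W2"
    and e2: "\<forall>\<psi> w. linear_functional_on V W2 \<psi> \<longrightarrow> w \<in> W2 \<longrightarrow> \<psi> w = (\<Sum>b\<in>B2. \<phi>2 b w * \<psi> b)"
    and l2: "\<forall>b\<in>B2. linear_functional_on V W2 (\<phi>2 b)"
    by (elim exE conjE) (rule that; assumption)
  from dual_basis[OF W(3)]
  obtain B3 \<phi>3 where B3: "B3 \<subseteq> W3" and l3: "\<forall>b\<in>B3. linear_functional_on V W3 (\<phi>3 b)"
    and z3: "\<forall>w\<in>W3. (\<forall>b\<in>B3. \<phi>3 b w = 0) \<longrightarrow> w = \<zero>\<^bsub>V\<^esub>"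
    by (elim exE conjE) (rule that; assumption)
  \<comment> \<open>The unknowns are the coefficients of the monomials in the box, the equations the
    matrix entries of their combination as a map from \<open>W1\<close> to \<open>W2\<close>. By
    assumption there are fewer entries than monomials.\<close>
  have "finite (B1 \<times> B2)" using B1(1) B2(1) by simp
  moreover have "card (B1 \<times> B2) < card ?X"
    unfolding card_cartesian_product cX B1(2) B2(2) using less by simp
  ultimately have "\<exists>c. (\<exists>b\<in>?X. c b \<noteq> 0) \<and>
      (\<forall>e\<in>B1 \<times> B2. (\<Sum>b\<in>?X. c b * (\<lambda>e b. \<phi>2 (snd e) (?M b (fst e))) e b) = 0)"
    by (intro homogeneous_system finX)
  then obtain c where cnz: "\<exists>b\<in>?X. c b \<noteq> 0"
    and c: "\<And>t1 t2. t1 \<in> B1 \<Longrightarrow> t2 \<in> B2 \<Longrightarrow> (\<Sum>b\<in>?X. c b * \<phi>2 t2 (?M b t1)) = 0"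
    by fastforce
  \<comment> \<open>Passes from the basis of \<open>W1\<close> to all of \<open>W1\<close>: each
    coordinate of the combination is a linear functional on \<open>W1\<close> and expands in the
    dual basis.\<close>
  have kill: "(\<Sum>b\<in>?X. c b * \<phi>2 t (?M b w)) = 0" if w: "w \<in> W1" and t: "t \<in> B2" for w t
  proof -
    let ?\<psi> = "\<lambda>w. \<Sum>b\<in>?X. c b * \<phi>2 t (?M b w)"
    have l: "\<And>u v. u \<in> W2 \<Longrightarrow> v \<in> W2 \<Longrightarrow> \<phi>2 t (u \<oplus>\<^bsub>V\<^esub> v) = \<phi>2 t u + \<phi>2 t v"
      "\<And>c u. u \<in> W2 \<Longrightarrow> \<phi>2 t (c \<odot>\<^bsub>V\<^esub> u) = c * \<phi>2 t u"
      using l2 t by (auto simp: linear_functional_on_def)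
    have "linear_functional_on V W1 ?\<psi>"
      unfolding linear_functional_on_def
    proof (intro conjI ballI allI)
      fix u v assume uv: "u \<in> W1" "v \<in> W1"
      then have "?M b (u \<oplus>\<^bsub>V\<^esub> v) = ?M b u \<oplus>\<^bsub>V\<^esub> ?M b v" for b
        using WV(1) by (intro linear_opD(2)[OF L]) auto
      then show "?\<psi> (u \<oplus>\<^bsub>V\<^esub> v) = ?\<psi> u + ?\<psi> v"
        unfolding sum.distrib[symmetric] using uv h2 l(1) by (intro sum.cong) (auto simp: distrib_left)
    next
      fix a u assume u: "u \<in> W1"
      then have "?M b (a \<odot>\<^bsub>V\<^esub> u) = a \<odot>\<^bsub>V\<^esub> ?M b u" for b
        using WV(1) by (intro linear_opD(3)[OF L]) auto
      then show "?\<psi> (a \<odot>\<^bsub>V\<^esub> u) = a * ?\<psi> u"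
        unfolding sum_distrib_left using u h2 l(2) by (intro sum.cong) (auto simp: mult_ac)
    qed
    then have "?\<psi> w = (\<Sum>b\<in>B1. \<phi>1 b w * ?\<psi> b)" using e1 w by blast
    then show ?thesis using c t by simp
  qed
  have zero_in: "(\<lambda>i\<in>{..<s}. 0) \<in> ?Y" by auto
  have top_in: "(\<lambda>i\<in>{..<s}. D) \<in> ?Y" by auto
  \<comment> \<open>Common target of all the conjugated monomials: up to scalars, every T^h T^b T^g
    \<open>m\<close> with h + g = (D,...,D) is a multiple of \<open>u b\<close>.\<close>
  define u where "u b = ?M (\<lambda>_. D) (?M b m)" for b
  have "?M (\<lambda>i\<in>{..<s}. 0) m = m"
  proof -
    have "op_monomial T r (\<lambda>i\<in>{..<s}. 0) v = v" if "r \<le> s" for r v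
      using that by (induction r arbitrary: v) auto
    then show ?thesis by simp
  qed
  then have mW: "m \<in> W1" using h1[OF zero_in] by simp
  have uW: "u b \<in> W3" if "b \<in> ?X" for b
  proof -
    have "?M (\<lambda>i\<in>{..<s}. D) (?M b m) \<in> W3" using h3[OF top_in h2[OF that mW]] .
    moreover have "?M (\<lambda>i\<in>{..<s}. D) (?M b m) = u b" unfolding u_def by (rule op_monomial_cong) simp
    ultimately show ?thesis by simp
  qed
  \<comment> \<open>The combination kills T^g \<open>m\<close>, which lies in \<open>W1\<close>.
    Applying T^h and normalizing each term to a multiple of \<open>u b\<close> gives one relation
    for every \<open>g\<close>. The third space only serves to hold these vectors, so that they have
    coordinates.\<close>
  have rel: "(\<Sum>b\<in>?X. (\<Prod>i<s. inverse (chi s i b) ^ g i) * (c b * \<phi>3 t (u b))) = 0"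
    if t: "t \<in> B3" and g: "g \<in> ?Y" for t g
  proof -
    have l: "\<And>u v. u \<in> W3 \<Longrightarrow> v \<in> W3 \<Longrightarrow> \<phi>3 t (u \<oplus>\<^bsub>V\<^esub> v) = \<phi>3 t u + \<phi>3 t v"
      "\<And>c u. u \<in> W3 \<Longrightarrow> \<phi>3 t (c \<odot>\<^bsub>V\<^esub> u) = c * \<phi>3 t u"
      using l3 t by (auto simp: linear_functional_on_def)
    define h where "h = (\<lambda>i\<in>{..<s}. D - g i)"
    have hY: "h \<in> ?Y" by (auto simp: h_def)
    let ?\<theta> = "\<lambda>w. \<phi>3 t (?M h w)"
    have lin\<theta>: "linear_functional_on V W2 ?\<theta>"
      unfolding linear_functional_on_def
    proof (intro conjI ballI allI)
      fix u v assume uv: "u \<in> W2" "v \<in> W2"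
      then have "?M h (u \<oplus>\<^bsub>V\<^esub> v) = ?M h u \<oplus>\<^bsub>V\<^esub> ?M h v"
        using WV(2) by (intro linear_opD(2)[OF L]) auto
      then show "?\<theta> (u \<oplus>\<^bsub>V\<^esub> v) = ?\<theta> u + ?\<theta> v" using uv h3[OF hY] l(1) by simp
    next
      fix a u assume u: "u \<in> W2"
      then have "?M h (a \<odot>\<^bsub>V\<^esub> u) = a \<odot>\<^bsub>V\<^esub> ?M h u"
        using WV(2) by (intro linear_opD(3)[OF L]) auto
      then show "?\<theta> (a \<odot>\<^bsub>V\<^esub> u) = a * ?\<theta> u" using u h3[OF hY] l(2) by simp
    qed
    obtain \<sigma> where \<sigma>: "\<sigma> \<noteq> 0" "\<And>v. v \<in> carrier V \<Longrightarrow> ?M h (?M g v) = \<sigma> \<odot>\<^bsub>V\<^esub> ?M (\<lambda>i. h i + g i) v"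
      using monomial_add[OF order.refl, of h g] by blast
    have hg: "?M (\<lambda>i. h i + g i) v = ?M (\<lambda>_. D) v" for v
      by (rule op_monomial_cong) (use g in \<open>auto simp: h_def PiE_iff\<close>)
    have val: "?\<theta> (?M b (?M g m)) = \<sigma> * (\<Prod>i<s. inverse (chi s i b) ^ g i) * \<phi>3 t (u b)" if b: "b \<in> ?X" for b
    proof -
      let ?K = "\<Prod>i<s. chi s i b ^ g i"
      have K: "?K \<noteq> 0" using chi_nonzero by simp
      have bm: "?M b m \<in> carrier V" "?M g m \<in> carrier V" using linear_opD(1)[OF L m] by auto
      have bgm: "?M b (?M g m) \<in> carrier V" using linear_opD(1)[OF L bm(2)] .
      have "?M g (?M b m) = ?K \<odot>\<^bsub>V\<^esub> ?M b (?M g m)" by (rule monomial_monomial[OF order.refl m])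
      then have "?M b (?M g m) = inverse ?K \<odot>\<^bsub>V\<^esub> ?M g (?M b m)"
        using K bgm by (simp add: smult_smult smult_1)
      then have "?M h (?M b (?M g m)) = inverse ?K \<odot>\<^bsub>V\<^esub> (\<sigma> \<odot>\<^bsub>V\<^esub> u b)"
        using linear_opD(1)[OF L bm(1)] linear_opD(3)[OF L] \<sigma>(2)[OF bm(1)] hg by (simp add: u_def)
      also have "\<dots> = (\<sigma> * inverse ?K) \<odot>\<^bsub>V\<^esub> u b"
        using uW[OF b] WV(3) by (subst smult_smult) (auto simp: mult.commute)
      finally have "?\<theta> (?M b (?M g m)) = \<sigma> * inverse ?K * \<phi>3 t (u b)" using l(2)[OF uW[OF b]] by simp
      then show ?thesis by (simp add: prod_inversef[symmetric] power_inverse comp_def)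
    qed
    have gW: "?M g m \<in> W1" by (rule h1[OF g])
    have "(\<Sum>b\<in>?X. c b * ?\<theta> (?M b (?M g m))) = (\<Sum>b\<in>?X. \<Sum>t2\<in>B2. (c b * \<phi>2 t2 (?M b (?M g m))) * ?\<theta> t2)"
      using e2 lin\<theta> h2[OF _ gW] by (intro sum.cong) (auto simp: sum_distrib_left mult.assoc)
    also have "\<dots> = (\<Sum>t2\<in>B2. (\<Sum>b\<in>?X. c b * \<phi>2 t2 (?M b (?M g m))) * ?\<theta> t2)"
      by (subst sum.swap) (simp add: sum_distrib_right)
    also have "\<dots> = 0" using kill[OF gW] by simp
    finally have "0 = (\<Sum>b\<in>?X. \<sigma> * ((\<Prod>i<s. inverse (chi s i b) ^ g i) * (c b * \<phi>3 t (u b))))"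
      using val by (simp add: mult_ac)
    then show ?thesis using \<sigma>(1) by (simp add: sum_distrib_left[symmetric])
  qed
  obtain b0 where b0: "b0 \<in> ?X" "c b0 \<noteq> 0" using cnz by blast
  \<comment> \<open>The relations for all \<open>g\<close> in the box of side \<open>D\<close>
    isolate the single term \<open>b0\<close>; inverting the characters affects neither separation
    nor the number of values.\<close>
  have "c b0 * \<phi>3 t (u b0) = 0" if t: "t \<in> B3" for t
  proof (rule characters_independent[of ?X s "\<lambda>i b. inverse (chi s i b)" D "\<lambda>b. c b * \<phi>3 t (u b)", OF finX _ _ _ b0(1)])
    show "\<exists>i<s. inverse (chi s i a) \<noteq> inverse (chi s i b)" if "a \<in> ?X" "b \<in> ?X" "a \<noteq> b" for a b
      using sep[OF that] by simp
    show "card ((\<lambda>b. inverse (chi s i b)) ` ?X) \<le> Suc D" if "i < s" for i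
    proof -
      have "card (inverse ` (chi s i ` ?X)) \<le> card (chi s i ` ?X)" by (intro card_image_le finite_imageI finX)
      then show ?thesis using few[OF that] by (simp add: image_image)
    qed
  qed (rule rel[OF t])
  then have "u b0 = \<zero>\<^bsub>V\<^esub>" using z3 uW[OF b0(1)] b0(2) by auto
  \<comment> \<open>But \<open>u b0\<close> is a nonzero multiple of a monomial applied to
    \<open>m\<close>, against \<open>nz\<close>.\<close>
  moreover obtain \<sigma> where "\<sigma> \<noteq> 0" "u b0 = \<sigma> \<odot>\<^bsub>V\<^esub> ?M (\<lambda>i. D + b0 i) m"
    using monomial_add[OF order.refl, of "\<lambda>_. D" b0] m unfolding u_def by blast
  ultimately show False using nz[of "\<lambda>i. D + b0 i"] linear_opD(1)[OF L m] smult_eq_zero by metis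
qed

end

section \<open>Commutation relations in quantum Euclidean space\<close>

context presentation
begin

text \<open>The identity u g = c g u of the quotient, stated as membership in the relation ideal.
  Its consequences then follow from identities of the free algebra.\<close>

definition skew_commute :: "'k \<Rightarrow> ('g, 'k) free_alg \<Rightarrow> ('g, 'k) free_alg \<Rightarrow> bool" where
  "skew_commute c u g \<longleftrightarrow> u \<in> fa_on G \<and> g \<in> fa_on G \<and> u * g - fa_scalar c * (g * u) \<in> I"

lemma skew_commute_mult_left:
  assumes u: "skew_commute c u g" and v: "skew_commute d v g"
  shows "skew_commute (c * d) (u * v) g"
proof -
  have on: "u \<in> fa_on G" "v \<in> fa_on G" "g \<in> fa_on G" using assms by (auto simp: skew_commute_def)
  have "u * v * g - fa_scalar (c * d) * (g * (u * v))
      = u * (v * g - fa_scalar d * (g * v)) + fa_scalar d * ((u * g - fa_scalar c * (g * u)) * v)"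
    unfolding mult.commute[of c d] fa_scalar_mult
    by (simp add: right_diff_distrib left_diff_distrib mult.assoc fa_scalar_left_commute[of u])
  moreover have "u * (v * g - fa_scalar d * (g * v)) + fa_scalar d * ((u * g - fa_scalar c * (g * u)) * v) \<in> I"
    using assms on by (intro I_add I_scale I_mult_left[OF _ on(1)] I_mult_right[OF _ on(2)]) (auto simp: skew_commute_def)
  ultimately show ?thesis using on by (simp add: skew_commute_def fa_on_mult)
qed

lemma skew_commute_mult_right:
  assumes u: "skew_commute c u g" and v: "skew_commute d u h"
  shows "skew_commute (c * d) u (g * h)"
proof -
  have on: "u \<in> fa_on G" "h \<in> fa_on G" "g \<in> fa_on G" using assms by (auto simp: skew_commute_def)
  have "u * (g * h) - fa_scalar (c * d) * (g * h * u)
      = (u * g - fa_scalar c * (g * u)) * h + fa_scalar c * (g * (u * h - fa_scalar d * (h * u)))"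
    unfolding fa_scalar_mult
    by (simp add: right_diff_distrib left_diff_distrib mult.assoc fa_scalar_left_commute[of g])
  moreover have "(u * g - fa_scalar c * (g * u)) * h + fa_scalar c * (g * (u * h - fa_scalar d * (h * u))) \<in> I"
    using assms on by (intro I_add I_scale I_mult_left[OF _ on(3)] I_mult_right[OF _ on(2)]) (auto simp: skew_commute_def)
  ultimately show ?thesis using on by (simp add: skew_commute_def fa_on_mult)
qed

lemma skew_commute_add_left:
  assumes "skew_commute c u g" "skew_commute c v g"
  shows "skew_commute c (u + v) g"
proof -
  have "(u + v) * g - fa_scalar c * (g * (u + v)) = (u * g - fa_scalar c * (g * u)) + (v * g - fa_scalar c * (g * v))"
    by (simp add: algebra_simps)
  then show ?thesis using assms by (simp add: skew_commute_def fa_on_add I_add)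
qed

lemma skew_commute_scale_left:
  assumes "skew_commute c u g"
  shows "skew_commute c (fa_scalar a * u) g"
proof -
  have "fa_scalar a * u * g - fa_scalar c * (g * (fa_scalar a * u)) = fa_scalar a * (u * g - fa_scalar c * (g * u))"
    by (simp add: right_diff_distrib mult.assoc fa_scalar_left_commute[of g] fa_scalar_left_commute[of "fa_scalar c" a])
  then show ?thesis using assms by (simp add: skew_commute_def fa_on_mult fa_on_scalar I_scale)
qed

lemma skew_commute_sym:
  assumes "skew_commute c u g" "c \<noteq> 0"
  shows "skew_commute (inverse c) g u"
proof -
  have neg: "fa_scalar (- inverse c) = (- fa_scalar (inverse c) :: ('g, 'k) free_alg)"
    by (simp add: fa_scalar_def single_uminus)
  have inv: "fa_scalar (inverse c) * (fa_scalar c * w) = (w :: ('g, 'k) free_alg)" for w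
    using assms(2) by (simp add: mult.assoc[symmetric] fa_scalar_mult[symmetric] fa_scalar_1)
  have "g * u - fa_scalar (inverse c) * (u * g) = fa_scalar (- inverse c) * (u * g - fa_scalar c * (g * u))"
    unfolding neg by (simp add: right_diff_distrib inv fa_scalar_1 assms(2))
  then show ?thesis using assms by (simp add: skew_commute_def I_scale I_uminus)
qed

lemma skew_commute_zero_left: "g \<in> fa_on G \<Longrightarrow> skew_commute c 0 g"
  by (simp add: skew_commute_def fa_on_0 I_zero)

lemma skew_commute_sum_left:
  "finite A \<Longrightarrow> g \<in> fa_on G \<Longrightarrow> (\<And>l. l \<in> A \<Longrightarrow> skew_commute c (f l) g) \<Longrightarrow> skew_commute c (\<Sum>l\<in>A. f l) g"
  by (induction A rule: finite_induct) (auto intro: skew_commute_zero_left skew_commute_add_left)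

lemma skew_commute_power_left: "skew_commute c u g \<Longrightarrow> skew_commute (c ^ k) (u ^ k) g"
proof (induction k)
  case 0
  then show ?case by (simp add: skew_commute_def fa_on_one fa_scalar_1 I_zero)
next
  case (Suc k)
  then show ?case using skew_commute_mult_left[of c u g "c ^ k" "u ^ k"] by simp
qed

end

section \<open>Quantum Euclidean space: commutation of the \<open>z i\<close> with the
  generators\<close>

locale quantum_euclid =
  fixes n :: nat and q :: "'k::field"
  assumes q_nonzero: "q \<noteq> 0" and q_not_root: "\<And>k::nat. k \<ge> 1 \<Longrightarrow> q ^ k \<noteq> 1"
begin

sublocale presentation "Kn_gens n" "Kn_relations n (qe_p q) qe_q (qe_gamma q)"
  by (rule Kn_presentation)

lemma quantum_euclidean_eq: "quantum_euclidean n q = PA"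
  by (simp add: quantum_euclidean_def Kn_algebra_def)

abbreviation rels :: "(gen, 'k) free_alg set" where "rels \<equiv> Kn_relations n (qe_p q) qe_q (qe_gamma q)"

abbreviation x :: "nat \<Rightarrow> (gen, 'k) free_alg" where "x i \<equiv> fa_gen (X i)"
abbreviation y :: "nat \<Rightarrow> (gen, 'k) free_alg" where "y i \<equiv> fa_gen (Y i)"

abbreviation Fn :: "(gen, 'k) free_alg set" where "Fn \<equiv> fa_on (Kn_gens n)"

definition c0 :: 'k where "c0 = 1 - inverse (q ^ 2)"

text \<open>Lift of \<open>Kn_z\<close> to the free algebra, since \<open>qe_q l - qe_p q l\<close>
  equals \<open>c0\<close> for all \<open>l\<close>. The empty sum \<open>z 0 = 0\<close> lets the
  last family of relations include i = 1.\<close>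

definition z :: "nat \<Rightarrow> (gen, 'k) free_alg" where
  "z i = (\<Sum>l = 1..i. fa_scalar c0 * (y l * x l))"

lemma c0_nonzero: "c0 \<noteq> 0"
  using q_not_root[of 2] by (auto simp: c0_def)

lemma x_on: "1 \<le> i \<Longrightarrow> i \<le> n \<Longrightarrow> x i \<in> Fn"
  and y_on: "1 \<le> i \<Longrightarrow> i \<le> n \<Longrightarrow> y i \<in> Fn"
  by (auto intro: fa_on_gen simp: Kn_gens_def)

lemma z_on: "i \<le> n \<Longrightarrow> z i \<in> Fn"
  unfolding z_def by (intro fa_on_sum fa_on_mult fa_on_scalar x_on y_on) auto

lemma z_Suc: "z (Suc i) = z i + fa_scalar c0 * (y (Suc i) * x (Suc i))"
  by (simp add: z_def)

lemma z_0: "z 0 = 0"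
  by (simp add: z_def)

lemma Kn_z_eq: "Kn_z n (qe_p q) qe_q (qe_gamma q) i = proj (z i)"
  by (simp add: Kn_z_def proj_def z_def c0_def qe_p_def qe_q_def mult.assoc)

lemma relations:
  shows "1 \<le> i \<Longrightarrow> i < j \<Longrightarrow> j \<le> n \<Longrightarrow> x i * x j - fa_scalar q * (x j * x i) \<in> I"
    and "1 \<le> i \<Longrightarrow> i < j \<Longrightarrow> j \<le> n \<Longrightarrow> y i * y j - fa_scalar (inverse q) * (y j * y i) \<in> I"
    and "1 \<le> i \<Longrightarrow> i < j \<Longrightarrow> j \<le> n \<Longrightarrow> x i * y j - fa_scalar (inverse q) * (y j * x i) \<in> I"
    and "1 \<le> j \<Longrightarrow> j < i \<Longrightarrow> i \<le> n \<Longrightarrow> x i * y j - fa_scalar (inverse q) * (y j * x i) \<in> I"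
    and "1 \<le> i \<Longrightarrow> i \<le> n \<Longrightarrow> x i * y i - y i * x i - z (i - 1) \<in> I"
proof -
  let ?s = "fa_scalar :: 'k \<Rightarrow> (gen, 'k) free_alg"
  show "x i * x j - ?s q * (x j * x i) \<in> I" if "1 \<le> i" "i < j" "j \<le> n"
  proof -
    have q: "qe_q i * inverse (qe_p q j) * qe_gamma q i j = q"
      using that q_nonzero by (simp add: qe_q_def qe_p_def qe_gamma_def power2_eq_square)
    have "x i * x j - ?s (qe_q i * inverse (qe_p q j) * qe_gamma q i j) * x j * x i \<in> rels"
      unfolding Kn_relations_def Let_def using that by blast
    from relation_in_I[OF this, unfolded q] show ?thesis by (simp only: mult.assoc)
  qed
  show "y i * y j - ?s (inverse q) * (y j * y i) \<in> I" if "1 \<le> i" "i < j" "j \<le> n"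
  proof -
    have q: "qe_gamma q i j = inverse q"
      using that by (simp add: qe_gamma_def)
    have "y i * y j - ?s (qe_gamma q i j) * y j * y i \<in> rels"
      unfolding Kn_relations_def Let_def using that by blast
    from relation_in_I[OF this, unfolded q] show ?thesis by (simp only: mult.assoc)
  qed
  show "x i * y j - ?s (inverse q) * (y j * x i) \<in> I" if "1 \<le> i" "i < j" "j \<le> n"
  proof -
    have q: "qe_p q j * inverse (qe_gamma q i j) = inverse q"
      using that q_nonzero by (simp add: qe_p_def qe_gamma_def power2_eq_square)
    have "x i * y j - ?s (qe_p q j * inverse (qe_gamma q i j)) * y j * x i \<in> rels"
      unfolding Kn_relations_def Let_def using that by blast
    from relation_in_I[OF this, unfolded q] show ?thesis by (simp only: mult.assoc)
  qed
  show "x i * y j - ?s (inverse q) * (y j * x i) \<in> I" if "1 \<le> j" "j < i" "i \<le> n"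
  proof -
    have q: "qe_q j * inverse (qe_gamma q i j) = inverse q"
      using that by (simp add: qe_q_def qe_gamma_def)
    have "x i * y j - ?s (qe_q j * inverse (qe_gamma q i j)) * y j * x i \<in> rels"
      unfolding Kn_relations_def Let_def using that by blast
    from relation_in_I[OF this, unfolded q] show ?thesis by (simp only: mult.assoc)
  qed
  show "x i * y i - y i * x i - z (i - 1) \<in> I" if "1 \<le> i" "i \<le> n"
  proof -
    have "x i * y i - ?s (qe_q i) * y i * x i - (\<Sum>l = 1..i - 1. ?s (qe_q l - qe_p q l) * y l * x l)
      \<in> rels"
      unfolding Kn_relations_def Let_def using that by blast
    then show ?thesis using relation_in_I by (fastforce simp: z_def c0_def qe_q_def qe_p_def fa_scalar_1 mult.assoc)
  qed
qed

lemma skew_x_x: "1 \<le> i \<Longrightarrow> i < j \<Longrightarrow> j \<le> n \<Longrightarrow> skew_commute q (x i) (x j)"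
  and skew_y_y: "1 \<le> i \<Longrightarrow> i < j \<Longrightarrow> j \<le> n \<Longrightarrow> skew_commute (inverse q) (y i) (y j)"
  and skew_x_y: "1 \<le> i \<Longrightarrow> 1 \<le> j \<Longrightarrow> i \<le> n \<Longrightarrow> j \<le> n \<Longrightarrow> i \<noteq> j \<Longrightarrow> skew_commute (inverse q) (x i) (y j)"
  unfolding skew_commute_def using relations x_on y_on by (auto simp: neq_iff)

lemma skew_x_x': "1 \<le> i \<Longrightarrow> i < j \<Longrightarrow> j \<le> n \<Longrightarrow> skew_commute (inverse q) (x j) (x i)"
  using skew_commute_sym[OF skew_x_x] q_nonzero by simp

lemma skew_y_y': "1 \<le> i \<Longrightarrow> i < j \<Longrightarrow> j \<le> n \<Longrightarrow> skew_commute q (y j) (y i)"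
  using skew_commute_sym[OF skew_y_y] q_nonzero by simp

lemma skew_y_x: "1 \<le> i \<Longrightarrow> 1 \<le> j \<Longrightarrow> i \<le> n \<Longrightarrow> j \<le> n \<Longrightarrow> i \<noteq> j \<Longrightarrow> skew_commute q (y j) (x i)"
  using skew_commute_sym[OF skew_x_y] q_nonzero by simp

text \<open>In each summand both \<open>y l\<close> and \<open>x l\<close> pass \<open>x j\<close>
  with a factor \<open>q\<close>, the same for all l below j.\<close>

lemma skew_z_x_below:
  assumes "i < j" "j \<le> n"
  shows "skew_commute (q ^ 2) (z i) (x j)"
proof -
  have "skew_commute (q * q) (y l * x l) (x j)" if "l \<in> {1..i}" for l
    by (intro skew_commute_mult_left skew_y_x skew_x_x) (use that assms in auto)
  then show ?thesis unfolding z_def power2_eq_square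
    using assms by (intro skew_commute_sum_left skew_commute_scale_left x_on) auto
qed

lemma skew_z_y_below:
  assumes "i < j" "j \<le> n"
  shows "skew_commute (inverse (q ^ 2)) (z i) (y j)"
proof -
  have "skew_commute (inverse q * inverse q) (y l * x l) (y j)" if "l \<in> {1..i}" for l
    by (intro skew_commute_mult_left skew_y_y skew_x_y) (use that assms in auto)
  then show ?thesis unfolding z_def power2_eq_square inverse_mult_distrib
    using assms by (intro skew_commute_sum_left skew_commute_scale_left y_on) auto
qed

text \<open>Modulo the relations z_j = (1 - c0) z_(j-1) + c0 x_j y_j. Moving \<open>x j\<close> past
  z_(j-1) costs q^2, which cancels because (1 - c0) q^2 = 1.\<close>

lemma skew_z_x_same:
  assumes "1 \<le> j" "j \<le> n"
  shows "skew_commute 1 (z j) (x j)"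
proof -
  have j: "Suc (j - 1) = j" using assms by simp
  let ?s = "fa_scalar :: 'k \<Rightarrow> (gen, 'k) free_alg"
  let ?Z = "z (j - 1)"
  have zj: "z j = ?Z + ?s c0 * (y j * x j)" using z_Suc[of "j - 1"] j by simp
  have h1: "x j * y j - y j * x j - ?Z \<in> I" using relations(5) assms by simp
  have h2: "?Z * x j - ?s (q ^ 2) * (x j * ?Z) \<in> I" using skew_z_x_below[of "j - 1" j] assms by (simp add: skew_commute_def)
  have s: "?s (1 - c0) * (?s (q ^ 2) * w) = w" for w
    using q_nonzero by (simp add: mult.assoc[symmetric] fa_scalar_mult[symmetric] c0_def fa_scalar_1)
  have s': "?s (1 - c0) = 1 - ?s c0"
    using fa_scalar_add[of "1 - c0" c0, where 'a=gen] by (simp add: fa_scalar_1 eq_diff_eq)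
  have "z j * x j - ?s 1 * (x j * z j)
      = ?s (1 - c0) * (?Z * x j - ?s (q ^ 2) * (x j * ?Z)) - ?s c0 * ((x j * y j - y j * x j - ?Z) * x j)"
    unfolding zj right_diff_distrib s unfolding s'
    by (simp add: algebra_simps fa_scalar_1 fa_scalar_left_commute[of "x j"])
  also have "\<dots> \<in> I" by (intro I_diff I_scale I_mult_right[OF h1] h2 x_on assms)
  finally show ?thesis using assms by (simp add: skew_commute_def x_on z_on)
qed

text \<open>Here z_(j-1) y_j = (1 - c0) y_j z_(j-1), and the missing c0 y_j z_(j-1) is supplied by
  the commutator when x_j y_j is rewritten.\<close>

lemma skew_z_y_same:
  assumes "1 \<le> j" "j \<le> n"
  shows "skew_commute 1 (z j) (y j)"
proof -
  have j: "Suc (j - 1) = j" using assms by simp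
  let ?s = "fa_scalar :: 'k \<Rightarrow> (gen, 'k) free_alg"
  let ?Z = "z (j - 1)"
  have zj: "z j = ?Z + ?s c0 * (y j * x j)" using z_Suc[of "j - 1"] j by simp
  have h1: "x j * y j - y j * x j - ?Z \<in> I" using relations(5) assms by simp
  have h2: "?Z * y j - ?s (1 - c0) * (y j * ?Z) \<in> I"
    using skew_z_y_below[of "j - 1" j] assms by (simp add: skew_commute_def c0_def)
  have s': "?s (1 - c0) = 1 - ?s c0"
    using fa_scalar_add[of "1 - c0" c0, where 'a=gen] by (simp add: fa_scalar_1 eq_diff_eq)
  have "z j * y j - ?s 1 * (y j * z j)
      = (?Z * y j - ?s (1 - c0) * (y j * ?Z)) + ?s c0 * (y j * (x j * y j - y j * x j - ?Z))"
    unfolding zj s'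
    by (simp add: algebra_simps fa_scalar_1 fa_scalar_left_commute[of "y j"])
  also have "\<dots> \<in> I" by (intro I_add I_scale I_mult_left[OF h1] h2 y_on assms)
  finally show ?thesis using assms by (simp add: skew_commute_def y_on z_on)
qed

text \<open>Each summand added beyond index j commutes with \<open>x j\<close>, since its two
  generators contribute \<open>q\<close> and its inverse.\<close>

lemma skew_z_x_above: "1 \<le> j \<Longrightarrow> j \<le> i \<Longrightarrow> i \<le> n \<Longrightarrow> skew_commute 1 (z i) (x j)"
proof (induction i)
  case 0
  then show ?case by simp
next
  case (Suc i)
  show ?case
  proof (cases "j = Suc i")
    case True
    then show ?thesis using skew_z_x_same Suc by simp
  next
    case False
    then have "j \<le> i" using Suc.prems by simp
    have "skew_commute (q * inverse q) (y (Suc i) * x (Suc i)) (x j)"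
      by (intro skew_commute_mult_left skew_y_x skew_x_x') (use Suc.prems \<open>j \<le> i\<close> in auto)
    then have "skew_commute 1 (y (Suc i) * x (Suc i)) (x j)" using q_nonzero by simp
    then show ?thesis unfolding z_Suc using Suc \<open>j \<le> i\<close>
      by (intro skew_commute_add_left skew_commute_scale_left) auto
  qed
qed

lemma skew_z_y_above: "1 \<le> j \<Longrightarrow> j \<le> i \<Longrightarrow> i \<le> n \<Longrightarrow> skew_commute 1 (z i) (y j)"
proof (induction i)
  case 0
  then show ?case by simp
next
  case (Suc i)
  show ?case
  proof (cases "j = Suc i")
    case True
    then show ?thesis using skew_z_y_same Suc by simp
  next
    case False
    then have "j \<le> i" using Suc.prems by simp
    have "skew_commute (q * inverse q) (y (Suc i) * x (Suc i)) (y j)"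
      by (intro skew_commute_mult_left skew_y_y' skew_x_y) (use Suc.prems \<open>j \<le> i\<close> in auto)
    then have "skew_commute 1 (y (Suc i) * x (Suc i)) (y j)" using q_nonzero by simp
    then show ?thesis unfolding z_Suc using Suc \<open>j \<le> i\<close>
      by (intro skew_commute_add_left skew_commute_scale_left) auto
  qed
qed

text \<open>Each product \<open>y l * x l\<close> commutes with \<open>z i\<close>: either both
  factors do, or they contribute q^-2 and q^2.\<close>

lemma skew_z_z: "i \<le> n \<Longrightarrow> j \<le> n \<Longrightarrow> skew_commute 1 (z i) (z j)"
proof -
  assume ij: "i \<le> n" "j \<le> n"
  have "skew_commute 1 (y l * x l) (z i)" if l: "l \<in> {1..j}" for l
  proof (cases "l \<le> i")
    case True
    then have "skew_commute (1 * 1) (z i) (y l * x l)"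
      using l ij by (intro skew_commute_mult_right skew_z_y_above skew_z_x_above) auto
    then show ?thesis using skew_commute_sym[of 1 "z i" "y l * x l"] by simp
  next
    case False
    then have "skew_commute (inverse (q ^ 2) * q ^ 2) (z i) (y l * x l)"
      using l ij by (intro skew_commute_mult_right skew_z_y_below skew_z_x_below) auto
    then show ?thesis using skew_commute_sym[of 1 "z i" "y l * x l"] q_nonzero by simp
  qed
  then have "skew_commute 1 (z j) (z i)"
    unfolding z_def[of j] using ij by (intro skew_commute_sum_left skew_commute_scale_left z_on) auto
  then show ?thesis using skew_commute_sym[of 1 "z j" "z i"] by simp
qed

end

section \<open>Growth of a module\<close>

locale presentation_module = presentation G R for G :: "'g set" and R :: "('g, 'k::field) free_alg set" +
  fixes M :: "(('g, 'k) free_alg set, 'm) module"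
  assumes right_module_M: "right_module PA M"
begin

abbreviation US :: "('k, 'm) module" where "US \<equiv> underlying_space PA M"

sublocale M: right_module PA M by (rule right_module_M)

sublocale US: kspace US
  unfolding kspace_def by (rule vectorspace_underlying_space[OF right_module_M])

abbreviation zeroM :: 'm where "zeroM \<equiv> \<zero>\<^bsub>US\<^esub>"

text \<open>The right action, pulled back to the free algebra: in \<open>act (f * g)\<close> the
  factor \<open>f\<close> acts first. Operators therefore compose in the order opposite to
  multiplication.\<close>

definition act :: "('g, 'k) free_alg \<Rightarrow> 'm \<Rightarrow> 'm" where
  "act f m = proj f \<odot>\<^bsub>M\<^esub> m"

lemma carrier_US: "carrier US = carrier M"
  and add_US: "u \<oplus>\<^bsub>US\<^esub> v = u \<oplus>\<^bsub>M\<^esub> v"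
  and zero_US: "zeroM = \<zero>\<^bsub>M\<^esub>"
  by (simp_all add: underlying_space_def)

lemma act_closed: "f \<in> fa_on G \<Longrightarrow> m \<in> carrier US \<Longrightarrow> act f m \<in> carrier US"
  unfolding carrier_US act_def by (rule M.smult_closed[OF proj_closed])

lemma act_add: "f \<in> fa_on G \<Longrightarrow> g \<in> fa_on G \<Longrightarrow> m \<in> carrier US \<Longrightarrow> act (f + g) m = act f m \<oplus>\<^bsub>US\<^esub> act g m"
  unfolding carrier_US act_def add_US by (simp add: proj_add M.smult_add_ring[OF proj_closed proj_closed])

lemma act_mult: "f \<in> fa_on G \<Longrightarrow> g \<in> fa_on G \<Longrightarrow> m \<in> carrier US \<Longrightarrow> act (f * g) m = act g (act f m)"
  unfolding carrier_US act_def by (simp add: proj_mult M.smult_assoc[OF proj_closed proj_closed])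

lemma act_one: "m \<in> carrier US \<Longrightarrow> act 1 m = m"
  unfolding carrier_US act_def proj_one by (rule M.smult_one)

lemma act_fa_scalar: "act (fa_scalar c) m = c \<odot>\<^bsub>US\<^esub> m"
  using proj_scalar[OF fa_on_one, of c] by (simp add: act_def underlying_space_def proj_one)

lemma act_scale: "f \<in> fa_on G \<Longrightarrow> m \<in> carrier US \<Longrightarrow> act (fa_scalar c * f) m = c \<odot>\<^bsub>US\<^esub> act f m"
  unfolding fa_scalar_commute by (simp add: act_mult fa_on_scalar act_fa_scalar)

lemma act_scale': "f \<in> fa_on G \<Longrightarrow> m \<in> carrier US \<Longrightarrow> act f (c \<odot>\<^bsub>US\<^esub> m) = c \<odot>\<^bsub>US\<^esub> act f m"
  using act_scale[of f m c] act_mult[OF fa_on_scalar[of c], of f m] by (simp add: act_fa_scalar)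

lemma linear_op_act: "f \<in> fa_on G \<Longrightarrow> US.linear_op (act f)"
  unfolding US.linear_op_def
proof (intro conjI ballI allI)
  assume f: "f \<in> fa_on G"
  fix u v assume u: "u \<in> carrier US"
  show "act f u \<in> carrier US" by (rule act_closed[OF f u])
  show "act f (c \<odot>\<^bsub>US\<^esub> u) = c \<odot>\<^bsub>US\<^esub> act f u" for c by (rule act_scale'[OF f u])
  assume v: "v \<in> carrier US"
  show "act f (u \<oplus>\<^bsub>US\<^esub> v) = act f u \<oplus>\<^bsub>US\<^esub> act f v"
    using u v unfolding carrier_US add_US act_def by (rule M.smult_add_module[OF proj_closed[OF f]])
qed

lemma act_zero: "f \<in> fa_on G \<Longrightarrow> act f zeroM = zeroM"
  by (rule US.linear_op_zero[OF linear_op_act])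

lemma act_cong: "f \<in> fa_on G \<Longrightarrow> g \<in> fa_on G \<Longrightarrow> f - g \<in> I \<Longrightarrow> act f m = act g m"
  by (simp add: act_def proj_eqI)

lemma act_skew:
  assumes "skew_commute c u g" "m \<in> carrier US"
  shows "act (u * g) m = c \<odot>\<^bsub>US\<^esub> act (g * u) m"
proof -
  have on: "u \<in> fa_on G" "g \<in> fa_on G" "u * g - fa_scalar c * (g * u) \<in> I"
    using assms(1) by (auto simp: skew_commute_def)
  have "act (u * g) m = act (fa_scalar c * (g * u)) m"
    using on by (intro act_cong fa_on_mult fa_on_scalar)
  then show ?thesis using on assms(2) by (simp add: act_scale fa_on_mult)
qed

text \<open>The subspace \<open>(V\<^sup>0 + \<cdots> + V\<^sup>k) m\<close>, where \<open>V\<close> is spanned by \<open>E\<close>\<close>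

definition orbit_space :: "('g, 'k) free_alg set \<Rightarrow> 'm \<Rightarrow> nat \<Rightarrow> 'm set" where
  "orbit_space E m k = (\<lambda>f. act f m) ` FA.span (fa_products E k)"

lemma act_span_image:
  assumes "P \<subseteq> fa_on G" "m \<in> carrier US"
  shows "(\<lambda>f. act f m) ` FA.span P = vs_span US ((\<lambda>f. act f m) ` P)"
  by (rule US.span_image_fa[OF assms(1)]) (simp_all add: act_closed act_add act_scale assms(2))

lemma orbit_space_fd:
  assumes "E \<subseteq> fa_on G" "finite E" "m \<in> carrier US"
  shows "orbit_space E m k \<in> fd_subspaces US"
proof -
  have "(\<lambda>f. act f m) ` fa_products E k \<subseteq> carrier US"
    using fa_products_on[OF assms(1), of k] assms(3) act_closed by blast
  then show ?thesis
    unfolding orbit_space_def act_span_image[OF fa_products_on[OF assms(1)] assms(3)]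
    by (intro US.span_fd finite_imageI finite_fa_products assms(2))
qed

lemma orbit_space_mono: "j \<le> k \<Longrightarrow> orbit_space E m j \<subseteq> orbit_space E m k"
  unfolding orbit_space_def by (intro image_mono FA.span_mono fa_products_mono)

lemma orbit_space_base: "m \<in> carrier US \<Longrightarrow> m \<in> orbit_space E m 0"
  unfolding orbit_space_def
  by (rule image_eqI[of _ _ 1]) (auto simp: act_one intro!: FA.span_base fa_productsI[of "[]"])

lemma orbit_space_act:
  assumes "E \<subseteq> fa_on G" "m \<in> carrier US" "e \<in> E" "w \<in> orbit_space E m k"
  shows "act e w \<in> orbit_space E m (Suc k)"
proof -
  obtain f where f: "f \<in> FA.span (fa_products E k)" "w = act f m"
    using assms(4) by (auto simp: orbit_space_def)
  have on: "f \<in> fa_on G" "e \<in> fa_on G"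
    using f(1) fa_span_subset_on[OF fa_products_on[OF assms(1)]] assms by auto
  have "f * e \<in> FA.span (fa_products E (Suc k))"
  proof (rule fa_span_mult[OF f(1) FA.span_base])
    show "e \<in> {e}" by simp
    fix u v assume "u \<in> fa_products E k" "v \<in> {e}"
    moreover have "e \<in> fa_products E 1" using assms(3) by (intro fa_productsI[of "[e]"]) auto
    ultimately show "u * v \<in> FA.span (fa_products E (Suc k))"
      using fa_products_mult[of u E k e 1] by (intro FA.span_base) auto
  qed
  then show ?thesis unfolding orbit_space_def f(2) act_mult[OF on assms(2), symmetric] by (rule imageI)
qed

text \<open>On the line spanned by \<open>m\<close> the span over pairs collapses to the image of
  one map, because the scalar on \<open>m\<close> can be moved into the algebra element.\<close>

lemma act_span_eq_orbit_space:
  assumes E: "E \<subseteq> fa_on G" and m: "m \<in> carrier US"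
  shows "act_span PA M (vs_span US {m}) (power_sum PA (proj ` FA.span E) k) = orbit_space E m k"
proof -
  let ?P = "FA.span (fa_products E k)"
  note P = fa_products_on[OF E, of k]
  note on = fa_span_subset_on[OF P]
  have F: "vs_span US {m} = (\<lambda>f. act f m) ` FA.span {1}"
    using act_span_image[OF _ m, of "{1}"] by (simp add: act_one m fa_on_one)
  have S: "{a \<odot>\<^bsub>M\<^esub> m' | a m'. a \<in> proj ` ?P \<and> m' \<in> vs_span US {m}} = orbit_space E m k" (is "?L = _")
  proof (intro equalityI subsetI)
    fix v assume "v \<in> ?L"
    then obtain a m' where "v = a \<odot>\<^bsub>M\<^esub> m'" "a \<in> proj ` ?P" "m' \<in> vs_span US {m}" by blast
    then obtain f g where fg: "v = act f (act g m)" "f \<in> ?P" "g \<in> FA.span {1}" by (auto simp: act_def F)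
    obtain c where "g = fa_scalar c" using fg(3) FA.span_breakdown_eq[of g 1 "{}"] by auto
    then have "v = act (fa_scalar c * f) m" using fg on m by (auto simp: act_mult fa_on_scalar)
    then show "v \<in> orbit_space E m k" unfolding orbit_space_def using fg(2) by (auto intro: FA.span_scale)
  next
    fix v assume "v \<in> orbit_space E m k"
    then obtain f where f: "v = act f m" "f \<in> ?P" by (auto simp: orbit_space_def)
    moreover have "m \<in> vs_span US {m}"
      unfolding F using act_one[OF m] FA.span_base[of 1 "{1}"] by (intro image_eqI[of _ _ 1]) auto
    ultimately show "v \<in> ?L" by (auto simp: act_def)
  qed
  have "act_span PA M (vs_span US {m}) (power_sum PA (proj ` FA.span E) k) = vs_span US (orbit_space E m k)"
    unfolding act_span_def power_sum_image[OF E] S ..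
  also have "\<dots> = orbit_space E m k"
  proof -
    have im: "(\<lambda>f. act f m) ` fa_products E k \<subseteq> carrier US" using P m act_closed by blast
    have eq: "orbit_space E m k = US.span ((\<lambda>f. act f m) ` fa_products E k)"
      unfolding orbit_space_def act_span_image[OF P m] US.vs_span_eq ..
    have "submodule class_ring (orbit_space E m k) US" unfolding eq by (rule US.span_is_submodule[OF im])
    then have "US.span (orbit_space E m k) \<subseteq> orbit_space E m k" by (intro US.span_is_subset) auto
    moreover have "orbit_space E m k \<subseteq> carrier US" unfolding eq by (rule US.span_is_subset2[OF im])
    ultimately show ?thesis unfolding US.vs_span_eq using US.in_own_span by blast
  qed
  finally show ?thesis .
qed

text \<open>The pair consisting of the span of \<open>E\<close> and the line through
  \<open>m\<close> is one of those over which the supremum is taken.\<close>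

lemma growth_le_GK_dim_module:
  assumes "E \<subseteq> fa_on G" "finite E" "m \<in> carrier US"
  shows "growth_exponent (\<lambda>k. subspace_dim US (orbit_space E m k)) \<le> GK_dim_module PA M"
proof -
  have 1: "proj ` FA.span E \<in> fd_subspaces PA" unfolding fd_subspaces_PA_iff using assms by blast
  have 2: "vs_span US {m} \<in> fd_subspaces US" using assms by (intro US.span_fd) auto
  show ?thesis unfolding GK_dim_module_def
    by (rule SUP_upper2[OF 1], rule SUP_upper2[OF 2]) (simp add: act_span_eq_orbit_space[OF assms(1,3)])
qed

section \<open>Vectors that no word in given elements kills\<close>

definition nonvanishing :: "('g, 'k) free_alg set \<Rightarrow> 'm \<Rightarrow> bool" where
  "nonvanishing U m \<longleftrightarrow> (\<forall>us. set us \<subseteq> U \<longrightarrow> act (prod_list us) m \<noteq> zeroM)"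

text \<open>Forgets the scalar of \<open>skew_commute\<close>: for the question whether a word kills
  a vector, only its being nonzero counts.\<close>

definition skew_related :: "('g, 'k) free_alg \<Rightarrow> ('g, 'k) free_alg \<Rightarrow> bool" where
  "skew_related u g \<longleftrightarrow> (\<exists>c. c \<noteq> 0 \<and> skew_commute c u g)"

lemma skew_related_sym: "skew_related u g \<Longrightarrow> skew_related g u"
  unfolding skew_related_def using skew_commute_sym by (metis nonzero_imp_inverse_nonzero)

lemma skew_related_prod_list:
  "g \<in> fa_on G \<Longrightarrow> (\<And>u. u \<in> set us \<Longrightarrow> skew_related u g) \<Longrightarrow> skew_related (prod_list us) g"
proof (induction us)
  case Nil
  have "skew_commute 1 1 g" using Nil by (simp add: skew_commute_def fa_on_one fa_scalar_1 I_zero)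
  then show ?case unfolding skew_related_def by (intro exI[of _ 1]) simp
next
  case (Cons u us)
  then have "skew_related u g" "skew_related (prod_list us) g" by auto
  then obtain c d where "c \<noteq> 0" "skew_commute c u g" "d \<noteq> 0" "skew_commute d (prod_list us) g"
    unfolding skew_related_def by blast
  then show ?case unfolding skew_related_def
    using skew_commute_mult_left[of c u g d "prod_list us"] by (intro exI[of _ "c * d"]) simp
qed

lemma skew_related_power: "skew_related u g \<Longrightarrow> skew_related (u ^ k) g"
  unfolding skew_related_def using skew_commute_power_left by (metis power_not_zero)

lemma act_skew_zero_iff:
  assumes "skew_related u g" "m \<in> carrier US"
  shows "act (u * g) m = zeroM \<longleftrightarrow> act (g * u) m = zeroM"
proof -
  obtain c where c: "c \<noteq> 0" "skew_commute c u g" using assms(1) by (auto simp: skew_related_def)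
  then have "act (g * u) m \<in> carrier US" using assms(2) by (intro act_closed fa_on_mult) (auto simp: skew_commute_def)
  then show ?thesis unfolding act_skew[OF c(2) assms(2)] by (rule US.smult_eq_zero[OF _ c(1)])
qed

text \<open>Every occurrence of \<open>x\<close> can be moved to the end of the word at the cost of
  a nonzero scalar, so it suffices to test words of the shape (word in \<open>U\<close>) times
  (power of \<open>x\<close>).\<close>

lemma collect_letter:
  assumes x: "x \<in> fa_on G" and U: "U \<subseteq> fa_on G" and rel: "\<And>u. u \<in> U \<Longrightarrow> skew_related u x"
    and us: "set us \<subseteq> insert x U"
  shows "\<exists>vs k. set vs \<subseteq> U \<and>
    (\<forall>m\<in>carrier US. act (prod_list us) m = zeroM \<longleftrightarrow> act (prod_list vs * x ^ k) m = zeroM)"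
  using us
proof (induction us)
  case Nil
  then show ?case by (intro exI[of _ "[]"] exI[of _ 0]) simp
next
  case (Cons u us)
  then obtain vs k where vs: "set vs \<subseteq> U" and eq: "\<And>m. m \<in> carrier US \<Longrightarrow>
      act (prod_list us) m = zeroM \<longleftrightarrow> act (prod_list vs * x ^ k) m = zeroM" by auto
  have on: "prod_list us \<in> fa_on G" "prod_list vs \<in> fa_on G" "x ^ k \<in> fa_on G" "u \<in> fa_on G"
    using Cons.prems vs x U by (auto intro!: fa_on_prod_list fa_on_power)
  have step: "act (prod_list (u # us)) m = zeroM \<longleftrightarrow> act (u * prod_list vs * x ^ k) m = zeroM"
    if m: "m \<in> carrier US" for m
    using eq[OF act_closed[OF on(4) m]] m on by (simp add: act_mult fa_on_mult act_closed)
  show ?case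
  proof (cases "u = x")
    case False
    then show ?thesis using step vs Cons.prems by (intro exI[of _ "u # vs"] exI[of _ k]) (auto simp: mult.assoc)
  next
    case True
    have r: "skew_related (prod_list vs) x" using vs rel by (intro skew_related_prod_list x) auto
    have "act (u * prod_list vs * x ^ k) m = zeroM \<longleftrightarrow> act (prod_list vs * x ^ Suc k) m = zeroM"
      if m: "m \<in> carrier US" for m
    proof -
      obtain c where c: "c \<noteq> 0" "skew_commute c x (prod_list vs)"
        using skew_related_sym[OF r] by (auto simp: skew_related_def)
      have cl: "act (prod_list vs * x) m \<in> carrier US" using on x m by (intro act_closed fa_on_mult)
      have "act (x * prod_list vs * x ^ k) m = act (x ^ k) (c \<odot>\<^bsub>US\<^esub> act (prod_list vs * x) m)"
        using act_mult[OF fa_on_mult[OF x on(2)] on(3) m] act_skew[OF c(2) m] by simp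
      also have "\<dots> = c \<odot>\<^bsub>US\<^esub> act (x ^ k) (act (prod_list vs * x) m)" by (rule act_scale'[OF on(3) cl])
      also have "act (x ^ k) (act (prod_list vs * x) m) = act (prod_list vs * x ^ Suc k) m"
        using on x m act_mult[of "prod_list vs * x" "x ^ k" m] by (simp add: fa_on_mult mult.assoc)
      finally show ?thesis unfolding True
        using US.smult_eq_zero[OF _ c(1)] on x m act_closed by (simp add: fa_on_mult fa_on_power del: power_Suc)
    qed
    then show ?thesis using step vs by (intro exI[of _ vs] exI[of _ "Suc k"]) auto
  qed
qed

lemma nonvanishing_insertI:
  assumes x: "x \<in> fa_on G" and U: "U \<subseteq> fa_on G" and rel: "\<And>u. u \<in> U \<Longrightarrow> skew_related u x"
    and m: "m \<in> carrier US"
    and nz: "\<And>vs k. set vs \<subseteq> U \<Longrightarrow> act (prod_list vs * x ^ k) m \<noteq> zeroM"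
  shows "nonvanishing (insert x U) m"
  unfolding nonvanishing_def using collect_letter[OF x U rel] nz m by metis

text \<open>A relation \<open>x y = y x + z\<close> with \<open>z y = r y z\<close> makes \<open>y\<close> act without torsion on vectors killed by
  \<open>x\<close>, because \<open>y\<^sup>t\<^sup>+\<^sup>1 x = x y\<^sup>t\<^sup>+\<^sup>1 - (1 + r + \<cdots> + r\<^sup>t) y\<^sup>t z\<close>.\<close>

lemma power_commutator:
  assumes on: "x \<in> fa_on G" "y \<in> fa_on G" "z \<in> fa_on G"
    and xy: "x * y - y * x - z \<in> I" and zy: "skew_commute r z y"
  shows "y ^ Suc t * x - x * y ^ Suc t + fa_scalar (\<Sum>i\<le>t. r ^ i) * (y ^ t * z) \<in> I"
proof (induction t)
  case 0
  have eq: "y ^ Suc 0 * x - x * y ^ Suc 0 + fa_scalar (\<Sum>i\<le>0. r ^ i) * (y ^ 0 * z) = - (x * y - y * x - z)"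
    by (simp add: fa_scalar_1)
  show ?case unfolding eq by (rule I_uminus[OF xy])
next
  case (Suc t)
  let ?k = "\<Sum>i\<le>t. r ^ i"
  have zyt: "skew_commute (r ^ Suc t) z (y ^ Suc t)"
  proof (induction t)
    case 0
    then show ?case using zy by simp
  next
    case (Suc t)
    then show ?case using skew_commute_mult_right[OF zy Suc] by simp
  qed
  have split: "fa_scalar (\<Sum>i\<le>Suc t. r ^ i) = (fa_scalar ?k + fa_scalar (r ^ Suc t) :: ('g, 'k) free_alg)"
    by (simp add: fa_scalar_add)
  \<comment> \<open>Multiply the induction hypothesis by \<open>y\<close> on the left, then rewrite
    y x by the commutator and move \<open>z\<close> through the power of \<open>y\<close>.\<close>
  have "y ^ Suc (Suc t) * x - x * y ^ Suc (Suc t) + fa_scalar (\<Sum>i\<le>Suc t. r ^ i) * (y ^ Suc t * z)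
     = y * (y ^ Suc t * x - x * y ^ Suc t + fa_scalar ?k * (y ^ t * z))
       - (x * y - y * x - z) * y ^ Suc t
       - (z * y ^ Suc t - fa_scalar (r ^ Suc t) * (y ^ Suc t * z))"
    unfolding split by (simp add: algebra_simps fa_scalar_left_commute[of y])
  also have "\<dots> \<in> I"
    using zyt unfolding skew_commute_def
    by (intro I_diff[OF I_diff[OF I_mult_left[OF Suc on(2)] I_mult_right[OF xy fa_on_power[OF on(2)]]]]) simp
  finally show ?case .
qed

text \<open>If powers of \<open>x\<close> create torsion, a last nonzero stage before torsion is a
  vector killed by \<open>x\<close> but still by no word in \<open>U\<close>; on it the commutator
  turns a power of \<open>y\<close> into powers of \<open>z\<close>, and \<open>z\<close> is in
  \<open>U\<close>.\<close>

lemma nonvanishing_extend: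
  assumes on: "x \<in> fa_on G" "y \<in> fa_on G" "U \<subseteq> fa_on G" and z: "z \<in> U"
    and relx: "\<And>u. u \<in> U \<Longrightarrow> skew_related u x" and rely: "\<And>u. u \<in> U \<Longrightarrow> skew_related u y"
    and xy: "x * y - y * x - z \<in> I" and zy: "skew_commute r z y"
    and r: "\<And>t. (\<Sum>i\<le>t. r ^ i) \<noteq> 0"
    and m: "m \<in> carrier US" "nonvanishing U m"
  shows "\<exists>m'\<in>carrier US. nonvanishing (insert x U) m' \<or> nonvanishing (insert y U) m'"
proof (cases "\<forall>vs k. set vs \<subseteq> U \<longrightarrow> act (prod_list vs * x ^ k) m \<noteq> zeroM")
  case True
  then have "nonvanishing (insert x U) m" by (intro nonvanishing_insertI on relx m) auto
  then show ?thesis using m by blast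
next
  case False
  \<comment> \<open>The least exponent over all words at once. Minimality for one fixed word would
    not protect the new vector against further words in \<open>U\<close>.\<close>
  define k where "k = (LEAST k. \<exists>vs. set vs \<subseteq> U \<and> act (prod_list vs * x ^ k) m = zeroM)"
  have "\<exists>vs. set vs \<subseteq> U \<and> act (prod_list vs * x ^ k) m = zeroM"
    unfolding k_def by (rule LeastI_ex) (use False in blast)
  then obtain us where us: "set us \<subseteq> U" "act (prod_list us * x ^ k) m = zeroM" by blast
  have least: "act (prod_list vs * x ^ i) m \<noteq> zeroM" if "i < k" "set vs \<subseteq> U" for i vs
    using not_less_Least[of i "\<lambda>k. \<exists>vs. set vs \<subseteq> U \<and> act (prod_list vs * x ^ k) m = zeroM"] that
    unfolding k_def by blast
  have "k \<noteq> 0"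
  proof
    assume "k = 0"
    then show False using us m(2) by (auto simp: nonvanishing_def)
  qed
  then obtain l where k: "k = Suc l" by (cases k) auto
  have usG: "prod_list us \<in> fa_on G" using us on by (intro fa_on_prod_list) auto
  have xl: "x ^ l \<in> fa_on G" by (rule fa_on_power[OF on(1)])
  define m' where "m' = act (prod_list us * x ^ l) m"
  have m': "m' \<in> carrier US" unfolding m'_def using usG xl m by (intro act_closed fa_on_mult)
  have "act (prod_list us * x ^ l * x) m = zeroM" using us(2) unfolding k by (simp only: power_Suc2 mult.assoc)
  then have xm': "act x m' = zeroM"
    unfolding m'_def using act_mult[of "prod_list us * x ^ l" x m] usG xl on m by (simp add: fa_on_mult)
  \<comment> \<open>A word \<open>vs\<close> killing \<open>m'\<close> would make
    \<open>us @ vs\<close> followed by the l-th power of \<open>x\<close> kill \<open>m\<close>,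
    against the minimality of \<open>k\<close>.\<close>
  have nz: "act (prod_list vs) m' \<noteq> zeroM" if vs: "set vs \<subseteq> U" for vs
  proof -
    have vsG: "prod_list vs \<in> fa_on G" using vs on by (intro fa_on_prod_list) auto
    have rel: "skew_related (x ^ l) (prod_list vs)"
      using vs relx by (intro skew_related_power skew_related_sym[OF skew_related_prod_list] on) auto
    let ?u = "act (prod_list us) m"
    have u: "?u \<in> carrier US" by (rule act_closed[OF usG m(1)])
    have "act (prod_list (us @ vs) * x ^ l) m \<noteq> zeroM"
      using least[of l "us @ vs"] us vs k by auto
    moreover have "act (prod_list (us @ vs) * x ^ l) m = act (prod_list vs * x ^ l) ?u"
      using act_mult[of "prod_list us" "prod_list vs * x ^ l" m] usG vsG xl m by (simp add: fa_on_mult mult.assoc)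
    moreover have "act (prod_list vs) m' = act (x ^ l * prod_list vs) ?u"
      unfolding m'_def using usG vsG xl m by (simp add: act_mult fa_on_mult act_closed)
    ultimately show ?thesis using act_skew_zero_iff[OF rel u] by simp
  qed
  have "act (prod_list vs * y ^ t) m' \<noteq> zeroM" if vs: "set vs \<subseteq> U" for vs t
  proof -
    let ?u = "act (prod_list vs) m'"
    have vsG: "prod_list vs \<in> fa_on G" using vs on by (intro fa_on_prod_list) auto
    have u: "?u \<in> carrier US" by (rule act_closed[OF vsG m'])
    have zG: "z \<in> fa_on G" using z on by auto
    have rel: "skew_related (prod_list vs) x" using vs relx by (intro skew_related_prod_list on) auto
    have "act (x * prod_list vs) m' = zeroM"
      using act_mult[OF on(1) vsG m'] xm' act_zero[OF vsG] by simp
    then have xu: "act x ?u = zeroM"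
      using act_skew_zero_iff[OF rel m'] act_mult[OF vsG on(1) m'] by simp
    \<comment> \<open>The induction on \<open>t\<close> must be uniform in \<open>p\<close>, since
      each step trades one factor \<open>y\<close> for one more factor \<open>z\<close>. At t = 0
      only words in \<open>U\<close> remain.\<close>
    have "act (y ^ t * z ^ p) ?u \<noteq> zeroM" for p
    proof (induction t arbitrary: p)
      case 0
      have "act (prod_list (vs @ replicate p z)) m' \<noteq> zeroM" using vs z by (intro nz) auto
      then show ?case using act_mult[OF vsG fa_on_power[OF zG, of p] m'] by simp
    next
      case (Suc t)
      let ?Y = "y ^ Suc t" and ?Z = "z ^ p"
      have G: "?Y \<in> fa_on G" "?Z \<in> fa_on G" "y ^ t \<in> fa_on G" "z ^ Suc p \<in> fa_on G" by (intro fa_on_power on zG)+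
      have relz: "skew_related ?Z x" by (intro skew_related_power relx z)
      show ?case
      proof
        assume "act (?Y * ?Z) ?u = zeroM"
        \<comment> \<open>Apply \<open>x\<close> and move it to the left of z^p, giving (y^(t+1) x)
          z^p. As \<open>x\<close> kills \<open>?u\<close>, the commutator turns y^(t+1) x into a
          nonzero multiple of y^t z.\<close>
        then have "act (?Z * x) (act ?Y ?u) = zeroM"
          using G on u by (simp add: act_mult act_zero act_closed del: power_Suc)
        then have "act (x * ?Z) (act ?Y ?u) = zeroM"
          using act_skew_zero_iff[OF relz] G u by (simp add: act_closed del: power_Suc)
        then have 0: "act ?Z (act (?Y * x) ?u) = zeroM"
          using G on u by (simp add: act_mult act_closed del: power_Suc)
        let ?k = "\<Sum>i\<le>t. r ^ i"
        have "act (?Y * x + fa_scalar ?k * (y ^ t * z)) ?u = act (x * ?Y) ?u"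
        proof (rule act_cong)
          show "?Y * x + fa_scalar ?k * (y ^ t * z) \<in> fa_on G" "x * ?Y \<in> fa_on G"
            by (intro fa_on_add fa_on_mult fa_on_scalar G on zG)+
          have "?Y * x + fa_scalar ?k * (y ^ t * z) - x * ?Y = ?Y * x - x * ?Y + fa_scalar ?k * (y ^ t * z)" by simp
          then show "?Y * x + fa_scalar ?k * (y ^ t * z) - x * ?Y \<in> I"
            using power_commutator[OF on(1,2) zG xy zy, of t] by (simp only:)
        qed
        also have "\<dots> = zeroM" using xu G on u by (simp add: act_mult act_zero del: power_Suc)
        finally have "act (?Y * x) ?u \<oplus>\<^bsub>US\<^esub> ?k \<odot>\<^bsub>US\<^esub> act (y ^ t * z) ?u = zeroM"
          using G on u zG by (simp add: act_add act_scale fa_on_mult fa_on_scalar del: power_Suc)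
        then have "act ?Z (act (?Y * x) ?u \<oplus>\<^bsub>US\<^esub> ?k \<odot>\<^bsub>US\<^esub> act (y ^ t * z) ?u) = zeroM"
          using act_zero[OF G(2)] by simp
        then have "zeroM \<oplus>\<^bsub>US\<^esub> ?k \<odot>\<^bsub>US\<^esub> act ?Z (act (y ^ t * z) ?u) = zeroM"
          using US.linear_opD(2,3)[OF linear_op_act[OF G(2)]] G on u zG 0
          by (simp add: act_closed fa_on_mult US.smult_in del: power_Suc)
        then have "?k \<odot>\<^bsub>US\<^esub> act ?Z (act (y ^ t * z) ?u) = zeroM"
          using G u zG by (simp add: act_closed fa_on_mult US.smult_in US.M.l_zero)
        then have "act ?Z (act (y ^ t * z) ?u) = zeroM"
          using US.smult_eq_zero[OF _ r] G u zG by (simp add: act_closed fa_on_mult)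
        then have "act (y ^ t * z ^ Suc p) ?u = zeroM"
          using G u zG act_mult[of "y ^ t * z" ?Z ?u] by (simp add: fa_on_mult mult.assoc)
        then show False using Suc by blast
      qed
    qed
    from this[of 0] show ?thesis using act_mult[OF vsG fa_on_power[OF on(2), of t] m'] by simp
  qed
  then have "nonvanishing (insert y U) m'" by (intro nonvanishing_insertI on rely m') auto
  then show ?thesis using m' by blast
qed

end

lemma sum_lessThan_add: "(\<Sum>j<a + b. f j) = (\<Sum>j<a. f j) + (\<Sum>j<b. f (a + j :: nat) :: 'a::comm_monoid_add)"
  by (induction b) (simp_all add: add.assoc)

lemma (in presentation_module) op_monomial_act:
  assumes "\<And>i. i < s \<Longrightarrow> e i \<in> U" "U \<subseteq> fa_on G" "m \<in> carrier US"
  shows "\<exists>us. set us \<subseteq> U \<and> US.op_monomial (\<lambda>i. act (e i)) s a m = act (prod_list us) m"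
  using assms(1,3)
proof (induction s arbitrary: m)
  case 0
  then show ?case by (intro exI[of _ "[]"]) (simp add: act_one)
next
  case (Suc s)
  have e: "e s \<in> fa_on G" "e s \<in> U" using Suc.prems assms(2) by auto
  have pow: "(act (e s) ^^ k) m = act (prod_list (replicate k (e s))) m" for k
  proof (induction k)
    case 0
    then show ?case using Suc.prems by (simp add: act_one)
  next
    case (Suc k)
    have "e s ^ k * e s = e s * e s ^ k" by (simp add: power_commutes)
    then show ?case using Suc act_mult[OF fa_on_power[OF e(1), of k] e(1) \<open>m \<in> carrier US\<close>]
      by simp
  qed
  let ?v = "prod_list (replicate (a s) (e s))"
  have v: "?v \<in> fa_on G" using e by (intro fa_on_prod_list) auto
  obtain us where us: "set us \<subseteq> U"
    "US.op_monomial (\<lambda>i. act (e i)) s a (act ?v m) = act (prod_list us) (act ?v m)"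
    using Suc.IH[of "act ?v m"] Suc.prems act_closed[OF v] by auto
  have "prod_list us \<in> fa_on G" using us(1) assms(2) by (intro fa_on_prod_list) auto
  then have "US.op_monomial (\<lambda>i. act (e i)) (Suc s) a m = act (prod_list (replicate (a s) (e s) @ us)) m"
    using act_mult[OF v _ Suc.prems(2), of "prod_list us"] us(2) pow by simp
  moreover have "set (replicate (a s) (e s) @ us) \<subseteq> U" using us e by auto
  ultimately show ?case by blast
qed

text \<open>Degree count: applying a monomial raises the filtration degree by at most the sum of its
  exponents.\<close>

lemma (in presentation_module) op_monomial_orbit:
  assumes "\<And>i. i < s \<Longrightarrow> e i \<in> E" "E \<subseteq> fa_on G" "m \<in> carrier US" "w \<in> orbit_space E m j"
  shows "US.op_monomial (\<lambda>i. act (e i)) s a w \<in> orbit_space E m (j + (\<Sum>i<s. a i))"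
  using assms(1,4)
proof (induction s arbitrary: w j)
  case 0
  then show ?case by simp
next
  case (Suc s)
  have "(act (e s) ^^ k) w \<in> orbit_space E m (j + k)" for k
  proof (induction k)
    case 0
    then show ?case using Suc.prems by simp
  next
    case (Suc k)
    then show ?case using orbit_space_act[OF assms(2,3)] \<open>\<And>i. i < Suc s \<Longrightarrow> e i \<in> E\<close> by simp
  qed
  from Suc.IH[OF _ this[of "a s"]] Suc.prems(1) show ?case by (simp add: ac_simps)
qed

section \<open>Powers of q, words in the \<open>z i\<close>, and the choice of letters\<close>

context quantum_euclid
begin

lemma powi_inj: "q powi a = q powi b \<longleftrightarrow> a = b"
proof -
  have "a = b" if "q powi a = q powi b" "a \<le> b" for a b
  proof (rule ccontr)
    assume "a \<noteq> b"
    then have "nat (b - a) \<ge> 1" using that by simp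
    moreover have "q powi (b - a) = 1" using that q_nonzero by (simp add: power_int_diff)
    then have "q ^ nat (b - a) = 1" using that(2) by (simp add: power_int_def)
    ultimately show False using q_not_root by blast
  qed
  then show ?thesis by (metis linear)
qed

text \<open>A vanishing sum would give (q^-2)^(t+1) = 1 by the geometric series. This supplies the
  hypothesis on \<open>r\<close> of \<open>nonvanishing_extend\<close>.\<close>

lemma geometric_nonzero: "(\<Sum>i\<le>t. inverse (q ^ 2) ^ i) \<noteq> 0"
proof
  assume "(\<Sum>i\<le>t. inverse (q ^ 2) ^ i) = 0"
  then have "inverse (q ^ 2) ^ Suc t = 1" using sum_gp_basic[of "inverse (q ^ 2)" t] by simp
  then have "(q ^ 2) ^ Suc t = 1" by (metis inverse_1 inverse_inverse_eq power_inverse)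
  then have "q ^ (2 * Suc t) = 1" by (simp only: power_mult)
  then show False using q_not_root[of "2 * Suc t"] by simp
qed

text \<open>The list of indices is a parameter for the sake of induction; for
  \<open>[1..<Suc n]\<close> this lifts the elements of the Ore set, factors in the same
  order.\<close>

definition z_monomial :: "(nat \<Rightarrow> nat) \<Rightarrow> nat list \<Rightarrow> (gen, 'k) free_alg" where
  "z_monomial j ls = prod_list (map (\<lambda>l. z l ^ j l) ls)"

lemma z_monomial_on: "set ls \<subseteq> {..n} \<Longrightarrow> z_monomial j ls \<in> Fn"
  unfolding z_monomial_def by (induction ls) (auto simp: fa_on_one fa_on_mult fa_on_power z_on)

lemma z_monomial_Cons: "z_monomial j (l # ls) = z l ^ j l * z_monomial j ls"
  by (simp add: z_monomial_def)

lemma z_monomial_mult: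
  "distinct ls \<Longrightarrow> i \<in> set ls \<Longrightarrow> set ls \<subseteq> {..n} \<Longrightarrow>
    z i * z_monomial j ls - z_monomial (j(i := Suc (j i))) ls \<in> I"
proof (induction ls)
  case (Cons l ls)
  have on: "z_monomial j ls \<in> Fn" "z l ^ j l \<in> Fn"
    using Cons.prems by (auto intro: z_monomial_on fa_on_power z_on)
  show ?case
  proof (cases "l = i")
    case True
    have "z_monomial (j(i := Suc (j i))) ls = z_monomial j ls"
      unfolding z_monomial_def by (intro arg_cong[where f = prod_list] map_cong) (use True Cons.prems in auto)
    then have eq: "z i * z_monomial j (l # ls) - z_monomial (j(i := Suc (j i))) (l # ls) = 0"
      using True by (simp add: z_monomial_Cons mult.assoc)
    show ?thesis unfolding eq by (rule I_zero)
  next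
    case False
    let ?r = "z_monomial j ls" and ?r' = "z_monomial (j(i := Suc (j i))) ls" and ?p = "z l ^ j l"
    have "skew_commute 1 ?p (z i)"
      using skew_commute_power_left[OF skew_z_z[of l i], of "j l"] Cons.prems by auto
    then have "?p * z i - z i * ?p \<in> I" by (simp add: skew_commute_def fa_scalar_1)
    from I_uminus[OF this] have c: "z i * ?p - ?p * z i \<in> I" by simp
    have IH: "z i * ?r - ?r' \<in> I" by (rule Cons.IH) (use Cons.prems False in auto)
    have "z i * z_monomial j (l # ls) - z_monomial (j(i := Suc (j i))) (l # ls)
        = (z i * ?p - ?p * z i) * ?r + ?p * (z i * ?r - ?r')"
      using False by (simp add: z_monomial_Cons algebra_simps)
    then show ?thesis using I_add[OF I_mult_right[OF c on(1)] I_mult_left[OF IH on(2)]] by (simp only:)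
  qed
qed simp

text \<open>The \<open>z i\<close> commute, so every word in them represents an element of the Ore
  set. Thus a vector without torsion is one that no word kills.\<close>

lemma z_product_eq_monomial:
  "set is \<subseteq> {1..n} \<Longrightarrow> \<exists>j. prod_list (map z is) - z_monomial j [1..<Suc n] \<in> I"
proof (induction "is")
  case Nil
  have "z_monomial (\<lambda>_. 0) ls = 1" for ls by (induction ls) (auto simp: z_monomial_def)
  then show ?case by (intro exI[of _ "\<lambda>_. 0"]) (simp add: I_zero del: upt_Suc)
next
  case (Cons i "is")
  then obtain j where j: "prod_list (map z is) - z_monomial j [1..<Suc n] \<in> I" by auto
  have i: "z i * z_monomial j [1..<Suc n] - z_monomial (j(i := Suc (j i))) [1..<Suc n] \<in> I"
    using Cons.prems by (intro z_monomial_mult) auto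
  have "z i \<in> Fn" using Cons.prems by (intro z_on) auto
  from I_add[OF I_mult_left[OF j this] i]
  have "z i * prod_list (map z is) - z_monomial (j(i := Suc (j i))) [1..<Suc n] \<in> I"
    by (simp add: right_diff_distrib del: upt_Suc)
  then show ?case by auto
qed

lemma proj_z_power: "i \<le> n \<Longrightarrow> proj (z i) [^]\<^bsub>PA\<^esub> (k :: nat) = proj (z i ^ k)"
proof (induction k)
  case 0
  interpret P: ring PA by (rule ring_presented)
  show ?case by (simp add: proj_one)
next
  case (Suc k)
  interpret P: ring PA by (rule ring_presented)
  show ?case using Suc proj_mult[OF fa_on_power[OF z_on[of i], of k] z_on[of i]]
    by (simp only: P.nat_pow_Suc power_Suc2)
qed

lemma z_monomial_in_Z: "proj (z_monomial j [1..<Suc n]) \<in> quantum_euclidean_Z n q"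
proof -
  have "foldr (\<lambda>i a. (proj (z i) [^]\<^bsub>PA\<^esub> j i) \<otimes>\<^bsub>PA\<^esub> a) ls \<one>\<^bsub>PA\<^esub> = proj (z_monomial j ls)"
    if "set ls \<subseteq> {..n}" for ls
    using that
  proof (induction ls)
    case Nil
    then show ?case by (simp add: z_monomial_def proj_one)
  next
    case (Cons l ls)
    then have "proj (z l ^ j l * z_monomial j ls) = (proj (z l) [^]\<^bsub>PA\<^esub> j l) \<otimes>\<^bsub>PA\<^esub> proj (z_monomial j ls)"
      using proj_mult[OF fa_on_power[OF z_on] z_monomial_on] by (simp add: proj_z_power)
    then show ?case using Cons by (simp add: z_monomial_Cons)
  qed
  then have "proj (z_monomial j [1..<Suc n])
    = foldr (\<lambda>i a. (proj (z i) [^]\<^bsub>PA\<^esub> j i) \<otimes>\<^bsub>PA\<^esub> a) [1..<Suc n] \<one>\<^bsub>PA\<^esub>"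
    by (rule sym) auto
  then show ?thesis
    unfolding quantum_euclidean_Z_def Kn_Z_def Let_def Kn_z_eq Kn_algebra_def by blast
qed

text \<open>\<open>p\<close> records which alternative of \<open>nonvanishing_extend\<close>
  occurred at each index.\<close>

definition letter :: "(nat \<Rightarrow> bool) \<Rightarrow> nat \<Rightarrow> (gen, 'k) free_alg" where
  "letter p i = (if p i then x i else y i)"

lemma letter_on: "1 \<le> i \<Longrightarrow> i \<le> n \<Longrightarrow> letter p i \<in> Fn"
  by (simp add: letter_def x_on y_on)

lemma skew_commute_self: "u \<in> Fn \<Longrightarrow> skew_commute 1 u u"
  by (simp add: skew_commute_def fa_scalar_1 I_zero)

text \<open>Only a bound on the exponent is kept. The pair \<open>x i\<close>, \<open>y i\<close>
  must be excluded, as their commutator is \<open>z (i - 1)\<close>; the bound 2, larger than needed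
  here, is shared with the pairs that involve some \<open>z i\<close>.\<close>

lemma skew_letter_letter:
  assumes "1 \<le> i" "i \<le> n" "1 \<le> j" "j \<le> n"
  shows "\<exists>l. \<bar>l\<bar> \<le> 2 \<and> (p i = p' i \<or> i \<noteq> j \<longrightarrow> skew_commute (q powi l) (letter p i) (letter p' j))"
proof -
  have 1: "q powi 1 = q" "q powi (-1) = inverse q" "q powi 0 = 1" by (simp_all add: power_int_minus)
  consider "i < j" | "j < i" | "i = j" by linarith
  then show ?thesis
  proof cases
    case 1
    show ?thesis
      by (rule exI[of _ "if p i then (if p' j then 1 else -1) else (if p' j then 1 else -1)"])
        (use 1 assms skew_x_x skew_x_y skew_y_x skew_y_y in \<open>auto simp: letter_def power_int_minus\<close>)
  next
    case 2
    show ?thesis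
      by (rule exI[of _ "if p i then -1 else 1"])
        (use 2 assms skew_x_x' skew_x_y skew_y_x skew_y_y' in \<open>auto simp: letter_def power_int_minus\<close>)
  next
    case 3
    show ?thesis
      by (rule exI[of _ 0]) (use 3 assms in \<open>auto simp: letter_def skew_commute_self x_on y_on\<close>)
  qed
qed

lemma skew_z_letter:
  assumes "1 \<le> i" "i \<le> n" "1 \<le> j" "j \<le> n"
  shows "skew_commute (q powi (if i < j then (if p j then 2 else -2) else 0)) (z i) (letter p j)"
  using skew_z_x_above[of j i] skew_z_y_above[of j i] skew_z_x_below[of i j] skew_z_y_below[of i j] assms
  by (auto simp: letter_def power_int_minus)

lemma skew_letter_z:
  assumes "1 \<le> i" "i \<le> n" "1 \<le> j" "j \<le> n"
  shows "skew_commute (q powi (if i < j then (if p j then -2 else 2) else 0)) (letter p j) (z i)"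
  using skew_commute_sym[OF skew_z_letter[OF assms, of p]] q_nonzero
  by (auto simp: power_int_minus split: if_splits)

end

section \<open>From a vector without torsion to the growth of its orbit\<close>

locale quantum_euclid_module = quantum_euclid n q +
  presentation_module "Kn_gens n" "Kn_relations n (qe_p q) qe_q (qe_gamma q)" M
  for n :: nat and q :: "'k::field" and M :: "((gen, 'k) free_alg set, 'm) module"
begin

lemma nonvanishing_z:
  assumes "\<not> torsion_module (quantum_euclidean_Z n q) M"
  shows "\<exists>m\<in>carrier US. nonvanishing (z ` {1..n}) m"
proof -
  obtain m where m: "m \<in> carrier US" "\<And>s. s \<in> quantum_euclidean_Z n q \<Longrightarrow> s \<odot>\<^bsub>M\<^esub> m \<noteq> zeroM"
    using assms by (auto simp: torsion_module_def carrier_US zero_US)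
  have "act (prod_list us) m \<noteq> zeroM" if us: "set us \<subseteq> z ` {1..n}" for us
  proof -
    have "\<forall>u\<in>set us. \<exists>i. i \<in> {1..n} \<and> u = z i" using us by blast
    then obtain r where r: "\<forall>u\<in>set us. r u \<in> {1..n} \<and> u = z (r u)" by metis
    have eq: "map z (map r us) = us" using r by (simp add: map_idI)
    have sub: "set (map r us) \<subseteq> {1..n}" using r by auto
    obtain j where j: "prod_list us - z_monomial j [1..<Suc n] \<in> I"
      using z_product_eq_monomial[OF sub] unfolding eq by blast
    have "prod_list us \<in> Fn" using us z_on by (intro fa_on_prod_list) auto
    moreover have "z_monomial j [1..<Suc n] \<in> Fn" by (rule z_monomial_on) auto
    ultimately have "act (prod_list us) m = act (z_monomial j [1..<Suc n]) m" using j by (rule act_cong)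
    then show ?thesis using m(2)[OF z_monomial_in_Z, of j] by (simp only: act_def not_False_eq_True)
  qed
  then show ?thesis using m(1) by (auto simp: nonvanishing_def)
qed

text \<open>Letters are added one index at a time. They start at 2 because the commutator at index j
  is \<open>z (j - 1)\<close>, which is zero at j = 1.\<close>

lemma nonvanishing_letters:
  assumes "\<not> torsion_module (quantum_euclidean_Z n q) M" "J \<le> n"
  shows "\<exists>p. \<exists>m\<in>carrier US. nonvanishing (z ` {1..n} \<union> letter p ` {2..J}) m"
  using assms(2)
proof (induction J)
  case 0
  then show ?case using nonvanishing_z[OF assms(1)] by simp
next
  case (Suc J)
  then obtain p m where m: "m \<in> carrier US" "nonvanishing (z ` {1..n} \<union> letter p ` {2..J}) m" by auto
  show ?case
  proof (cases "J = 0")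
    case True
    then show ?thesis using m by auto
  next
    case False
    let ?U = "z ` {1..n} \<union> letter p ` {2..J}" and ?j = "Suc J"
    have UG: "?U \<subseteq> Fn" using Suc.prems by (auto intro: z_on letter_on)
    have rel: "skew_related u (letter p' ?j)" if "u \<in> ?U" for u p'
    proof -
      consider i where "i \<in> {1..n}" "u = z i" | i where "i \<in> {2..J}" "u = letter p i" using \<open>u \<in> ?U\<close> by blast
      then show ?thesis
      proof cases
        case 1
        then have "skew_commute (q powi (if i < ?j then (if p' ?j then 2 else -2) else 0)) u (letter p' ?j)"
          using skew_z_letter[of i ?j p'] Suc.prems by simp
        then show ?thesis unfolding skew_related_def using q_nonzero by (metis power_int_eq_0_iff)
      next
        case 2
        then obtain l where "skew_commute (q powi l) u (letter p' ?j)"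
          using skew_letter_letter[of i ?j p p'] Suc.prems by auto
        then show ?thesis unfolding skew_related_def using q_nonzero by (metis power_int_eq_0_iff)
      qed
    qed
    have on: "x ?j \<in> Fn" "y ?j \<in> Fn" using Suc.prems by (auto intro: x_on y_on)
    \<comment> \<open>The commutator at \<open>?j\<close> is \<open>z J\<close>; as J is positive,
      it is among the elements already known not to kill the vector.\<close>
    have zU: "z J \<in> ?U" using False Suc.prems by auto
    have xy: "x ?j * y ?j - y ?j * x ?j - z J \<in> I" using relations(5)[of ?j] Suc.prems by simp
    have zy: "skew_commute (inverse (q ^ 2)) (z J) (y ?j)" using skew_z_y_below[of J ?j] Suc.prems by simp
    have "\<exists>m'\<in>carrier US. nonvanishing (insert (x ?j) ?U) m' \<or> nonvanishing (insert (y ?j) ?U) m'"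
    proof (rule nonvanishing_extend[OF on UG zU _ _ xy zy geometric_nonzero m])
      show "skew_related u (x ?j)" if "u \<in> ?U" for u
        using rel[OF that, of "\<lambda>_. True"] by (simp only: letter_def if_True)
      show "skew_related u (y ?j)" if "u \<in> ?U" for u
        using rel[OF that, of "\<lambda>_. False"] by (simp only: letter_def if_False)
    qed
    then obtain m' where m': "m' \<in> carrier US"
      and "nonvanishing (insert (x ?j) ?U) m' \<or> nonvanishing (insert (y ?j) ?U) m'" by (rule bexE)
    from this(2) have "\<exists>b. nonvanishing (insert (if b then x ?j else y ?j) ?U) m'"
      by (rule disjE) (rule exI[of _ True], simp only: if_True, rule exI[of _ False], simp only: if_False)
    then obtain b where b: "nonvanishing (insert (if b then x ?j else y ?j) ?U) m'" by (rule exE)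
    have "insert (if b then x ?j else y ?j) ?U = z ` {1..n} \<union> letter (p(?j := b)) ` {2..?j}"
    proof -
      have "{2..?j} = insert ?j {2..J}" using False by auto
      moreover have "letter (p(?j := b)) ` {2..J} = letter p ` {2..J}" by (intro image_cong) (auto simp: letter_def)
      moreover have "letter (p(?j := b)) ?j = (if b then x ?j else y ?j)" by (simp add: letter_def)
      ultimately show ?thesis by (simp only: image_insert Un_insert_right)
    qed
    then have "nonvanishing (z ` {1..n} \<union> letter (p(?j := b)) ` {2..?j}) m'" using b by (simp only:)
    then show ?thesis using m' by (intro exI[of _ "p(?j := b)"] bexI[of _ m'])
  qed
qed

text \<open>Bernstein's inequality for the n - 1 letters and z_1, ..., z_(n-1). The degrees come
  from the number of values that the characters take on a box.\<close>

lemma orbit_dim_product: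
  assumes n: "1 \<le> n" and nt: "\<not> torsion_module (quantum_euclidean_Z n q) M"
  defines "s \<equiv> 2 * (n - 1)"
  shows "\<exists>E m. finite E \<and> E \<subseteq> Fn \<and> m \<in> carrier US \<and>
    (\<forall>k. (k + 1) ^ s \<le> subspace_dim US (orbit_space E m (4 * s * s * k)) *
      subspace_dim US (orbit_space E m ((4 * s * s + s) * k)))"
proof -
  define r where "r = n - 1"
  have s: "s = r + r" by (simp add: s_def r_def)
  obtain p m where m: "m \<in> carrier US" "nonvanishing (z ` {1..n} \<union> letter p ` {2..n}) m"
    using nonvanishing_letters[OF nt order.refl] by blast
  \<comment> \<open>Positions below \<open>r\<close> hold the letters of index 2, ..., n, the others
    z_1, ..., z_(n-1). \<open>z n\<close> commutes with all generators and would spoil separation by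
    characters.\<close>
  define e where "e i = (if i < r then letter p (i + 2) else z (i - r + 1))" for i
  let ?U = "z ` {1..n} \<union> letter p ` {2..n}"
  have UG: "?U \<subseteq> Fn" by (auto intro: z_on letter_on)
  have eU: "e i \<in> ?U" if "i < s" for i
  proof (cases "i < r")
    case True
    then have "i + 2 \<in> {2..n}" by (auto simp: r_def)
    then show ?thesis using True by (auto simp: e_def)
  next
    case False
    then have "i - r + 1 \<in> {1..n}" using that by (auto simp: r_def s)
    then show ?thesis using False by (auto simp: e_def)
  qed
  have eG: "e i \<in> Fn" if "i < s" for i using eU[OF that] UG by blast
  define \<sigma> where "\<sigma> i = (if p (i + 2) then 2 else -2 :: int)" for i
  \<comment> \<open>The exponents of \<open>q\<close> in the commutation of the operators. The order
    \<open>e j\<close>, \<open>e i\<close> is reversed because the action is on the right. Exact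
    values are recorded except between two letters, where the bound suffices.\<close>
  have "\<exists>l. \<forall>i j. i < s \<longrightarrow> j < s \<longrightarrow> \<bar>l i j\<bar> \<le> 2 \<and> skew_commute (q powi l i j) (e j) (e i) \<and>
      (r \<le> i \<longrightarrow> j < r \<longrightarrow> l i j = (if i - r \<le> j then - \<sigma> j else 0)) \<and>
      (i < r \<longrightarrow> r \<le> j \<longrightarrow> l i j = (if j - r \<le> i then \<sigma> i else 0)) \<and> (r \<le> i \<longrightarrow> r \<le> j \<longrightarrow> l i j = 0)"
    (is "\<exists>l. \<forall>i j. ?P i j (l i j)")
  proof -
    have "\<exists>l. ?P i j l" for i j
    proof (cases "i < s \<and> j < s")
      case ij: True
      consider "i < r" "j < r" | "i < r" "r \<le> j" | "r \<le> i" "j < r" | "r \<le> i" "r \<le> j" by linarith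
      then show ?thesis
      proof cases
        case 1
        then show ?thesis using skew_letter_letter[of "j + 2" "i + 2" p p] by (auto simp: e_def r_def)
      next
        case 2
        have eq: "j - r + 1 < i + 2 \<longleftrightarrow> j - r \<le> i" by linarith
        from 2 have "skew_commute (q powi (if j - r \<le> i then \<sigma> i else 0)) (e j) (e i)"
          using skew_z_letter[of "j - r + 1" "i + 2" p] ij unfolding eq \<sigma>_def by (auto simp: e_def r_def s split: if_splits)
        then show ?thesis using 2 by (intro exI[of _ "if j - r \<le> i then \<sigma> i else 0"]) (auto simp: \<sigma>_def)
      next
        case 3
        have eq: "i - r + 1 < j + 2 \<longleftrightarrow> i - r \<le> j" by linarith
        from 3 have "skew_commute (q powi (if i - r \<le> j then - \<sigma> j else 0)) (e j) (e i)"
          using skew_letter_z[of "i - r + 1" "j + 2" p] ij unfolding eq \<sigma>_def by (auto simp: e_def r_def s split: if_splits)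
        then show ?thesis using 3 by (intro exI[of _ "if i - r \<le> j then - \<sigma> j else 0"]) (auto simp: \<sigma>_def)
      next
        case 4
        then have "skew_commute 1 (e j) (e i)" using ij by (auto simp: e_def r_def s intro!: skew_z_z)
        then show ?thesis using 4 by (intro exI[of _ 0]) auto
      qed
    qed auto
    then show ?thesis by (intro exI[of _ "\<lambda>i j. SOME l. ?P i j l"] allI) (rule someI_ex)
  qed
  then obtain l where
    l_bound: "\<And>i j. i < s \<Longrightarrow> j < s \<Longrightarrow> \<bar>l i j\<bar> \<le> 2" and
    l_skew: "\<And>i j. i < s \<Longrightarrow> j < s \<Longrightarrow> skew_commute (q powi l i j) (e j) (e i)" and
    l_zw: "\<And>i j. i < s \<Longrightarrow> j < s \<Longrightarrow> r \<le> i \<Longrightarrow> j < r \<Longrightarrow> l i j = (if i - r \<le> j then - \<sigma> j else 0)" and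
    l_wz: "\<And>i j. i < s \<Longrightarrow> j < s \<Longrightarrow> i < r \<Longrightarrow> r \<le> j \<Longrightarrow> l i j = (if j - r \<le> i then \<sigma> i else 0)" and
    l_zz: "\<And>i j. i < s \<Longrightarrow> j < s \<Longrightarrow> r \<le> i \<Longrightarrow> r \<le> j \<Longrightarrow> l i j = 0"
    by blast
  let ?T = "\<lambda>i. act (e i)"
  interpret T: skew_operators US ?T s "\<lambda>i j. q powi l i j"
  proof
    show "US.linear_op (act (e i))" if "i < s" for i by (rule linear_op_act[OF eG[OF that]])
    show "act (e i) (act (e j) v) = (q powi l i j) \<odot>\<^bsub>US\<^esub> act (e j) (act (e i) v)"
      if "i < s" "j < s" "v \<in> carrier US" for i j v
      using act_skew[OF l_skew[OF that(1,2)] that(3)] act_mult[OF eG[OF that(2)] eG[OF that(1)] that(3)]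
        act_mult[OF eG[OF that(1)] eG[OF that(2)] that(3)] by simp
    show "q powi l i j \<noteq> 0" for i j using q_nonzero by simp
  qed
  have chi: "T.chi t i a = q powi (\<Sum>j<t. l i j * int (a j))" for t i a
    unfolding T.chi_def
    by (induction t) (simp_all add: power_int_add q_nonzero power_int_mult power_int_of_nat)
  define E where "E = e ` {..<s}"
  have E: "finite E" "E \<subseteq> Fn" "\<And>i. i < s \<Longrightarrow> e i \<in> E" using eG by (auto simp: E_def)
  note W = orbit_space_fd[OF E(2,1) m(1)]
  have "(k + 1) ^ s \<le> subspace_dim US (orbit_space E m (4 * s * s * k)) *
      subspace_dim US (orbit_space E m ((4 * s * s + s) * k))" for k
  \<comment> \<open>A character takes at most 4 s k + 1 values on the box of side k, whence
    \<open>D\<close>. A monomial with s exponents up to \<open>D\<close> has degree at most 4 s s k,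
    and one in the box of side k adds at most s k.\<close>
  proof (rule T.box_le_dim_product[where D = "4 * s * k" and k = k, OF W[of "4 * s * s * k"]
        W[of "(4 * s * s + s) * k"] W[of "(4 * s * s + s) * k + 4 * s * s * k"] m(1)])
    fix a
    obtain us where "set us \<subseteq> ?U" "US.op_monomial ?T s a m = act (prod_list us) m"
      using op_monomial_act[of s e ?U m a, OF eU UG m(1)] by blast
    then show "US.op_monomial ?T s a m \<noteq> zeroM" using m(2) by (simp add: nonvanishing_def)
  next
    have box: "US.op_monomial ?T s g w \<in> orbit_space E m (j + s * b)"
      if "g \<in> {..<s} \<rightarrow>\<^sub>E {..b}" "w \<in> orbit_space E m j" for g w j and b :: nat
    proof -
      have "(\<Sum>i<s. g i) \<le> (\<Sum>i<s. b)" using that(1) by (intro sum_mono) auto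
      then have "j + (\<Sum>i<s. g i) \<le> j + s * b" by simp
      from orbit_space_mono[OF this] show ?thesis
        by (rule subsetD) (rule op_monomial_orbit[OF E(3,2) m(1) that(2)])
    qed
    show "US.op_monomial ?T s g m \<in> orbit_space E m (4 * s * s * k)" if "g \<in> {..<s} \<rightarrow>\<^sub>E {..4 * s * k}" for g
      using box[OF that orbit_space_base[OF m(1)]] by (simp add: mult_ac)
    show "US.op_monomial ?T s b w \<in> orbit_space E m ((4 * s * s + s) * k)"
      if "b \<in> {..<s} \<rightarrow>\<^sub>E {..k}" "w \<in> orbit_space E m (4 * s * s * k)" for b w
      using box[OF that] by (simp add: algebra_simps)
    show "US.op_monomial ?T s g w \<in> orbit_space E m ((4 * s * s + s) * k + 4 * s * s * k)"
      if "g \<in> {..<s} \<rightarrow>\<^sub>E {..4 * s * k}" "w \<in> orbit_space E m ((4 * s * s + s) * k)" for g w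
      using box[OF that] by (simp add: algebra_simps)
  next
    fix a b assume ab: "a \<in> {..<s} \<rightarrow>\<^sub>E {..k}" "b \<in> {..<s} \<rightarrow>\<^sub>E {..k}" "a \<noteq> b"
    show "\<exists>i<s. T.chi s i a \<noteq> T.chi s i b"
    proof (rule ccontr)
      assume "\<not> ?thesis"
      then have eq: "(\<Sum>j<s. l i j * int (a j)) = (\<Sum>j<s. l i j * int (b j))" if "i < s" for i
        using that unfolding chi powi_inj by blast
      \<comment> \<open>Separation is injectivity of the exponent matrix on integer vectors;
        \<open>d\<close> is a vector in its kernel.\<close>
      define d where "d j = int (a j) - int (b j)" for j
      have sum0: "(\<Sum>j<r. l i j * d j) + (\<Sum>j<r. l i (r + j) * d (r + j)) = 0" if "i < s" for i
        using eq[OF that] unfolding s sum_lessThan_add d_def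
        by (simp add: right_diff_distrib sum_subtractf)
      \<comment> \<open>The row of z_(i+1): it commutes with all z's and fails to commute exactly
        with the letters of index j + 2 > i + 1. Subtracting consecutive tail sums then gives
        \<open>d = 0\<close> on the letters.\<close>
      have tail: "(\<Sum>j<r. if i \<le> j then \<sigma> j * d j else 0) = 0" if "i < r" for i
      proof -
        have "(\<Sum>j<r. l (r + i) j * d j) = (\<Sum>j<r. - (if i \<le> j then \<sigma> j * d j else 0))"
          using that by (intro sum.cong) (auto simp: l_zw s)
        moreover have "(\<Sum>j<r. l (r + i) (r + j) * d (r + j)) = 0"
          using that by (intro sum.neutral) (auto simp: l_zz s)
        ultimately show ?thesis using sum0[of "r + i"] that by (simp add: s sum_negf)
      qed
      have dw: "d i = 0" if "i < r" for i
      proof -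
        have "(\<Sum>j<r. if Suc i \<le> j then \<sigma> j * d j else 0) = 0"
        proof (cases "Suc i < r")
          case False
          then show ?thesis by (intro sum.neutral) auto
        qed (rule tail)
        moreover have "(\<Sum>j<r. if i \<le> j then \<sigma> j * d j else 0)
          = (\<Sum>j<r. (if j = i then \<sigma> j * d j else 0) + (if Suc i \<le> j then \<sigma> j * d j else 0))"
          by (intro sum.cong) auto
        ultimately have "\<sigma> i * d i = 0" using tail[OF that] that by (simp add: sum.distrib)
        then show ?thesis by (auto simp: \<sigma>_def split: if_splits)
      qed
      \<comment> \<open>With the letter part zero, the unknown letter-against-letter block drops
        out, and the row of letter i involves only the z's of smaller index. Consecutive head sums
        then determine the z part.\<close>
      have head: "(\<Sum>j<r. if j \<le> i then d (r + j) else 0) = 0" if "i < r" for i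
      proof -
        have "(\<Sum>j<r. l i j * d j) = 0" using dw by (intro sum.neutral) auto
        moreover have "(\<Sum>j<r. l i (r + j) * d (r + j)) = (\<Sum>j<r. \<sigma> i * (if j \<le> i then d (r + j) else 0))"
          using that by (intro sum.cong) (auto simp: l_wz s)
        ultimately have "\<sigma> i * (\<Sum>j<r. if j \<le> i then d (r + j) else 0) = 0"
          using sum0[of i] that by (simp add: s sum_distrib_left)
        then show ?thesis by (auto simp: \<sigma>_def split: if_splits)
      qed
      have dz: "d (r + i) = 0" if "i < r" for i
      proof -
        have "(\<Sum>j<r. if j < i then d (r + j) else 0) = 0"
        proof (cases i)
          case (Suc i')
          then show ?thesis using head[of i'] that by (simp add: less_Suc_eq_le)
        qed simp
        moreover have "(\<Sum>j<r. if j \<le> i then d (r + j) else 0)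
          = (\<Sum>j<r. (if j = i then d (r + j) else 0) + (if j < i then d (r + j) else 0))"
          by (intro sum.cong) auto
        ultimately show ?thesis using head[OF that] that by (simp add: sum.distrib)
      qed
      have "a i = b i" for i
      proof (cases "i < s")
        case True
        have "d i = 0"
        proof (cases "i < r")
          case False
          then show ?thesis using dz[of "i - r"] True by (simp add: s)
        qed (rule dw)
        then show ?thesis by (simp add: d_def)
      next
        case False
        then show ?thesis using ab by (auto simp: PiE_iff extensional_def)
      qed
      then show False using ab(3) by auto
    qed
  next
    fix i assume i: "i < s"
    \<comment> \<open>Each of the s summands is at most 2 k in absolute value.\<close>
    let ?K = "int (2 * s * k)"
    have "T.chi s i ` ({..<s} \<rightarrow>\<^sub>E {..k}) \<subseteq> (\<lambda>c. q powi c) ` {- ?K..?K}"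
    proof (rule image_subsetI)
      fix a assume a: "a \<in> {..<s} \<rightarrow>\<^sub>E {..k}"
      have "\<bar>\<Sum>j<s. l i j * int (a j)\<bar> \<le> (\<Sum>j<s. \<bar>l i j * int (a j)\<bar>)" by (rule sum_abs)
      also have "\<dots> \<le> (\<Sum>j<s. 2 * int k)"
        using a l_bound[OF i] by (intro sum_mono) (auto simp: abs_mult PiE_iff intro!: mult_mono)
      finally have "\<bar>\<Sum>j<s. l i j * int (a j)\<bar> \<le> ?K" by (simp add: mult_ac)
      then show "T.chi s i a \<in> (\<lambda>c. q powi c) ` {- ?K..?K}" unfolding chi by (intro imageI) auto
    qed
    then have "card (T.chi s i ` ({..<s} \<rightarrow>\<^sub>E {..k})) \<le> card ((\<lambda>c. q powi c) ` {- ?K..?K})"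
      by (intro card_mono) auto
    also have "\<dots> \<le> card {- ?K..?K}" by (rule card_image_le) simp
    also have "\<dots> = Suc (4 * s * k)" by (simp add: nat_add_distrib[symmetric] nat_eq_iff)
    finally show "card (T.chi s i ` ({..<s} \<rightarrow>\<^sub>E {..k})) \<le> Suc (4 * s * k)" .
  qed
  then show ?thesis using E(1,2) m(1) by blast
qed

end

section \<open>Spanning monomials\<close>

text \<open>Working modulo an ideal is expressed by adding the ideal to the spanning set;
  \<open>proj_span_mod_I\<close> removes it again after projection.\<close>

lemma fa_span_cong:
  assumes "f - g \<in> J" "g \<in> FA.span (P \<union> J)"
  shows "(f :: ('g, 'k::field) free_alg) \<in> FA.span (P \<union> J)"
  using FA.span_add[OF FA.span_base[of "f - g" "P \<union> J"] assms(2)] assms(1) by simp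

lemma fa_mem_span_words:
  assumes "f \<in> fa_on G" "\<And>w. w \<in> Poly_Mapping.keys f \<Longrightarrow> length (letters w) \<le> N"
  shows "(f :: ('g, 'k::field) free_alg) \<in> FA.span (fa_mono ` {ws. set ws \<subseteq> G \<and> length ws \<le> N})"
proof -
  have "(\<Sum>w\<in>Poly_Mapping.keys f. fa_scalar (Poly_Mapping.lookup f w) * fa_mono (letters w))
    \<in> FA.span (fa_mono ` {ws. set ws \<subseteq> G \<and> length ws \<le> N})"
    using assms by (intro FA.span_sum FA.span_scale FA.span_base imageI) (auto simp: fa_on_def)
  then show ?thesis using fa_expand[of f] by simp
qed

lemma fa_length_bound:
  assumes "finite E"
  shows "\<exists>d. \<forall>f\<in>E. \<forall>w\<in>Poly_Mapping.keys (f :: ('g, 'k::field) free_alg). length (letters w) \<le> d"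
proof -
  let ?L = "\<Union>f\<in>E. (\<lambda>w. length (letters w)) ` Poly_Mapping.keys f"
  have "finite ?L" using assms by simp
  then have "\<forall>l\<in>?L. l \<le> Max ?L" by simp
  then show ?thesis by (intro exI[of _ "Max ?L"]) blast
qed

lemma fa_products_length:
  assumes E: "\<And>f w. f \<in> E \<Longrightarrow> w \<in> Poly_Mapping.keys f \<Longrightarrow> length (letters w) \<le> d"
    and f: "f \<in> fa_products E k" and w: "w \<in> Poly_Mapping.keys (f :: ('g, 'k::field) free_alg)"
  shows "length (letters w) \<le> d * k"
proof -
  obtain es where es: "length es \<le> k" "set es \<subseteq> E" "f = prod_list es" using f by (rule fa_productsE)
  have "length (letters w) \<le> d * length es"
    using es(2) w unfolding es(3)
  proof (induction es arbitrary: w)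
    case Nil
    then show ?case by (auto simp: zero_free_monoid_def)
  next
    case (Cons e es)
    then obtain u v where "w = u + v" "u \<in> Poly_Mapping.keys e" "v \<in> Poly_Mapping.keys (prod_list es)"
      using keys_mult[of e "prod_list es"] by auto
    then show ?case using Cons.IH[of v] Cons.prems(1) E[of e u] by (auto simp: plus_free_monoid_def)
  qed
  also have "\<dots> \<le> d * k" using es(1) by simp
  finally show ?thesis .
qed

context presentation
begin

lemma proj_span_mod_I:
  assumes "P \<subseteq> fa_on G"
  shows "proj ` FA.span (P \<union> I) \<subseteq> proj ` FA.span P"
proof -
  have "\<exists>g\<in>FA.span P. f - g \<in> I" if "f \<in> FA.span (P \<union> I)" for f
    using that
  proof (induction rule: FA.span_induct_alt)
    case base
    then show ?case using I_zero FA.span_zero[of P] by (intro bexI[of _ 0]) auto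
  next
    case (step c u f)
    then obtain g where g: "g \<in> FA.span P" "f - g \<in> I" by blast
    from step(1) show ?case
    proof
      assume "u \<in> P"
      from FA.span_add[OF FA.span_scale[OF FA.span_base[OF this]] g(1)]
      have "fa_scalar c * u + g \<in> FA.span P" .
      then show ?thesis using g(2) by (intro bexI[of _ "fa_scalar c * u + g"]) auto
    next
      assume "u \<in> I"
      then have "fa_scalar c * u + (f - g) \<in> I" using g(2) by (intro I_add I_scale)
      moreover have "fa_scalar c * u + (f - g) = fa_scalar c * u + f - g" by simp
      ultimately show ?thesis using g(1) by (intro bexI[of _ g]) simp_all
    qed
  qed
  note ex = this
  have on: "FA.span (P \<union> I) \<subseteq> fa_on G" "FA.span P \<subseteq> fa_on G"
    using assms I_subset by (intro fa_span_subset_on; simp)+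
  show ?thesis
  proof (rule image_subsetI)
    fix f assume f: "f \<in> FA.span (P \<union> I)"
    obtain g where g: "g \<in> FA.span P" "f - g \<in> I" using ex[OF f] by (rule bexE)
    have "proj f = proj g" using f g on by (intro proj_eqI) auto
    then show "proj f \<in> proj ` FA.span P" using g(1) by (rule image_eqI)
  qed
qed

text \<open>Mirror image of \<open>power_commutator\<close>: here a single \<open>y\<close> moves
  left through a power of \<open>x\<close>, as straightening a word on its right end
  requires.\<close>

lemma power_commutator_left:
  assumes on: "x \<in> fa_on G" "y \<in> fa_on G" "z \<in> fa_on G"
    and xy: "x * y - y * x - z \<in> I" and xz: "skew_commute r x z"
  shows "x ^ Suc b * y - y * x ^ Suc b - fa_scalar (\<Sum>i\<le>b. r ^ i) * (z * x ^ b) \<in> I"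
proof (induction b)
  case 0
  then show ?case using xy by (simp add: fa_scalar_1)
next
  case (Suc b)
  let ?k = "\<Sum>i\<le>b. r ^ i"
  have pow: "x ^ k \<in> fa_on G" for k
    using on(1) by (induction k) (auto simp: fa_on_one fa_on_mult)
  have xz': "x * z - fa_scalar r * (z * x) \<in> I" using xz by (simp add: skew_commute_def)
  have "(\<Sum>i\<le>Suc b. r ^ i) = 1 + r * ?k"
    by (subst sum.atMost_Suc_shift) (simp add: sum_distrib_left)
  then have split: "fa_scalar (\<Sum>i\<le>Suc b. r ^ i) = (1 + fa_scalar ?k * fa_scalar r :: ('g, 'k) free_alg)"
    by (simp add: fa_scalar_add fa_scalar_1 fa_scalar_mult[symmetric] mult.commute)
  have "x ^ Suc (Suc b) * y - y * x ^ Suc (Suc b) - fa_scalar (\<Sum>i\<le>Suc b. r ^ i) * (z * x ^ Suc b)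
     = x * (x ^ Suc b * y - y * x ^ Suc b - fa_scalar ?k * (z * x ^ b))
       + (x * y - y * x - z) * x ^ Suc b
       + fa_scalar ?k * ((x * z - fa_scalar r * (z * x)) * x ^ b)"
    unfolding split by (simp add: algebra_simps fa_scalar_left_commute[of x])
  also have "\<dots> \<in> I"
    by (intro I_add I_scale I_mult_left[OF Suc on(1)] I_mult_right[OF xy pow] I_mult_right[OF xz' pow])
  finally show ?case .
qed

end

section \<open>Straightening words into ordered monomials\<close>

context quantum_euclid
begin

text \<open>Products over l = 1, ..., i of y_l^a x_l^b, every exponent bounded by \<open>N\<close>
  separately; this bound gives the count (N + 1)^(2 i).\<close>

fun pbw :: "nat \<Rightarrow> nat \<Rightarrow> (gen, 'k) free_alg set" where
  "pbw N 0 = {1}"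
| "pbw N (Suc i) = (\<lambda>(u, a, b). u * (y (Suc i) ^ a * x (Suc i) ^ b)) ` (pbw N i \<times> {..N} \<times> {..N})"

lemma finite_pbw: "finite (pbw N i)"
  by (induction i) auto

lemma card_pbw: "card (pbw N i) \<le> (N + 1) ^ (2 * i)"
proof (induction i)
  case (Suc i)
  have "card (pbw N (Suc i)) \<le> card (pbw N i \<times> {..N} \<times> {..N})"
    unfolding pbw.simps by (rule card_image_le) (simp add: finite_pbw)
  also have "\<dots> = card (pbw N i) * (N + 1) ^ 2"
    by (simp only: card_cartesian_product card_atMost power2_eq_square Suc_eq_plus1)
  also have "\<dots> \<le> (N + 1) ^ (2 * i) * (N + 1) ^ 2" using Suc by (rule mult_right_mono) simp
  finally show ?case by (simp add: power_add[symmetric] del: pbw.simps)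
qed simp

lemma pbw_on: "i \<le> n \<Longrightarrow> pbw N i \<subseteq> Fn"
  by (induction i) (auto intro!: fa_on_mult fa_on_power x_on y_on simp: fa_on_one)

text \<open>Intermediate normal form: only the generators of top index are collected, at the right
  end, while the word in lower ones is left as it stands. The bound is on total degree, which
  straightening does not increase.\<close>

definition half_ordered :: "nat \<Rightarrow> nat \<Rightarrow> (gen, 'k) free_alg set" where
  "half_ordered N i = {fa_mono ws * (y i ^ a * x i ^ b) | ws a b.
    set ws \<subseteq> Kn_gens (i - 1) \<and> length ws + a + b \<le> N}"

lemma half_orderedI:
  "set ws \<subseteq> Kn_gens (i - 1) \<Longrightarrow> length ws + a + b \<le> N \<Longrightarrow> f = fa_mono ws * (y i ^ a * x i ^ b)
    \<Longrightarrow> f \<in> half_ordered N i"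
  by (auto simp: half_ordered_def)

text \<open>A lower generator passes the block y_i^a x_i^b with a scalar, \<open>x i\<close> joins
  it directly, and \<open>y i\<close> produces a correction by \<open>z (i - 1)\<close>, which
  consists of lower generators.\<close>

lemma half_ordered_mult_gen:
  assumes i: "1 \<le> i" "i \<le> n" and g: "g \<in> Kn_gens i"
    and t: "t \<in> half_ordered N i"
  shows "t * fa_gen g \<in> FA.span (half_ordered (Suc N) i \<union> I)"
proof -
  obtain ws a b where ws: "set ws \<subseteq> Kn_gens (i - 1)" "length ws + a + b \<le> N"
    and t: "t = fa_mono ws * (y i ^ a * x i ^ b)" using t by (auto simp: half_ordered_def)
  have wsn: "set ws \<subseteq> Kn_gens n" using ws(1) i by (force simp: Kn_gens_def)
  have on: "fa_mono ws \<in> Fn" "y i ^ k \<in> Fn" "x i ^ k \<in> Fn" for k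
    by (rule fa_mono_on[OF wsn]) (intro fa_on_power x_on y_on i)+
  show ?thesis
  proof (cases "index g = i")
    case False
    then have gi: "1 \<le> index g" "index g < i" using g by (auto simp: Kn_gens_def)
    have "\<exists>c d. skew_commute c (y i) (fa_gen g) \<and> skew_commute d (x i) (fa_gen g)"
    proof (cases g)
      case (X l)
      then show ?thesis using skew_y_x[of l i] skew_x_x'[of l i] gi i by auto
    next
      case (Y l)
      then show ?thesis using skew_y_y'[of l i] skew_x_y[of i l] gi i by auto
    qed
    then obtain c d where "skew_commute c (y i) (fa_gen g)" "skew_commute d (x i) (fa_gen g)" by blast
    then have "skew_commute (c ^ a * d ^ b) (y i ^ a * x i ^ b) (fa_gen g)"
      by (intro skew_commute_mult_left skew_commute_power_left)
    then have *: "(y i ^ a * x i ^ b) * fa_gen g - fa_scalar (c ^ a * d ^ b) * (fa_gen g * (y i ^ a * x i ^ b)) \<in> I"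
      by (simp add: skew_commute_def)
    have "t * fa_gen g - fa_scalar (c ^ a * d ^ b) * (fa_mono (ws @ [g]) * (y i ^ a * x i ^ b)) =
      fa_mono ws * ((y i ^ a * x i ^ b) * fa_gen g - fa_scalar (c ^ a * d ^ b) * (fa_gen g * (y i ^ a * x i ^ b)))"
      unfolding t fa_mono_append fa_mono_single
      by (simp only: right_diff_distrib mult.assoc fa_scalar_left_commute[of "fa_mono ws"])
    then have "t * fa_gen g - fa_scalar (c ^ a * d ^ b) * (fa_mono (ws @ [g]) * (y i ^ a * x i ^ b)) \<in> I"
      using I_mult_left[OF * on(1)] by (simp only:)
    moreover have "fa_mono (ws @ [g]) * (y i ^ a * x i ^ b) \<in> half_ordered (Suc N) i"
      by (rule half_orderedI[OF _ _ refl]) (use ws gi in \<open>auto simp: Kn_gens_def\<close>)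
    ultimately show ?thesis by (intro fa_span_cong[OF _ FA.span_scale[OF FA.span_base]]) auto
  next
    case index: True
    show ?thesis
    proof (cases g)
      case (X l)
      then have "t * fa_gen g = fa_mono ws * (y i ^ a * x i ^ Suc b)"
        using index unfolding t by (simp add: mult.assoc power_commutes)
      moreover have "fa_mono ws * (y i ^ a * x i ^ Suc b) \<in> half_ordered (Suc N) i"
        by (rule half_orderedI[OF ws(1) _ refl]) (use ws in auto)
      ultimately show ?thesis by (auto intro: FA.span_base)
    next
      case (Y l)
      then have g: "fa_gen g = y i" using index by simp
      show ?thesis
      proof (cases b)
        case 0
        have "t * fa_gen g = fa_mono ws * (y i ^ Suc a * x i ^ 0)"
          unfolding t g 0 by (simp add: mult.assoc power_commutes)
        moreover have "fa_mono ws * (y i ^ Suc a * x i ^ 0) \<in> half_ordered (Suc N) i"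
          by (rule half_orderedI[OF ws(1) _ refl]) (use ws in auto)
        ultimately show ?thesis by (auto intro: FA.span_base)
      next
        case (Suc b')
        let ?Z = "z (i - 1)"
        have Z: "?Z \<in> Fn" using i by (intro z_on) auto
        have xy: "x i * y i - y i * x i - ?Z \<in> I" using relations(5) i by simp
        have "skew_commute (q ^ 2) ?Z (x i)" "skew_commute (inverse (q ^ 2)) ?Z (y i)"
          using skew_z_x_below[of "i - 1" i] skew_z_y_below[of "i - 1" i] i by auto
        then obtain r r' where r: "skew_commute r (x i) ?Z" "skew_commute r' (y i) ?Z"
          using skew_commute_sym q_nonzero by (metis power_not_zero nonzero_imp_inverse_nonzero)
        let ?k = "\<Sum>i\<le>b'. r ^ i"
        have h1: "x i ^ Suc b' * y i - y i * x i ^ Suc b' - fa_scalar ?k * (?Z * x i ^ b') \<in> I"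
          using i by (intro power_commutator_left x_on y_on Z xy r)
        have h2: "y i ^ a * ?Z - fa_scalar (r' ^ a) * (?Z * y i ^ a) \<in> I"
          using skew_commute_power_left[OF r(2), of a] by (simp add: skew_commute_def)
        let ?main = "fa_mono ws * (y i ^ Suc a * x i ^ b)"
        let ?rest = "fa_scalar (?k * r' ^ a) * (fa_mono ws * ?Z * (y i ^ a * x i ^ b'))"
        \<comment> \<open>\<open>y i\<close> is moved left through x_i^b, and the resulting z_(i-1)
          left through y_i^a to join the lower word. The two ideal terms are these two
          commutations.\<close>
        have "t * fa_gen g - (?main + ?rest) =
            fa_mono ws * (y i ^ a * (x i ^ Suc b' * y i - y i * x i ^ Suc b' - fa_scalar ?k * (?Z * x i ^ b')))
          + fa_scalar ?k * (fa_mono ws * ((y i ^ a * ?Z - fa_scalar (r' ^ a) * (?Z * y i ^ a)) * x i ^ b'))"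
        proof -
          have 1: "fa_scalar (?k * r' ^ a) = (fa_scalar ?k * fa_scalar (r' ^ a) :: (gen, 'k) free_alg)"
            by (rule fa_scalar_mult)
          have 2: "y i ^ Suc a = y i ^ a * y i" by (rule power_Suc2)
          show ?thesis unfolding t g Suc 1 2 right_diff_distrib left_diff_distrib distrib_left mult.assoc
              fa_scalar_left_commute[of "fa_mono ws"] fa_scalar_left_commute[of "y i ^ a"] by simp
        qed
        moreover have "fa_mono ws * (y i ^ a * (x i ^ Suc b' * y i - y i * x i ^ Suc b' - fa_scalar ?k * (?Z * x i ^ b')))
          + fa_scalar ?k * (fa_mono ws * ((y i ^ a * ?Z - fa_scalar (r' ^ a) * (?Z * y i ^ a)) * x i ^ b')) \<in> I"
          by (intro I_add I_scale I_mult_left[OF I_mult_left[OF h1 on(2)] on(1)] I_mult_left[OF I_mult_right[OF h2 on(3)] on(1)])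
        ultimately have I: "t * fa_gen g - (?main + ?rest) \<in> I" by (simp only:)
        have main: "?main \<in> FA.span (half_ordered (Suc N) i \<union> I)"
          by (intro FA.span_base UnI1 half_orderedI[OF ws(1) _ refl]) (use ws in auto)
        \<comment> \<open>Two lower letters replace one \<open>x i\<close> and the incoming
          \<open>y i\<close>, so the total degree is at most \<open>Suc N\<close>.\<close>
        have "?rest = fa_scalar (?k * r' ^ a) *
          (\<Sum>l = 1..i - 1. fa_scalar c0 * (fa_mono (ws @ [Y l, X l]) * (y i ^ a * x i ^ b')))"
          unfolding z_def sum_distrib_left sum_distrib_right fa_mono_append fa_scalar_left_commute[of "fa_mono ws"]
          using fa_mono_append[of "[Y _]" "[X _]", where 'b='k] by (simp add: mult.assoc fa_mono_single)
        also have "\<dots> \<in> FA.span (half_ordered (Suc N) i \<union> I)"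
        proof (intro FA.span_scale FA.span_sum FA.span_base UnI1 half_orderedI[OF _ _ refl])
          fix l assume l: "l \<in> {1..i - 1}"
          then show "set (ws @ [Y l, X l]) \<subseteq> Kn_gens (i - 1)" using ws(1) by (auto simp: Kn_gens_def)
          show "length (ws @ [Y l, X l]) + a + b' \<le> Suc N" using ws(2) Suc by simp
        qed
        finally show ?thesis using main by (intro fa_span_cong[OF I] FA.span_add)
      qed
    qed
  qed
qed

lemma word_in_half_ordered_span:
  assumes i: "1 \<le> i" "i \<le> n" and "set ws \<subseteq> Kn_gens i"
  shows "fa_mono ws \<in> FA.span (half_ordered (length ws) i \<union> I)"
  using assms(3)
proof (induction ws rule: rev_induct)
  case Nil
  have "fa_mono [] \<in> half_ordered 0 i" by (rule half_orderedI[of "[]" _ 0 0]) auto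
  then show ?case by (auto intro: FA.span_base)
next
  case (snoc g ws)
  then have IH: "fa_mono ws \<in> FA.span (half_ordered (length ws) i \<union> I)" and g: "g \<in> Kn_gens i" by auto
  have gn: "(fa_gen g :: (gen, 'k) free_alg) \<in> Fn" using g i by (intro fa_on_gen) (auto simp: Kn_gens_def)
  have "fa_mono ws * fa_gen g \<in> FA.span (half_ordered (Suc (length ws)) i \<union> I)"
  proof (rule fa_span_mult[OF IH FA.span_base[of "fa_gen g" "{fa_gen g}"]])
    fix u v :: "(gen, 'k) free_alg" assume u: "u \<in> half_ordered (length ws) i \<union> I" and v: "v \<in> {fa_gen g}"
    from u show "u * v \<in> FA.span (half_ordered (Suc (length ws)) i \<union> I)"
    proof
      assume "u \<in> half_ordered (length ws) i"
      then show ?thesis using v half_ordered_mult_gen[OF i g] by simp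
    next
      assume "u \<in> I"
      then show ?thesis using v gn by (auto intro!: FA.span_base I_mult_right)
    qed
  qed simp
  then show ?case by (simp add: fa_mono_append fa_mono_single)
qed

text \<open>Induction on the largest index: once the top generators are collected on the right, the
  remaining word has only lower ones and is no longer than before.\<close>

lemma word_in_pbw_span:
  "i \<le> n \<Longrightarrow> set ws \<subseteq> Kn_gens i \<Longrightarrow> length ws \<le> N \<Longrightarrow> fa_mono ws \<in> FA.span (pbw N i \<union> I)"
proof (induction i arbitrary: ws)
  case 0
  then have "ws = []" by (cases ws) (auto simp: Kn_gens_def)
  then show ?case by (auto simp: fa_mono_Nil intro: FA.span_base)
next
  case (Suc i)
  let ?T = "half_ordered (length ws) (Suc i) \<union> I"
  have "?T \<subseteq> FA.span (pbw N (Suc i) \<union> I)"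
  proof
    fix t assume "t \<in> ?T"
    then show "t \<in> FA.span (pbw N (Suc i) \<union> I)"
    proof
      assume "t \<in> half_ordered (length ws) (Suc i)"
      then obtain us a b where us: "set us \<subseteq> Kn_gens i" "length us + a + b \<le> length ws"
        and t: "t = fa_mono us * (y (Suc i) ^ a * x (Suc i) ^ b)" by (auto simp: half_ordered_def)
      let ?v = "y (Suc i) ^ a * x (Suc i) ^ b"
      have v: "?v \<in> Fn" using Suc.prems by (intro fa_on_mult fa_on_power x_on y_on) auto
      have "fa_mono us \<in> FA.span (pbw N i \<union> I)" using Suc us by (intro Suc.IH) auto
      then show ?thesis unfolding t
      proof (rule fa_span_mult[OF _ FA.span_base[of ?v "{?v}"]])
        fix u v assume "u \<in> pbw N i \<union> I" and v': "v \<in> {?v}"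
        then show "u * v \<in> FA.span (pbw N (Suc i) \<union> I)"
        proof (elim UnE)
          assume "u \<in> pbw N i"
          moreover have "a \<le> N" "b \<le> N" using us Suc.prems by auto
          ultimately have "u * v \<in> pbw N (Suc i)" using v' by (auto intro!: image_eqI[of _ _ "(u, a, b)"])
          then show ?thesis by (intro FA.span_base UnI1)
        next
          assume "u \<in> I"
          then have "u * ?v \<in> I" by (rule I_mult_right[OF _ v])
          then show ?thesis using v' by (auto intro: FA.span_base)
        qed
      qed simp
    next
      assume "t \<in> I"
      then show ?thesis by (auto intro: FA.span_base)
    qed
  qed
  then have "FA.span ?T \<subseteq> FA.span (pbw N (Suc i) \<union> I)"
    by (intro FA.span_minimal FA.subspace_span)
  then show ?case using word_in_half_ordered_span[of "Suc i" ws] Suc.prems by auto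
qed

lemma power_sum_dim_upper:
  assumes "V \<in> fd_subspaces PA"
  shows "\<exists>d. \<forall>k. subspace_dim PA (power_sum PA V k) \<le> (d * k + 1) ^ (2 * n)"
proof -
  interpret K: kspace PA by (rule kspace_PA)
  from assms[unfolded fd_subspaces_PA_iff]
  obtain E where E: "finite E" "E \<subseteq> Fn" "V = proj ` FA.span E" by (elim exE conjE)
  obtain d where d: "\<And>f w. f \<in> E \<Longrightarrow> w \<in> Poly_Mapping.keys f \<Longrightarrow> length (letters w) \<le> d"
    using fa_length_bound[OF E(1)] by blast
  have "subspace_dim PA (power_sum PA V k) \<le> (d * k + 1) ^ (2 * n)" for k
  proof -
    \<comment> \<open>\<open>d\<close> bounds the length of the words in \<open>E\<close>, so
      products of k elements involve only words of length up to d k.\<close>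
    let ?P = "pbw (d * k) n"
    note P = pbw_on[OF order.refl, of "d * k"]
    have "fa_products E k \<subseteq> FA.span (?P \<union> I)"
    proof
      fix f assume f: "f \<in> fa_products E k"
      then have "f \<in> FA.span (fa_mono ` {ws. set ws \<subseteq> Kn_gens n \<and> length ws \<le> d * k})"
        using fa_products_on[OF E(2)] fa_products_length[OF d f] by (intro fa_mem_span_words) auto
      also have "\<dots> \<subseteq> FA.span (?P \<union> I)"
        by (intro FA.span_minimal FA.subspace_span image_subsetI) (auto intro: word_in_pbw_span)
      finally show "f \<in> FA.span (?P \<union> I)" .
    qed
    then have "FA.span (fa_products E k) \<subseteq> FA.span (?P \<union> I)"
      by (intro FA.span_minimal FA.subspace_span)
    then have "power_sum PA V k \<subseteq> proj ` FA.span (?P \<union> I)"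
      unfolding E(3) power_sum_image[OF E(2)] by (rule image_mono)
    also have "\<dots> \<subseteq> proj ` FA.span ?P" by (rule proj_span_mod_I[OF P])
    also have "\<dots> = vs_span PA (proj ` ?P)" by (rule proj_span_image[OF P])
    finally have sub: "power_sum PA V k \<subseteq> vs_span PA (proj ` ?P)" .
    have fd: "power_sum PA V k \<in> fd_subspaces PA"
      unfolding E(3) power_sum_image[OF E(2)] fd_subspaces_PA_iff
      using finite_fa_products[OF E(1)] fa_products_on[OF E(2)] by blast
    have "proj ` ?P \<subseteq> carrier PA" using P proj_closed by auto
    then have "subspace_dim PA (power_sum PA V k) \<le> card (proj ` ?P)"
      using finite_pbw sub by (intro K.dim_le_card[OF fd]) auto
    also have "\<dots> \<le> card ?P" by (rule card_image_le[OF finite_pbw])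
    also have "\<dots> \<le> (d * k + 1) ^ (2 * n)" by (rule card_pbw)
    finally show ?thesis .
  qed
  then show ?thesis by blast
qed

end

section \<open>Linearly independent monomials\<close>

lemma fa_words_span: "(f :: ('g, 'k::field) free_alg) \<in> FA.span (range fa_mono)"
  using fa_mem_span_words[of f UNIV "Max (insert 0 ((\<lambda>w. length (letters w)) ` Poly_Mapping.keys f))"]
    FA.span_mono[of "fa_mono ` {ws. set ws \<subseteq> UNIV \<and> length ws \<le> _}" "range fa_mono"]
  by (auto simp: fa_on_def)

context presentation
begin

lemma proj_eqD:
  assumes "f \<in> fa_on G" "g \<in> fa_on G" "proj f = proj g"
  shows "f - g \<in> I"
proof -
  interpret J: ideal I FG by (rule ideal_relation_ideal)
  have "f \<in> I +>\<^bsub>FG\<^esub> f" using J.a_rcos_self[of f] assms(1) by (simp add: carrier_free_algebra)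
  then have "f \<in> I +>\<^bsub>FG\<^esub> g" using assms(3) by (simp add: proj_def)
  then obtain h where "h \<in> I" "f = h \<oplus>\<^bsub>FG\<^esub> g" by (auto simp: a_r_coset_def r_coset_def)
  then show ?thesis by (simp add: free_algebra_def)
qed

text \<open>Minimality of the generated ideal, in the notation of the free algebra; applied to the
  kernel of a representation.\<close>

lemma I_subset_ideal:
  assumes R: "R \<subseteq> K" and K: "K \<subseteq> fa_on G" "0 \<in> K"
    "\<And>f g. f \<in> K \<Longrightarrow> g \<in> K \<Longrightarrow> f - g \<in> K"
    "\<And>f a. f \<in> K \<Longrightarrow> a \<in> fa_on G \<Longrightarrow> a * f \<in> K"
    "\<And>f a. f \<in> K \<Longrightarrow> a \<in> fa_on G \<Longrightarrow> f * a \<in> K"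
  shows "I \<subseteq> K"
proof -
  interpret F: ring FG by (rule ring_free_algebra)
  have "ideal K FG"
  proof (rule idealI[OF ring_free_algebra])
    show "subgroup K (add_monoid FG)"
    proof (rule F.add.subgroupI)
      show "K \<subseteq> carrier FG" using K(1) by (simp add: carrier_free_algebra)
      show "K \<noteq> {}" using K(2) by auto
    next
      fix a assume a: "a \<in> K"
      have "a \<in> fa_on G" using K(1) a by (rule subsetD)
      then show "\<ominus>\<^bsub>FG\<^esub> a \<in> K" using K(3)[OF K(2) a] by (simp only: FG_minus diff_0)
    next
      fix a b assume ab: "a \<in> K" "b \<in> K"
      have "a - (0 - b) \<in> K" by (rule K(3)[OF ab(1) K(3)[OF K(2) ab(2)]])
      then show "a \<oplus>\<^bsub>FG\<^esub> b \<in> K" by (simp add: free_algebra_def)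
    qed
  next
    fix a x assume "a \<in> K" "x \<in> carrier FG"
    then have "x * a \<in> K" "a * x \<in> K" unfolding carrier_free_algebra by (rule K(4), rule K(5))
    then show "x \<otimes>\<^bsub>FG\<^esub> a \<in> K" "a \<otimes>\<^bsub>FG\<^esub> x \<in> K" by (simp_all add: free_algebra_def)
  qed
  then show ?thesis unfolding relation_ideal_def by (rule F.genideal_minimal[OF _ R])
qed

end

text \<open>Polynomials in indeterminates t_1, t_2, .... The \<open>z i\<close> act with weights
  proportional to t_i, and the algebraic independence of the t_i is what separates their
  monomials.\<close>

type_synonym 'k coeff = "(nat \<Rightarrow>\<^sub>0 nat) \<Rightarrow>\<^sub>0 'k"
type_synonym 'k state = "(nat \<Rightarrow> int) \<Rightarrow> 'k coeff"

definition const :: "'k::field \<Rightarrow> 'k coeff" where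
  "const c = Poly_Mapping.single 0 c"

text \<open>The value 0 at index 0 makes the weight of z_0 = 0 vanish.\<close>

definition tvar :: "nat \<Rightarrow> 'k::field coeff" where
  "tvar i = (if i = 0 then 0 else Poly_Mapping.single (Poly_Mapping.single i 1) 1)"

lemma const_add: "const (c + d) = const c + const d"
  and const_mult: "const (c * d) = const c * const d"
  and const_1: "const 1 = 1"
  and const_0: "const 0 = 0"
  by (simp_all add: const_def single_add mult_single)

lemma const_diff: "const (c - d) = const c - const d"
  by (simp add: const_def single_diff)

section \<open>A representation by weighted shifts\<close>

context quantum_euclid
begin

text \<open>The power of \<open>q\<close> that makes the shifts satisfy x_i x_j = q x_j x_i for i <
  j: a shift at i changes the weight of \<open>x j\<close> exactly when i < j.\<close>

definition xi :: "nat \<Rightarrow> (nat \<Rightarrow> int) \<Rightarrow> 'k" where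
  "xi j a = q powi (\<Sum>i\<in>{1..<j}. a i)"

text \<open>The eigenvalue of \<open>z i\<close>. A shift at an index above i multiplies it by q^-2,
  which reproduces z_i x_j = q^2 x_j z_i for j > i.\<close>

definition wt :: "nat \<Rightarrow> (nat \<Rightarrow> int) \<Rightarrow> 'k coeff" where
  "wt i a = const (q powi (- 2 * (\<Sum>l\<in>{i<..n}. a l))) * tvar i"

text \<open>The eigenvalue of \<open>c0\<close> times \<open>y j * x j\<close>, namely of z_j -
  z_(j-1).\<close>

definition wtd :: "nat \<Rightarrow> (nat \<Rightarrow> int) \<Rightarrow> 'k coeff" where
  "wtd j a = wt j a - wt (j - 1) a"

text \<open>The operators of \<open>K\<^sub>n\<close> on functions of \<open>a \<in> \<int>\<^sup>n\<close>: \<open>x\<^sub>j\<close> is a weighted shift, \<open>z\<^sub>j\<close> the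
  multiplication by \<open>wt j\<close>, and \<open>y\<^sub>j = c\<^sup>-\<^sup>1 (z\<^sub>j - z\<^sub>j\<^sub>-\<^sub>1) x\<^sub>j\<^sup>-\<^sup>1\<close>.\<close>

fun gen_op :: "gen \<Rightarrow> 'k state \<Rightarrow> 'k state" where
  "gen_op (X j) \<phi> a = const (xi j a) * \<phi> (a(j := a j + 1))"
| "gen_op (Y j) \<phi> a =
    const (inverse (c0 * xi j a)) * (wtd j a * \<phi> (a(j := a j - 1)))"

definition word_op :: "gen list \<Rightarrow> 'k state \<Rightarrow> 'k state" where
  "word_op ws = foldr gen_op ws"

text \<open>Defined on the whole free algebra, where no relation has to be respected; the relations
  are checked afterwards. The first letter of a word is the outermost operator.\<close>

definition rep :: "(gen, 'k) free_alg \<Rightarrow> 'k state \<Rightarrow> 'k state" where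
  "rep f \<phi> a = (\<Sum>w\<in>Poly_Mapping.keys f. const (Poly_Mapping.lookup f w) * word_op (letters w) \<phi> a)"

lemma gen_op_linear:
  "gen_op g (\<lambda>a. r * \<phi> a + \<psi> a) b = r * gen_op g \<phi> b + gen_op g \<psi> b"
  by (cases g) (simp_all add: algebra_simps)

lemma word_op_linear:
  "word_op ws (\<lambda>a. r * \<phi> a + \<psi> a) = (\<lambda>b. r * word_op ws \<phi> b + word_op ws \<psi> b)"
  by (induction ws) (auto simp: word_op_def gen_op_linear)

lemma word_op_zero: "word_op ws (\<lambda>_. 0) = (\<lambda>_. 0)"
proof -
  have "gen_op g (\<lambda>_. 0) = (\<lambda>_. 0)" for g
    by (rule ext) (cases g; simp)
  then show ?thesis by (induction ws) (simp_all add: word_op_def)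
qed

lemma rep_add: "rep (f + g) \<phi> a = rep f \<phi> a + rep g \<phi> a"
  unfolding rep_def
  by (rule setsum_keys_plus_distrib[where f = "\<lambda>w c. const c * word_op (letters w) \<phi> a"])
    (simp_all add: const_0 const_add distrib_right)

lemma rep_zero: "rep 0 \<phi> a = 0"
  by (simp add: rep_def)

lemma rep_mono: "rep (fa_mono ws) \<phi> = word_op ws \<phi>"
  by (rule ext) (simp add: rep_def fa_mono_def const_1)

lemma rep_scale: "rep (fa_scalar c * f) \<phi> a = const c * rep f \<phi> a"
proof -
  have word: "rep (fa_scalar c * fa_mono ws) \<phi> a = const c * rep (fa_mono ws) \<phi> a" for c ws
    unfolding rep_mono by (cases "c = 0") (simp_all add: rep_def fa_mono_def fa_scalar_def mult_single const_0)
  have "f \<in> FA.span (range fa_mono)" by (rule fa_words_span)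
  then show ?thesis
  proof (induction rule: FA.span_induct_alt)
    case base
    then show ?case by (simp add: rep_zero)
  next
    case (step d u f)
    then obtain ws where u: "u = fa_mono ws" by blast
    have "fa_scalar c * (fa_scalar d * u + f) = fa_scalar (c * d) * u + fa_scalar c * f"
      by (simp add: distrib_left)
    then show ?case using step(2) unfolding u by (simp add: rep_add word const_mult algebra_simps)
  qed
qed

lemma rep_state_zero: "rep f (\<lambda>_. 0) = (\<lambda>_. 0)"
  by (rule ext) (simp add: rep_def word_op_zero)

text \<open>True on words by concatenation, then extended by linearity first in \<open>g\<close> and
  then in \<open>f\<close>.\<close>

lemma rep_mult: "rep (f * g) \<phi> = rep f (rep g \<phi>)"
proof -
  have 1: "rep (fa_mono us * g) \<phi> = word_op us (rep g \<phi>)" for us g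
  proof -
    have "g \<in> FA.span (range fa_mono)" by (rule fa_words_span)
    then show ?thesis
    proof (induction rule: FA.span_induct_alt)
      case base
      have "rep 0 \<phi> = (\<lambda>_. 0)" by (rule ext) (rule rep_zero)
      then show ?case by (simp add: word_op_zero)
    next
      case (step d u g)
      then obtain ws where u: "u = fa_mono ws" by blast
      have "fa_mono us * (fa_scalar d * u + g) = fa_scalar d * fa_mono (us @ ws) + fa_mono us * g"
        unfolding u fa_mono_append by (simp only: distrib_left fa_scalar_left_commute[of "fa_mono us"])
      then have "rep (fa_mono us * (fa_scalar d * u + g)) \<phi> = (\<lambda>a. const d * word_op us (word_op ws \<phi>) a + word_op us (rep g \<phi>) a)"
        using step(2) by (auto simp: rep_add rep_scale rep_mono word_op_def)
      also have "\<dots> = word_op us (rep (fa_scalar d * u + g) \<phi>)"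
      proof -
        have "rep (fa_scalar d * u + g) \<phi> = (\<lambda>a. const d * word_op ws \<phi> a + rep g \<phi> a)"
          by (auto simp: rep_add rep_scale rep_mono u)
        then show ?thesis by (simp only: word_op_linear)
      qed
      finally show ?case .
    qed
  qed
  have "f \<in> FA.span (range fa_mono)" by (rule fa_words_span)
  then show ?thesis
  proof (induction rule: FA.span_induct_alt)
    case base
    then show ?case by (simp add: rep_zero fun_eq_iff)
  next
    case (step d u f)
    then obtain ws where u: "u = fa_mono ws" by blast
    have "(fa_scalar d * u + f) * g = fa_scalar d * (fa_mono ws * g) + f * g"
      unfolding u by (simp only: distrib_right mult.assoc)
    then show ?case using step(2) by (auto simp: rep_add rep_scale 1 u rep_mono)
  qed
qed

lemma rep_gen: "rep (fa_gen g) \<phi> = gen_op g \<phi>"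
  using rep_mono[of "[g]"] by (simp add: fa_mono_single word_op_def)

lemma rep_diff: "rep (f - g) \<phi> a = rep f \<phi> a - rep g \<phi> a"
  using rep_add[of "f - g" g \<phi> a] by simp

lemma xi_nonzero: "xi j a \<noteq> 0"
  using q_nonzero by (simp add: xi_def)

lemma xi_shift:
  assumes "1 \<le> i"
  shows "xi j (a(i := a i + d)) = (if i < j then q powi d else 1) * xi j a"
proof -
  have "(\<Sum>l\<in>{1..<j}. (a(i := a i + d)) l) = (\<Sum>l\<in>{1..<j}. a l + (if l = i then d else 0))"
    by (intro sum.cong) auto
  also have "\<dots> = (\<Sum>l\<in>{1..<j}. a l) + (if i < j then d else 0)"
    using assms by (simp add: sum.distrib)
  finally show ?thesis unfolding xi_def using q_nonzero by (simp add: power_int_add)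
qed

lemma wt_shift:
  assumes "j \<le> n"
  shows "wt i (a(j := a j + d)) = const (if i < j then q powi (- 2 * d) else 1) * wt i a"
proof -
  have "(\<Sum>l\<in>{i<..n}. (a(j := a j + d)) l) = (\<Sum>l\<in>{i<..n}. a l + (if l = j then d else 0))"
    by (intro sum.cong) auto
  also have "\<dots> = (\<Sum>l\<in>{i<..n}. a l) + (if i < j then d else 0)"
    using assms by (simp add: sum.distrib)
  finally show ?thesis unfolding wt_def using q_nonzero
    by (simp add: power_int_add distrib_left power_int_minus const_mult mult_ac const_1 power_int_diff divide_inverse)
qed

lemma rep_zl: "1 \<le> l \<Longrightarrow> l \<le> n \<Longrightarrow> rep (fa_scalar c0 * (y l * x l)) \<phi> a = wtd l a * \<phi> a"
proof -
  assume l: "1 \<le> l" "l \<le> n"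
  have "xi l (a(l := a l - 1)) = xi l a" using xi_shift[OF l(1), of l a "-1"] by simp
  moreover have "(a(l := a l - 1))(l := (a(l := a l - 1)) l + 1) = a" by auto
  moreover have "const c0 * (const (inverse (c0 * xi l a)) * (r * (const (xi l a) * r'))) = r * r'" for r r'
  proof -
    have "c0 * (inverse (c0 * xi l a) * xi l a) = 1"
      using c0_nonzero xi_nonzero[of l a] by (simp add: field_simps)
    then have "const c0 * (const (inverse (c0 * xi l a)) * const (xi l a)) = (1 :: 'k coeff)"
      by (simp only: const_mult[symmetric] const_1)
    moreover have "const c0 * (const (inverse (c0 * xi l a)) * (r * (const (xi l a) * r')))
        = const c0 * (const (inverse (c0 * xi l a)) * const (xi l a)) * (r * r')" by (simp only: mult_ac)
    ultimately show ?thesis by simp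
  qed
  ultimately show ?thesis
    unfolding rep_scale by (simp add: rep_mult rep_gen del: fun_upd_apply)
qed

lemma rep_z: "i \<le> n \<Longrightarrow> rep (z i) \<phi> a = wt i a * \<phi> a"
proof (induction i)
  case 0
  then show ?case by (simp add: z_0 rep_zero wt_def tvar_def)
next
  case (Suc i)
  then show ?case using rep_zl[of "Suc i" \<phi> a] by (simp add: z_Suc rep_add wtd_def algebra_simps)
qed

lemma const_swap: "const c * (const d * r) = const (c * d) * r"
  by (simp add: const_mult mult.assoc)

lemma rep_x_x:
  assumes "1 \<le> i" "i < j" "j \<le> n"
  shows "rep (x i * x j) \<phi> a = rep (fa_scalar q * (x j * x i)) \<phi> a"
proof -
  have "(a(i := a i + 1))(j := (a(i := a i + 1)) j + 1) = (a(j := a j + 1))(i := (a(j := a j + 1)) i + 1)"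
    using assms by auto
  then show ?thesis using assms xi_shift[of i j a 1] xi_shift[of j i a 1] unfolding rep_scale
    by (simp add: rep_mult rep_gen rep_scale const_swap mult_ac)
qed

text \<open>For i different from j both weights in the difference scale alike. At i = j they do not,
  and this discrepancy is the commutator of \<open>x j\<close> and \<open>y j\<close>.\<close>

lemma wtd_shift:
  assumes "1 \<le> j" "i \<le> n" "i \<noteq> j"
  shows "wtd j (a(i := a i + d)) = const (if j < i then q powi (- 2 * d) else 1) * wtd j a"
proof -
  have "j - 1 < i \<longleftrightarrow> j < i" using assms by auto
  then show ?thesis unfolding wtd_def wt_shift[OF assms(2)] by (simp only: right_diff_distrib)
qed

lemma const_pull: "wtd j a * (const c * r) = const c * (wtd j a * r)"
  by (rule mult.left_commute)

lemma rep_y_y: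
  assumes "1 \<le> i" "i < j" "j \<le> n"
  shows "rep (y i * y j) \<phi> a = rep (fa_scalar (inverse q) * (y j * y i)) \<phi> a"
proof -
  let ?ai = "a(i := a i - 1)" and ?aj = "a(j := a j - 1)"
  let ?b = "?ai(j := ?ai j - 1)"
  have b: "?aj(i := ?aj i - 1) = ?b" using assms by auto
  have xi: "xi j ?ai = inverse q * xi j a" "xi i ?aj = xi i a"
    using assms xi_shift[of i j a "-1"] xi_shift[of j i a "-1"] by (simp_all add: power_int_minus)
  have w: "wtd j ?ai = wtd j a" "wtd i ?aj = const (q ^ 2) * wtd i a"
    using assms wtd_shift[of j i a "-1"] wtd_shift[of i j a "-1"] by (simp_all add: const_1)
  have "rep (y i * y j) \<phi> a = const (inverse (c0 * xi i a)) * (wtd i a *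
      (const (inverse (c0 * xi j ?ai)) * (wtd j ?ai * \<phi> ?b)))"
    by (simp only: rep_mult rep_gen gen_op.simps)
  also have "\<dots> = const (inverse (c0 * xi i a) * inverse (c0 * xi j ?ai)) * (wtd i a * (wtd j a * \<phi> ?b))"
    unfolding w(1) by (simp only: const_pull const_swap)
  also have "inverse (c0 * xi i a) * inverse (c0 * xi j ?ai)
      = inverse q * (inverse (c0 * xi j a) * (inverse (c0 * xi i a) * q ^ 2))"
    unfolding xi using q_nonzero by (simp add: power2_eq_square mult_ac)
  also have "const (inverse q * (inverse (c0 * xi j a) * (inverse (c0 * xi i a) * q ^ 2))) * (wtd i a * (wtd j a * \<phi> ?b))
    = const (inverse q) * (const (inverse (c0 * xi j a)) * (wtd j a *
      (const (inverse (c0 * xi i ?aj)) * (wtd i ?aj * \<phi> ?b))))"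
    unfolding w(2) xi(2) by (simp only: const_pull const_swap mult.assoc mult.left_commute[of "wtd i a" "wtd j a"])
  also have "\<dots> = rep (fa_scalar (inverse q) * (y j * y i)) \<phi> a"
    unfolding rep_scale by (simp only: rep_mult rep_gen gen_op.simps b)
  finally show ?thesis .
qed

lemma rep_x_y:
  assumes "1 \<le> i" "i \<noteq> j" "1 \<le> j" "i \<le> n" "j \<le> n"
  shows "rep (x i * y j) \<phi> a = rep (fa_scalar (inverse q) * (y j * x i)) \<phi> a"
proof -
  let ?ai = "a(i := a i + 1)" and ?aj = "a(j := a j - 1)"
  let ?b = "?ai(j := ?ai j - 1)"
  have b: "?aj(i := ?aj i + 1) = ?b" using assms by auto
  define e where "e = (if j < i then inverse (q ^ 2) else 1)"
  have xi: "xi j ?ai = (if i < j then q else 1) * xi j a" "xi i ?aj = (if j < i then inverse q else 1) * xi i a"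
    using assms xi_shift[of i j a 1] xi_shift[of j i a "-1"] by (simp_all add: power_int_minus)
  have w: "wtd j ?ai = const e * wtd j a"
    using assms wtd_shift[of j i a 1] by (auto simp: e_def power_int_minus)
  have "rep (x i * y j) \<phi> a = const (xi i a) * (const (inverse (c0 * xi j ?ai)) * (wtd j ?ai * \<phi> ?b))"
    by (simp only: rep_mult rep_gen gen_op.simps)
  also have "\<dots> = const (xi i a * (inverse (c0 * xi j ?ai) * e)) * (wtd j a * \<phi> ?b)"
    unfolding w by (simp only: mult.assoc const_swap)
  also have "xi i a * (inverse (c0 * xi j ?ai) * e) = inverse q * (inverse (c0 * xi j a) * xi i ?aj)"
    unfolding xi e_def using q_nonzero assms(2) by (auto simp: power2_eq_square mult_ac)
  also have "const (inverse q * (inverse (c0 * xi j a) * xi i ?aj)) * (wtd j a * \<phi> ?b)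
      = const (inverse q) * (const (inverse (c0 * xi j a)) * (wtd j a * (const (xi i ?aj) * \<phi> ?b)))"
    by (simp only: const_pull const_swap)
  also have "\<dots> = rep (fa_scalar (inverse q) * (y j * x i)) \<phi> a"
    unfolding rep_scale by (simp only: rep_mult rep_gen gen_op.simps b)
  finally show ?thesis .
qed

text \<open>A shift at i fixes the weight of z_i and multiplies that of z_(i-1) by 1 - c0, so the
  commutator is 1/c0 times c0 times the weight of z_(i-1).\<close>

lemma rep_x_y_same:
  assumes "1 \<le> i" "i \<le> n"
  shows "rep (x i * y i) \<phi> a = rep (y i * x i) \<phi> a + rep (z (i - 1)) \<phi> a"
proof -
  let ?a1 = "a(i := a i + 1)" and ?a2 = "a(i := a i - 1)"
  have e: "?a1(i := ?a1 i - 1) = a" "?a2(i := ?a2 i + 1) = a" by auto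
  have xi: "xi i ?a1 = xi i a" "xi i ?a2 = xi i a"
    using assms xi_shift[of i i a 1] xi_shift[of i i a "-1"] by simp_all
  have w: "wt i ?a1 = wt i a" "wt (i - 1) ?a1 = const (1 - c0) * wt (i - 1) a"
    using assms wt_shift[of i i a 1] wt_shift[of i "i - 1" a 1] by (auto simp: c0_def const_1 power_int_minus)
  have xx: "const (xi i a) * (const (inverse (c0 * xi i a)) * r) = const (inverse c0) * r" for r
  proof -
    have "xi i a * inverse (c0 * xi i a) = inverse c0 * (xi i a * inverse (xi i a))"
      by (simp only: inverse_mult_distrib mult_ac)
    then have "xi i a * inverse (c0 * xi i a) = inverse c0" using xi_nonzero[of i a] by simp
    then show ?thesis by (simp only: const_swap)
  qed
  have xx': "const (inverse (c0 * xi i a)) * (wtd i a * (const (xi i a) * r)) = const (inverse c0) * (wtd i a * r)" for r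
  proof -
    have "const (inverse (c0 * xi i a)) * (wtd i a * (const (xi i a) * r))
        = const (xi i a) * (const (inverse (c0 * xi i a)) * (wtd i a * r))" by (simp only: mult_ac)
    then show ?thesis by (simp only: xx)
  qed
  have w': "wtd i ?a1 = wt i a - const (1 - c0) * wt (i - 1) a" unfolding wtd_def w ..
  have "rep (x i * y i) \<phi> a = const (xi i a) * (const (inverse (c0 * xi i a)) * (wtd i ?a1 * \<phi> a))"
    by (simp only: rep_mult rep_gen gen_op.simps e xi)
  also have "\<dots> = const (inverse c0) * ((wt i a - const (1 - c0) * wt (i - 1) a) * \<phi> a)"
    unfolding xx w' ..
  also have "\<dots> = const (inverse c0) * (wtd i a * \<phi> a)
      + const (inverse c0) * (const c0 * (wt (i - 1) a * \<phi> a))"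
    by (simp add: const_diff const_1 wtd_def algebra_simps)
  also have "const (inverse c0) * (const c0 * (wt (i - 1) a * \<phi> a)) = wt (i - 1) a * \<phi> a"
    unfolding const_swap using c0_nonzero by (simp add: const_1)
  also have "const (inverse c0) * (wtd i a * \<phi> a)
      = const (inverse (c0 * xi i a)) * (wtd i a * (const (xi i ?a2) * \<phi> a))"
    unfolding xi xx' ..
  also have "\<dots> = rep (y i * x i) \<phi> a"
    by (simp only: rep_mult rep_gen gen_op.simps e)
  finally show ?thesis using assms by (simp add: rep_z)
qed

lemma rep_relations:
  assumes "r \<in> rels"
  shows "rep r \<phi> a = 0"
proof -
  have e1: "qe_q i * inverse (qe_p q j) * qe_gamma q i j = q" "qe_gamma q i j = inverse q"
    "qe_p q j * inverse (qe_gamma q i j) = inverse q" if "i < j" for i j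
    using that q_nonzero by (simp_all add: qe_q_def qe_p_def qe_gamma_def power2_eq_square)
  have e2: "qe_q j * inverse (qe_gamma q i j) = inverse q" if "j < i" for i j
    using that by (simp add: qe_q_def qe_gamma_def)
  show ?thesis
    using assms unfolding Kn_relations_def Let_def
  proof (elim UnE CollectE exE conjE)
    fix i j assume r: "r = x i * x j - fa_scalar (qe_q i * inverse (qe_p q j) * qe_gamma q i j) * x j * x i"
      and ij: "1 \<le> i" "i < j" "j \<le> n"
    show ?thesis unfolding r unfolding e1(1)[OF ij(2)] unfolding mult.assoc rep_diff using rep_x_x[OF ij] by simp
  next
    fix i j assume r: "r = y i * y j - fa_scalar (qe_gamma q i j) * y j * y i"
      and ij: "1 \<le> i" "i < j" "j \<le> n"
    show ?thesis unfolding r unfolding e1(2)[OF ij(2)] unfolding mult.assoc rep_diff using rep_y_y[OF ij] by simp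
  next
    fix i j assume r: "r = x i * y j - fa_scalar (qe_p q j * inverse (qe_gamma q i j)) * y j * x i"
      and ij: "1 \<le> i" "i < j" "j \<le> n"
    show ?thesis unfolding r unfolding e1(3)[OF ij(2)] unfolding mult.assoc rep_diff using rep_x_y[of i j] ij by simp
  next
    fix i j assume r: "r = x i * y j - fa_scalar (qe_q j * inverse (qe_gamma q i j)) * y j * x i"
      and ij: "1 \<le> j" "j < i" "i \<le> n"
    show ?thesis unfolding r unfolding e2[OF ij(2)] unfolding mult.assoc rep_diff using rep_x_y[of i j] ij by simp
  next
    fix i assume r: "r = x i * y i - fa_scalar (qe_q i) * y i * x i - (\<Sum>l = 1..i - 1. fa_scalar (qe_q l - qe_p q l) * y l * x l)"
      and i: "1 \<le> i" "i \<le> n"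
    have "r = x i * y i - y i * x i - z (i - 1)"
      unfolding r by (simp add: z_def c0_def qe_q_def qe_p_def fa_scalar_1 mult.assoc)
    then show ?thesis using rep_x_y_same[OF i, of \<phi> a] by (simp add: rep_diff)
  qed
qed

text \<open>The kernel is an ideal of the free algebra that contains the relations. Hence
  functionals built from \<open>rep\<close> descend to the quotient.\<close>

lemma rep_I:
  assumes "f \<in> I"
  shows "rep f \<phi> a = 0"
proof -
  let ?K = "{f \<in> Fn. \<forall>\<phi>. rep f \<phi> = (\<lambda>_. 0)}"
  have "I \<subseteq> ?K"
  proof (rule I_subset_ideal)
    show "rels \<subseteq> ?K"
      using Kn_relations_subset[of n "qe_p q" qe_q "qe_gamma q", unfolded carrier_free_algebra]
      by (auto simp: rep_relations fun_eq_iff)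
  qed (auto simp: fa_on_0 fa_on_diff fa_on_mult rep_zero rep_diff rep_mult rep_state_zero intro!: ext)
  then show ?thesis using assms by auto
qed

section \<open>Independence of the monomials z^j x^b\<close>

definition x_monomial :: "(nat \<Rightarrow> nat) \<Rightarrow> nat list \<Rightarrow> (gen, 'k) free_alg" where
  "x_monomial b ls = prod_list (map (\<lambda>l. x l ^ b l) ls)"

lemma x_monomial_on: "set ls \<subseteq> {1..n} \<Longrightarrow> x_monomial b ls \<in> Fn"
  unfolding x_monomial_def by (induction ls) (auto simp: fa_on_one intro!: fa_on_mult fa_on_power x_on)

lemma rep_1: "rep 1 \<phi> = \<phi>"
  using rep_mono[of "[]"] by (simp add: fa_mono_Nil word_op_def)

lemma rep_z_power: "i \<le> n \<Longrightarrow> rep (z i ^ k) \<phi> a = wt i a ^ k * \<phi> a"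
  by (induction k arbitrary: a) (simp_all add: rep_1 rep_mult rep_z mult.assoc)

lemma rep_z_monomial:
  "set ls \<subseteq> {..n} \<Longrightarrow> rep (z_monomial j ls) \<phi> a = prod_list (map (\<lambda>l. wt l a ^ j l) ls) * \<phi> a"
  by (induction ls) (simp_all add: z_monomial_def rep_1 rep_mult rep_z_power mult.assoc)

lemma rep_x_power: "\<exists>c. c \<noteq> 0 \<and> (\<forall>\<phi>. rep (x i ^ k) \<phi> a = const c * \<phi> (a(i := a i + int k)))"
proof (induction k arbitrary: a)
  case 0
  show ?case by (intro exI[of _ 1]) (simp add: rep_1 const_1)
next
  case (Suc k)
  let ?a = "a(i := a i + 1)"
  obtain c where c: "c \<noteq> 0" "\<And>\<phi>. rep (x i ^ k) \<phi> ?a = const c * \<phi> (?a(i := ?a i + int k))" using Suc by blast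
  have "?a(i := ?a i + int k) = a(i := a i + int (Suc k))" by auto
  then have "rep (x i ^ Suc k) \<phi> a = const (xi i a * c) * \<phi> (a(i := a i + int (Suc k)))" for \<phi>
    using c(2) by (simp add: rep_mult rep_gen const_mult mult.assoc del: fun_upd_apply)
  then show ?case using c(1) xi_nonzero[of i a] by (intro exI[of _ "xi i a * c"]) (simp del: fun_upd_apply)
qed

lemma rep_x_monomial:
  "distinct ls \<Longrightarrow> \<exists>c. c \<noteq> 0 \<and> (\<forall>\<phi>. rep (x_monomial b ls) \<phi> a
    = const c * \<phi> (\<lambda>l. a l + (if l \<in> set ls then int (b l) else 0)))"
proof (induction ls arbitrary: a)
  case Nil
  show ?case by (intro exI[of _ 1]) (simp add: x_monomial_def rep_1 const_1)
next
  case (Cons i ls)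
  obtain c where c: "c \<noteq> 0" "\<And>\<phi>. rep (x i ^ b i) \<phi> a = const c * \<phi> (a(i := a i + int (b i)))"
    using rep_x_power by blast
  let ?a = "a(i := a i + int (b i))"
  obtain d where d: "d \<noteq> 0" "\<And>\<phi>. rep (x_monomial b ls) \<phi> ?a
    = const d * \<phi> (\<lambda>l. ?a l + (if l \<in> set ls then int (b l) else 0))"
    using Cons.IH[of ?a] Cons.prems by (auto simp del: fun_upd_apply)
  have eq: "(\<lambda>l. ?a l + (if l \<in> set ls then int (b l) else 0)) = (\<lambda>l. a l + (if l \<in> set (i # ls) then int (b l) else 0))"
    using Cons.prems by auto
  have "rep (x_monomial b (i # ls)) \<phi> a = const (c * d) * \<phi> (\<lambda>l. a l + (if l \<in> set (i # ls) then int (b l) else 0))" for \<phi>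
  proof -
    have "x_monomial b (i # ls) = x i ^ b i * x_monomial b ls" by (simp add: x_monomial_def)
    then show ?thesis using c(2)[of "rep (x_monomial b ls) \<phi>"] d(2)[of \<phi>] unfolding eq
      by (simp only: rep_mult const_mult mult.assoc)
  qed
  then show ?case using c(1) d(1) by (intro exI[of _ "c * d"]) simp
qed

definition exponent :: "(nat \<Rightarrow> nat) \<Rightarrow> nat list \<Rightarrow> nat \<Rightarrow>\<^sub>0 nat" where
  "exponent j ls = sum_list (map (\<lambda>l. Poly_Mapping.single l (j l)) ls)"

lemma lookup_exponent: "distinct ls \<Longrightarrow> Poly_Mapping.lookup (exponent j ls) l = (if l \<in> set ls then j l else 0)"
  by (induction ls) (auto simp: exponent_def lookup_add lookup_single when_def)

text \<open>At the origin the power of \<open>q\<close> in the weight is 1, so the weight of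
  \<open>z i\<close> is the bare indeterminate t_i.\<close>

lemma wt_zero_power: "1 \<le> i \<Longrightarrow> wt i (\<lambda>_. 0) ^ k = Poly_Mapping.single (Poly_Mapping.single i k) 1"
proof (induction k)
  case 0
  then show ?case by simp
next
  case (Suc k)
  have "wt i (\<lambda>_. 0) = Poly_Mapping.single (Poly_Mapping.single i 1) 1"
    using Suc.prems by (simp add: wt_def tvar_def const_1)
  then show ?case using Suc by (simp add: mult_single single_add[symmetric])
qed

lemma wt_zero_monomial:
  "set ls \<subseteq> {1..n} \<Longrightarrow> prod_list (map (\<lambda>l. wt l (\<lambda>_. 0) ^ j l) ls) = Poly_Mapping.single (exponent j ls) 1"
  by (induction ls) (auto simp: exponent_def wt_zero_power mult_single)

text \<open>Dual functionals for z^j x^b: apply the element to the indicator of the lattice point b,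
  evaluate at the origin, read off the coefficient of t^j. The x part reaches that point only for
  the right b, and the z part gives t^j. There are 2 n exponents up to k, hence degree 2 n
  k.\<close>

lemma power_sum_dim_lower:
  "\<exists>V\<in>fd_subspaces PA. \<forall>k. (k + 1) ^ (2 * n) \<le> subspace_dim PA (power_sum PA V (2 * n * k))"
proof -
  interpret K: kspace PA by (rule kspace_PA)
  let ?ls = "[1..<Suc n]"
  have ls: "set ?ls = {1..n}" "length ?ls = n" "distinct ?ls" by auto
  define E where "E = z ` {1..n} \<union> x ` {1..n}"
  have E: "finite E" "E \<subseteq> Fn" by (auto simp: E_def intro: z_on x_on)
  define V where "V = proj ` FA.span E"
  have V: "V \<in> fd_subspaces PA" unfolding V_def fd_subspaces_PA_iff using E by blast
  define mon where "mon j b = z_monomial j ?ls * x_monomial b ?ls" for j b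
  have mon_on: "mon j b \<in> Fn" for j b
    unfolding mon_def using ls(1) by (intro fa_on_mult z_monomial_on x_monomial_on) auto
  define hat where "hat b = (\<lambda>l. if l \<in> {1..n} then int (b l) else 0)" for b :: "nat \<Rightarrow> nat"
  define delta where "delta b = (\<lambda>a. if a = hat b then 1 else 0 :: 'k coeff)" for b
  define fnl where "fnl j b f = Poly_Mapping.lookup (rep f (delta b) (\<lambda>_. 0)) (exponent j ?ls)" for j b f
  have val: "fnl j b (mon j' b') = 0 \<longleftrightarrow> \<not> (exponent j ?ls = exponent j' ?ls \<and> hat b = hat b')" for j b j' b'
  proof -
    obtain c where c: "c \<noteq> 0" "\<And>\<phi>. rep (x_monomial b' ?ls) \<phi> (\<lambda>_. 0)
      = const c * \<phi> (\<lambda>l. 0 + (if l \<in> set ?ls then int (b' l) else 0))"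
      using rep_x_monomial[OF ls(3), of b' "\<lambda>_. 0"] by blast
    have h: "(\<lambda>l. 0 + (if l \<in> set ?ls then int (b' l) else 0)) = hat b'"
      unfolding ls(1) hat_def by simp
    have x: "rep (x_monomial b' ?ls) (delta b) (\<lambda>_. 0) = const c * delta b (hat b')"
      using c(2)[of "delta b"] unfolding h .
    have "rep (mon j' b') (delta b) (\<lambda>_. 0)
        = prod_list (map (\<lambda>l. wt l (\<lambda>_. 0) ^ j' l) ?ls) * rep (x_monomial b' ?ls) (delta b) (\<lambda>_. 0)"
      unfolding mon_def rep_mult by (rule rep_z_monomial) (use ls(1) in auto)
    also have "\<dots> = Poly_Mapping.single (exponent j' ?ls) 1 * (const c * delta b (hat b'))"
      unfolding x by (subst wt_zero_monomial) (simp_all only: ls(1) order.refl)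
    also have "\<dots> = (if hat b = hat b' then Poly_Mapping.single (exponent j' ?ls) c else 0)"
      by (auto simp: delta_def const_def mult_single simp del: upt_Suc)
    finally show ?thesis using c(1) by (auto simp: fnl_def lookup_single when_def simp del: upt_Suc)
  qed
  \<comment> \<open>An arbitrary lift. The functionals vanish on the relation ideal, so their values
    do not depend on the choice.\<close>
  define rp where "rp U = (SOME f. f \<in> Fn \<and> U = proj f)" for U
  have fnl_I: "fnl j b f = 0" if "f \<in> I" for j b f
    by (simp add: fnl_def rep_I[OF that])
  have fnl_add: "fnl j b (f + g) = fnl j b f + fnl j b g" for j b f g
    by (simp add: fnl_def rep_add lookup_add)
  have fnl_scale: "fnl j b (fa_scalar c * f) = c * fnl j b f" for j b c f
  proof -
    have "Poly_Mapping.lookup (const c * r) e = c * Poly_Mapping.lookup r e" for r and e :: "nat \<Rightarrow>\<^sub>0 nat"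
    proof (induction r rule: update_induct)
      case (update r m d)
      have "Poly_Mapping.update m d r = r + Poly_Mapping.single m d"
        using update(1) by (intro poly_mapping_eqI) (auto simp: lookup_update lookup_add lookup_single in_keys_iff)
      then show ?case using update
        by (simp add: distrib_left lookup_add) (simp add: const_def mult_single lookup_single when_def)
    qed simp
    then show ?thesis by (simp add: fnl_def rep_scale)
  qed
  have fnl_rp: "fnl j b (rp (proj f)) = fnl j b f" if f: "f \<in> Fn" for j b f
  proof -
    have "rp (proj f) \<in> Fn \<and> proj f = proj (rp (proj f))"
      unfolding rp_def by (rule someI[of _ f]) (use f in simp)
    then have "rp (proj f) - f \<in> I" using f by (intro proj_eqD) auto
    then show ?thesis using fnl_add[of j b "rp (proj f) - f" f] fnl_I by simp
  qed
  have "(k + 1) ^ (2 * n) \<le> subspace_dim PA (power_sum PA V (2 * n * k))" for k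
  proof -
    let ?B = "{1..n} \<rightarrow>\<^sub>E {..k}"
    let ?W = "power_sum PA V (2 * n * k)"
    have W: "?W = proj ` FA.span (fa_products E (2 * n * k))" unfolding V_def by (rule power_sum_image[OF E(2)])
    have Wfd: "?W \<in> fd_subspaces PA"
      unfolding W fd_subspaces_PA_iff using finite_fa_products[OF E(1)] fa_products_on[OF E(2)] by blast
    note Won = fa_span_subset_on[OF fa_products_on[OF E(2)], of "2 * n * k"]
    have "card (?B \<times> ?B) \<le> subspace_dim PA ?W"
    proof (rule K.dim_ge_dual_family[OF Wfd, of "?B \<times> ?B" "\<lambda>(j, b). proj (mon j b)" "\<lambda>(j, b) U. fnl j b (rp U)"])
      show "finite (?B \<times> ?B)" by (intro finite_cartesian_product finite_PiE) auto
      fix p assume "p \<in> ?B \<times> ?B"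
      then obtain j b where p: "p = (j, b)" "j \<in> ?B" "b \<in> ?B" by auto
      have "z_monomial j ?ls \<in> fa_products E (length ?ls * k)"
        unfolding z_monomial_def using p ls(1) by (intro prod_list_powers_products) (auto simp: E_def simp del: upt_Suc)
      moreover have "x_monomial b ?ls \<in> fa_products E (length ?ls * k)"
        unfolding x_monomial_def using p ls(1) by (intro prod_list_powers_products) (auto simp: E_def simp del: upt_Suc)
      ultimately have "mon j b \<in> fa_products E (n * k + n * k)"
        unfolding mon_def ls(2) by (rule fa_products_mult)
      then have "mon j b \<in> fa_products E (2 * n * k)" by (simp add: mult_2 distrib_right)
      then show "(case p of (j, b) \<Rightarrow> proj (mon j b)) \<in> ?W"
        unfolding W p(1) prod.case by (intro imageI FA.span_base)
      show "linear_functional_on PA ?W (case p of (j, b) \<Rightarrow> \<lambda>U. fnl j b (rp U))"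
        unfolding linear_functional_on_def p(1) prod.case
      proof (intro conjI ballI allI)
        fix u v assume "u \<in> ?W" "v \<in> ?W"
        then obtain f g where fg: "u = proj f" "v = proj g" "f \<in> Fn" "g \<in> Fn"
          unfolding W using Won by blast
        then show "fnl j b (rp (u \<oplus>\<^bsub>PA\<^esub> v)) = fnl j b (rp u) + fnl j b (rp v)"
          by (simp add: proj_add[symmetric] fnl_rp fa_on_add fnl_add)
      next
        fix c u assume "u \<in> ?W"
        then obtain f where f: "u = proj f" "f \<in> Fn" unfolding W using Won by blast
        then show "fnl j b (rp (c \<odot>\<^bsub>PA\<^esub> u)) = c * fnl j b (rp u)"
          by (simp add: proj_scalar[symmetric] fnl_rp fa_on_mult fa_on_scalar fnl_scale)
      qed
      fix p' assume "p' \<in> ?B \<times> ?B"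
      then obtain j' b' where p': "p' = (j', b')" "j' \<in> ?B" "b' \<in> ?B" by auto
      have "j = j'" if "exponent j ?ls = exponent j' ?ls"
      proof (rule PiE_ext[OF p(2) p'(2)])
        fix l assume "l \<in> {1..n}"
        then show "j l = j' l"
          using arg_cong[OF that, of "\<lambda>e. Poly_Mapping.lookup e l"] ls(1) unfolding lookup_exponent[OF ls(3)] by (simp del: upt_Suc)
      qed
      moreover have "b = b'" if "hat b = hat b'"
      proof (rule PiE_ext[OF p(3) p'(3)])
        fix l assume "l \<in> {1..n}"
        then show "b l = b' l" using fun_cong[OF that, of l] by (simp add: hat_def)
      qed
      ultimately show "((case p of (j, b) \<Rightarrow> \<lambda>U. fnl j b (rp U)) (case p' of (j, b) \<Rightarrow> proj (mon j b)) = 0) = (p \<noteq> p')"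
        unfolding p(1) p'(1) prod.case fnl_rp[OF mon_on] val by auto
    qed
    moreover have "card (?B \<times> ?B) = (k + 1) ^ (2 * n)"
      by (simp add: card_cartesian_product card_PiE power_add[symmetric] mult_2)
    ultimately show ?thesis by simp
  qed
  then show ?thesis using V by blast
qed

end

section \<open>Gelfand--Kirillov dimensions\<close>

lemma ln_real_at_top: "filterlim (\<lambda>k. ln (real k)) at_top sequentially"
  by (rule filterlim_compose[OF ln_at_top filterlim_real_sequentially])

text \<open>The constant \<open>C\<close> contributes ln C / ln k, which tends to 0.\<close>

lemma growth_exponent_le:
  assumes C: "C \<ge> 1" and le: "\<And>k. k \<ge> 1 \<Longrightarrow> d k \<le> (C * k) ^ m"
  shows "growth_exponent d \<le> ereal (real m)"
proof -
  let ?g = "\<lambda>k. real m * (ln (real C) / ln (real k) + 1)"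
  have "log (real k) (real (d k)) \<le> ?g k" if k: "k \<ge> 2" for k
  proof (cases "d k = 0")
    \<comment> \<open>By convention \<open>ln 0 = 0\<close>, so a vanishing dimension counts as
      exponent 0.\<close>
    case True
    then show ?thesis using k C by (simp add: log_def)
  next
    case False
    have "real (d k) \<le> (real C * real k) ^ m" using le[of k] k of_nat_mono[of "d k" "(C * k) ^ m"] by simp
    then have "ln (real (d k)) \<le> ln ((real C * real k) ^ m)" using False by (subst ln_le_cancel_iff) (use C k in auto)
    also have "\<dots> = real m * (ln (real C) + ln (real k))" using C k by (simp add: ln_realpow ln_mult)
    finally have "ln (real (d k)) / ln (real k) \<le> real m * (ln (real C) + ln (real k)) / ln (real k)"
      using k by (intro divide_right_mono) auto
    also have "\<dots> = ?g k" using k by (simp add: field_simps)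
    finally show ?thesis by (simp add: log_def)
  qed
  then have "\<forall>\<^sub>F k in sequentially. ereal (log (real k) (real (d k))) \<le> ereal (?g k)"
    unfolding eventually_sequentially by auto
  then have "growth_exponent d \<le> limsup (\<lambda>k. ereal (?g k))"
    unfolding growth_exponent_def by (rule Limsup_mono)
  also have "\<dots> = ereal (real m)"
  proof (rule lim_imp_Limsup)
    have "(\<lambda>k. ln (real C) / ln (real k)) \<longlonglongrightarrow> 0"
      by (intro tendsto_divide_0[OF tendsto_const] filterlim_at_top_imp_at_infinity ln_real_at_top)
    then have "?g \<longlonglongrightarrow> real m * (0 + 1)" by (intro tendsto_intros)
    then show "(\<lambda>k. ereal (?g k)) \<longlonglongrightarrow> ereal (real m)" by (simp add: tendsto_ereal)
  qed simp
  finally show ?thesis .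
qed

text \<open>If the exponent were below some e < r, then d (a k) d (b k) would be at most (a b k^2)^e
  for large k, which is eventually smaller than k^(2 r). Taking the product of two values fits the
  Bernstein inequality.\<close>

lemma growth_exponent_ge:
  assumes ab: "a \<ge> 1" "b \<ge> 1" and ge: "\<And>k. (k + 1) ^ (2 * r) \<le> d (a * k) * d (b * k)"
  shows "ereal (real r) \<le> growth_exponent d"
proof (rule ccontr)
  assume "\<not> ?thesis"
  then have "growth_exponent d < ereal (real r)" by simp
  then obtain e where e: "growth_exponent d < ereal e" "e < real r"
    using ereal_dense2[of "growth_exponent d" "ereal (real r)"] by auto
  have "\<forall>\<^sub>F k in sequentially. ereal (log (real k) (real (d k))) < ereal e"
    using e(1) unfolding growth_exponent_def by (rule Limsup_lessD)
  then obtain K where K: "\<And>k. k \<ge> K \<Longrightarrow> log (real k) (real (d k)) < e"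
    by (auto simp: eventually_sequentially)
  have bound: "ln (real (d (c * k))) \<le> e * (ln (real c) + ln (real k))"
    if k: "k \<ge> max 2 K" and c: "c \<ge> 1" for k c
  proof -
    have "k \<le> c * k" using c by simp
    then have ck: "c * k \<ge> 2" "c * k \<ge> K" using k by linarith+
    have pos: "0 < ln (real (c * k))" using ck(1) by (intro ln_gt_zero) linarith
    then have "ln (real (d (c * k))) < e * ln (real (c * k))"
      using K[OF ck(2)] by (simp add: log_def pos_divide_less_eq del: of_nat_mult)
    also have "ln (real (c * k)) = ln (real c) + ln (real k)" using c k by (simp add: ln_mult)
    finally show ?thesis by simp
  qed
  have main: "2 * (real r - e) * ln (real k) \<le> e * (ln (real a) + ln (real b))" if k: "k \<ge> max 2 K" for k
  proof -
    \<comment> \<open>Neither factor vanishes, as needed to split the logarithm of the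
      product.\<close>
    have prod: "1 \<le> d (a * k) * d (b * k)" using ge[of k] by (meson le_trans one_le_power le_add2)
    then have d: "d (a * k) \<noteq> 0" "d (b * k) \<noteq> 0" by (metis mult_zero_left not_one_le_zero) (metis prod mult_zero_right not_one_le_zero)
    have "k ^ (2 * r) \<le> (k + 1) ^ (2 * r)" by (rule power_mono) simp_all
    then have "k ^ (2 * r) \<le> d (a * k) * d (b * k)" using ge[of k] by linarith
    then have "real (k ^ (2 * r)) \<le> real (d (a * k) * d (b * k))" by (rule of_nat_mono)
    then have "ln (real k ^ (2 * r)) \<le> ln (real (d (a * k)) * real (d (b * k)))"
      using k d by (subst ln_le_cancel_iff) auto
    then have "real (2 * r) * ln (real k) \<le> ln (real (d (a * k))) + ln (real (d (b * k)))"
      using k d by (simp add: ln_realpow ln_mult)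
    also have "\<dots> \<le> e * (ln (real a) + ln (real k)) + e * (ln (real b) + ln (real k))"
      by (intro add_mono bound k ab)
    finally show ?thesis by (simp add: algebra_simps)
  qed
  have "\<forall>\<^sub>F k in sequentially. e * (ln (real a) + ln (real b)) / (2 * (real r - e)) < ln (real k)"
    using ln_real_at_top by (simp add: filterlim_at_top_dense)
  then obtain k0 where k0: "\<And>k. k \<ge> k0 \<Longrightarrow> e * (ln (real a) + ln (real b)) / (2 * (real r - e)) < ln (real k)"
    by (auto simp: eventually_sequentially)
  let ?k = "max k0 (max 2 K)"
  have "e * (ln (real a) + ln (real b)) < 2 * (real r - e) * ln (real ?k)"
    using k0[of ?k] e(2) by (simp add: pos_divide_less_eq mult.commute del: of_nat_max)
  then show False using main[of ?k] by simp
qed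

lemma growth_exponent_nonneg: "0 \<le> growth_exponent d"
proof -
  have "0 \<le> log (real k) (real (d k))" if "k \<ge> 2" for k
    using that by (cases "d k = 0") (auto simp: log_def intro!: divide_nonneg_nonneg)
  then have "\<forall>\<^sub>F k in sequentially. (0 :: ereal) \<le> ereal (log (real k) (real (d k)))"
    unfolding eventually_sequentially by (auto simp: zero_ereal_def)
  then have "limsup (\<lambda>k. 0 :: ereal) \<le> growth_exponent d"
    unfolding growth_exponent_def by (rule Limsup_mono)
  then show ?thesis by (simp add: Limsup_const)
qed

lemma (in quantum_euclid) GK_dim_eq:
  assumes "1 \<le> n"
  shows "GK_dim PA = ereal (2 * real n)"
proof (rule antisym)
  show "GK_dim PA \<le> ereal (2 * real n)"
    unfolding GK_dim_def
  proof (rule SUP_least)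
    fix V assume V: "V \<in> fd_subspaces PA"
    then obtain d where d: "\<And>k. subspace_dim PA (power_sum PA V k) \<le> (d * k + 1) ^ (2 * n)"
      using power_sum_dim_upper by blast
    have "subspace_dim PA (power_sum PA V k) \<le> ((d + 1) * k) ^ (2 * n)" if "k \<ge> 1" for k
      using order.trans[OF d power_mono[of "d * k + 1" "(d + 1) * k" "2 * n"]] that by simp
    then show "growth_exponent (\<lambda>k. subspace_dim PA (power_sum PA V k)) \<le> ereal (2 * real n)"
      using growth_exponent_le[of "d + 1" "\<lambda>k. subspace_dim PA (power_sum PA V k)" "2 * n"] by simp
  qed
  obtain V where V: "V \<in> fd_subspaces PA"
    "\<And>k. (k + 1) ^ (2 * n) \<le> subspace_dim PA (power_sum PA V (2 * n * k))"
    using power_sum_dim_lower by blast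
  let ?d = "\<lambda>k. subspace_dim PA (power_sum PA V k)"
  \<comment> \<open>The single bound is squared to fit the product form, with r = 2 n and both
    scales equal.\<close>
  have "(k + 1) ^ (2 * (2 * n)) \<le> ?d (2 * n * k) * ?d (2 * n * k)" for k
    using mult_mono[OF V(2)[of k] V(2)[of k]] by (simp add: power_add[symmetric] mult_2)
  then have "ereal (real (2 * n)) \<le> growth_exponent ?d"
    using assms by (intro growth_exponent_ge[of "2 * n" "2 * n"]) auto
  also have "\<dots> \<le> GK_dim PA" unfolding GK_dim_def by (rule SUP_upper[OF V(1)])
  finally show "ereal (2 * real n) \<le> GK_dim PA" by simp
qed

lemma (in quantum_euclid_module) GK_dim_module_ge:
  assumes n: "1 \<le> n" and nt: "\<not> torsion_module (quantum_euclidean_Z n q) M"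
  shows "ereal (real (n - 1)) \<le> GK_dim_module PA M"
proof -
  define s where "s = 2 * (n - 1)"
  obtain E m where E: "finite E" "E \<subseteq> Fn" "m \<in> carrier US"
    and dim: "\<And>k. (k + 1) ^ s \<le> subspace_dim US (orbit_space E m (4 * s * s * k)) *
      subspace_dim US (orbit_space E m ((4 * s * s + s) * k))"
    using orbit_dim_product[OF n nt] unfolding s_def by blast
  have "ereal (real (n - 1)) \<le> growth_exponent (\<lambda>k. subspace_dim US (orbit_space E m k))"
  proof (cases "n = 1")
    \<comment> \<open>Here s = 0 and both scales would be 0, outside the range of
      \<open>growth_exponent_ge\<close>; the claim is only nonnegativity.\<close>
    case True
    then show ?thesis using growth_exponent_nonneg by (simp add: zero_ereal_def[symmetric])
  next
    case False
    then have "1 \<le> s" using n by (simp add: s_def)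
    then show ?thesis using dim
      by (intro growth_exponent_ge[of "4 * s * s" "4 * s * s + s" "n - 1"]) (simp_all add: s_def)
  qed
  also have "\<dots> \<le> GK_dim_module PA M" by (rule growth_le_GK_dim_module[OF E(2,1,3)])
  finally show ?thesis .
qed

theorem corollary1p3:
  fixes q :: "'k::field" and n :: nat
    and M :: "((gen, 'k) free_alg set, 'm) module"
  assumes "n \<ge> 1"
    and "q \<noteq> 0" and "\<And>k::nat. k \<ge> 1 \<Longrightarrow> q ^ k \<noteq> 1"
    and "right_module (quantum_euclidean n q) M"
    and "carrier M \<noteq> {\<zero>\<^bsub>M\<^esub>}"
    and "fin_gen_module (quantum_euclidean n q) M"
    and "\<not> torsion_module (quantum_euclidean_Z n q) M"
  shows "GK_dim_module (quantum_euclidean n q) M \<ge> ereal (real n - 1) \<and>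
         ereal (real n - 1) = GK_dim (quantum_euclidean n q) / 2 - 1"
proof -
  interpret quantum_euclid n q by unfold_locales (use assms(2,3) in auto)
  interpret quantum_euclid_module n q M
    using assms(4) unfolding quantum_euclidean_eq
    by (intro quantum_euclid_module.intro presentation_module.intro presentation_module_axioms.intro
        quantum_euclid_axioms presentation_axioms)
  have n: "real (n - 1) = real n - 1" using assms(1) by (simp add: of_nat_diff)
  have "ereal (real n - 1) \<le> GK_dim_module PA M" using GK_dim_module_ge[OF assms(1,7)] by (simp only: n)
  moreover have "ereal (real n - 1) = GK_dim PA / 2 - 1"
    unfolding GK_dim_eq[OF assms(1)] numeral_eq_ereal one_ereal_def by simp
  ultimately show ?thesis by (simp only: quantum_euclidean_eq)
qed

end
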